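(* For every positive integer $k$ there exist a bounded pseudoconvex domain $D\subset\mathbb C^3$ with $C^k$-smooth boundary, a point $P\in\partial D$, a number $\varepsilon>0$, and a decreasing sequence $(\delta_\nu)_{\nu}$ of positive numbers with $\delta_\nu\to0$ and $P_{\delta_\nu}:=P-\delta_\nu n\in D$ for all $\nu$, such that $$\kappa_D(P_{\delta_\nu};n)\le \frac{1}{\delta_\nu^{1-\varepsilon}}\quad\text{for all }\nu,$$ where $n$ denotes the unit outward normal vector to $\partial D$ at $P$.
   Context: For a domain $D\subset\mathbb C^m$, $z\in D$ and $X\in\mathbb C^m$, the Kobayashi–Royden (pseudo)metric is $\kappa_D(z;X):=\inf\{\alpha>0:\ \text{there is } f\in\mathcal O(\mathbb D,D)\text{ with } f(0)=z,\ \alpha f'(0)=X\}$, where $\mathbb D$ is the open unit disc in $\mathbb C$ and $\mathcal O(\mathbb D,D)$ is the set of holomorphic maps $\mathbb D\to D$. *)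

theory Defs
  imports "HOL-Analysis.Analysis"
begin

text \<open>C^3 is modelled as the type complex^3 (with the standard Euclidean / Hermitian
norm; its real inner product is the real part of the Hermitian product).\<close>

text \<open>C^k functions (k-times continuously Frechet differentiable) from a real normed
space to the reals on an open set U.  g vs x is the iterated derivative of f at x
applied to the list of directions vs (innermost derivative direction last in the list).\<close>
definition Ck_on :: "nat \<Rightarrow> 'a::real_normed_vector set \<Rightarrow> ('a \<Rightarrow> real) \<Rightarrow> bool" where
  "Ck_on k U f \<longleftrightarrow> open U \<and>
     (\<exists>g :: 'a list \<Rightarrow> 'a \<Rightarrow> real.
        (\<forall>x\<in>U. g [] x = f x) \<and>
        (\<forall>vs. length vs \<le> k \<longrightarrow> continuous_on U (g vs)) \<and>
        (\<forall>vs. length vs < k \<longrightarrow>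
            (\<forall>x\<in>U. (g vs has_derivative (\<lambda>h. g (h # vs) x)) (at x))))"

definition domain :: "'a::topological_space set \<Rightarrow> bool" where
  "domain D \<longleftrightarrow> open D \<and> connected D \<and> D \<noteq> {}"

definition Ck_boundary :: "nat \<Rightarrow> (complex^3) set \<Rightarrow> bool" where
  "Ck_boundary k D \<longleftrightarrow>
     (\<exists>U \<rho>. open U \<and> frontier D \<subseteq> U \<and> Ck_on k U \<rho> \<and>
        D \<inter> U = {z\<in>U. \<rho> z < 0} \<and>
        (\<forall>p\<in>frontier D. \<forall>L. (\<rho> has_derivative L) (at p) \<longrightarrow> L \<noteq> (\<lambda>_. 0)))"

definition unit_outward_normal :: "(complex^3) set \<Rightarrow> complex^3 \<Rightarrow> complex^3 \<Rightarrow> bool" where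
  "unit_outward_normal D P n \<longleftrightarrow> P \<in> frontier D \<and> norm n = 1 \<and>
     (\<exists>U \<rho> L. open U \<and> P \<in> U \<and> D \<inter> U = {z\<in>U. \<rho> z < 0} \<and>
        (\<rho> has_derivative L) (at P) \<and>
        (\<exists>c>0. \<forall>h. L h = c * inner n h))"

text \<open>Pseudoconvexity: -log of the Euclidean boundary distance is plurisubharmonic on D,
i.e. (being continuous) satisfies the sub-mean-value inequality on every closed
analytic disc {a + zeta b : |zeta| <= r} contained in D.\<close>
definition pseudoconvex :: "(complex^3) set \<Rightarrow> bool" where
  "pseudoconvex D \<longleftrightarrow>
     (let \<phi> = (\<lambda>z. - ln (infdist z (- D))) in
      \<forall>a b r. a \<in> D \<and> r > 0 \<and> (\<forall>\<zeta>. cmod \<zeta> \<le> r \<longrightarrow> a + \<zeta> *s b \<in> D) \<longrightarrow>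
        \<phi> a \<le> (1 / (2 * pi)) *
              integral {0..2*pi} (\<lambda>t. \<phi> (a + (of_real r * exp (\<i> * of_real t)) *s b)))"

definition holo_disc :: "(complex \<Rightarrow> complex^3) \<Rightarrow> (complex^3) set \<Rightarrow> bool" where
  "holo_disc f D \<longleftrightarrow> (\<forall>i. (\<lambda>\<zeta>. f \<zeta> $ i) holomorphic_on ball 0 1) \<and> f ` ball 0 1 \<subseteq> D"

definition vderiv0 :: "(complex \<Rightarrow> complex^3) \<Rightarrow> complex^3" where
  "vderiv0 f = (\<chi> i. deriv (\<lambda>\<zeta>. f \<zeta> $ i) 0)"

definition kobayashi :: "(complex^3) set \<Rightarrow> complex^3 \<Rightarrow> complex^3 \<Rightarrow> real" where
  "kobayashi D z X = Inf {\<alpha>::real. \<alpha> > 0 \<and>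
       (\<exists>f. holo_disc f D \<and> f 0 = z \<and> of_real \<alpha> *s vderiv0 f = X)}"

end

theory Submission
  imports Defs "HOL-Complex_Analysis.Cauchy_Integral_Formula"
begin

text \<open>
  The discs wind around the cusp \<open>y\<^sup>3 = z\<^sup>2\<close>, parametrised by \<open>\<xi> \<mapsto> (\<xi>\<^sup>2, \<xi>\<^sup>3)\<close>: this map has zero
  derivative at \<open>0\<close>, so a disc \<open>\<zeta> \<mapsto> (w \<zeta>, (R \<zeta>)\<^sup>2, (R \<zeta>)\<^sup>3)\<close> can have a purely normal derivative,
  while \<open>\<xi> = z / y\<close> still is a coordinate away from \<open>0\<close>.  On the cusp the function
  \<open>8 ln (|\<xi>|\<^sup>2 / 4) - Re \<xi>\<close> is harmonic for large \<open>\<xi>\<close> and can be glued to \<open>0\<close> near the origin and, off the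
  cusp, to a multiple of \<open>|y\<^sup>3 - z\<^sup>2|\<^sup>2\<close> minus a constant, giving a \<open>C\<^sup>k\<close> plurisubharmonic function whose
  derivatives grow polynomially.  Rescaled by \<open>\<xi> \<mapsto> \<xi> / r\<close> and multiplied by \<open>r\<^sup>K\<close>, it has small
  \<open>C\<^sup>k\<close> norm, vanishes for \<open>|\<xi>| < r\<close> and is \<open>\<le> O (r\<^sup>K ln (1 / r)) - r\<^bsup>K-1\<^esup> Re \<xi>\<close> on the cusp.
  The linear term compensates \<open>Re w\<close> with \<open>w' = r\<^bsup>K-1\<^esup> R\<close> at a distance to the boundary of only
  about \<open>r\<^sup>K ln (1 / r)\<close>, which is a power gain.  Summing over a superexponentially decreasing
  sequence of scales \<open>r\<close>, the coarser summands vanish on the disc, and the finer ones are negligible.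
\<close>

subsection \<open>Means over the unit circle\<close>

text \<open>Count of exponents. For \<open>R = rad \<nu>\<close> the disc has first coordinate
  \<open>- \<delta> + A * \<zeta>\<close>, runs around the cusp at radius \<open>R\<close>, and is
  compensated by the summand of scale \<open>r = R ^ 4\<close>. Matching the linear terms forces
  \<open>A = r ^ (K - 1) * R = R ^ (4 * K - 3)\<close>. All errors together are a constant times
  \<open>R ^ (4 * K - 1)\<close>, one factor \<open>1 / R\<close> being spent on the logarithm.
  Hence \<open>\<delta> = R ^ (4 * K - 2)\<close> fits in between, and
  \<open>A = \<delta> powr (1 - \<epsilon>)\<close> with
  \<open>\<epsilon> = 1 / (4 * K - 2)\<close>, which depends on \<open>k\<close> through
  \<open>K\<close>. The obstacle is that \<open>\<xi> = z / y\<close> is not smooth at the origin,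
  so \<open>- Re \<xi>\<close> has to be cut off there. A function that is constant near the origin
  and nonconstant harmonic further out must gain in its circular means to be subharmonic in between;
  the logarithm is the price of this gain. Plurisubharmonicity is expressed by mean values
  throughout, as pseudoconvexity is, and no Levi form is computed.\<close>

definition circ_mean :: "(complex \<Rightarrow> real) \<Rightarrow> real" where
  "circ_mean u = integral {0..2*pi} (\<lambda>t. u (cis t)) / (2*pi)"

lemma circ_integrable:
  fixes u :: "complex \<Rightarrow> real"
  assumes "continuous_on (sphere 0 1) u"
  shows "(\<lambda>t. u (cis t)) integrable_on {0..2*pi}"
proof (rule integrable_continuous_real)
  show "continuous_on {0..2*pi} (\<lambda>t. u (cis t))"
    by (rule continuous_on_compose2[OF assms]) (auto intro!: continuous_intros)
qed

lemma circ_mean_const [simp]: "circ_mean (\<lambda>_. c) = c"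
  by (simp add: circ_mean_def)

lemma circ_mean_cong:
  assumes "\<And>\<zeta>. cmod \<zeta> = 1 \<Longrightarrow> u \<zeta> = v \<zeta>"
  shows "circ_mean u = circ_mean v"
  using assms by (auto simp: circ_mean_def intro!: integral_cong)

lemma circ_mean_mono:
  assumes "continuous_on (sphere 0 1) u" "continuous_on (sphere 0 1) v"
    and "\<And>\<zeta>. cmod \<zeta> = 1 \<Longrightarrow> u \<zeta> \<le> v \<zeta>"
  shows "circ_mean u \<le> circ_mean v"
  unfolding circ_mean_def
  by (intro divide_right_mono integral_le circ_integrable assms) (auto intro: assms)

lemma circ_mean_add:
  assumes "continuous_on (sphere 0 1) u" "continuous_on (sphere 0 1) v"
  shows "circ_mean (\<lambda>\<zeta>. u \<zeta> + v \<zeta>) = circ_mean u + circ_mean v"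
  unfolding circ_mean_def
  by (simp add: integral_add[OF circ_integrable[OF assms(1)] circ_integrable[OF assms(2)]] add_divide_distrib)

lemma circ_mean_cmult: "circ_mean (\<lambda>\<zeta>. c * u \<zeta>) = c * circ_mean u"
  unfolding circ_mean_def by simp

lemma circ_mean_le_const:
  assumes "continuous_on (sphere 0 1) u" "\<And>\<zeta>. cmod \<zeta> = 1 \<Longrightarrow> u \<zeta> \<le> c"
  shows "circ_mean u \<le> c"
  using circ_mean_mono[OF assms(1) continuous_on_const assms(2)] by simp

lemma circ_mean_less_0:
  assumes "continuous_on (sphere 0 1) u" "\<And>\<zeta>. cmod \<zeta> = 1 \<Longrightarrow> u \<zeta> < 0"
  shows "circ_mean u < 0"
proof -
  have "compact (sphere (0::complex) 1)" "sphere (0::complex) 1 \<noteq> {}" by auto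
  from continuous_attains_sup[OF this assms(1)] obtain x
    where x: "x \<in> sphere 0 1" "\<And>y. y \<in> sphere 0 1 \<Longrightarrow> u y \<le> u x" by blast
  have "circ_mean u \<le> u x"
    by (rule circ_mean_le_const[OF assms(1)]) (use x in auto)
  with assms(2)[of x] x(1) show ?thesis by (auto simp: dist_norm)
qed

text \<open>Cauchy's formula at the centre, where the kernel \<open>1 / \<zeta>\<close> cancels
  against the velocity of the circle.\<close>

lemma holomorphic_mean_value:
  fixes f :: "complex \<Rightarrow> complex"
  assumes "f holomorphic_on ball 0 R" "R > 1"
  shows "((\<lambda>t. f (cis t)) has_integral (2 * pi * f 0)) {0..2*pi}"
proof -
  have "f holomorphic_on cball 0 1"
    using assms(2) by (intro holomorphic_on_subset[OF assms(1)]) auto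
  from Cauchy_integral_circlepath_simple[OF this, of 0]
  have "((\<lambda>u. f u / u) has_contour_integral 2 * of_real pi * \<i> * f 0) (part_circlepath 0 1 0 (2*pi))"
    by (simp add: circlepath_def)
  hence "((\<lambda>t. f (cis t) / cis t * \<i> * cis t) has_integral 2 * of_real pi * \<i> * f 0) {0..2*pi}"
    by (subst (asm) has_contour_integral_part_circlepath_iff) auto
  hence "((\<lambda>t. \<i> * f (cis t)) has_integral \<i> * (2 * of_real pi * f 0)) {0..2*pi}"
    by (simp add: mult_ac)
  hence "((\<lambda>t. (-\<i>) * (\<i> * f (cis t))) has_integral (-\<i>) * (\<i> * (2 * of_real pi * f 0))) {0..2*pi}"
    by (rule has_integral_mult_right)
  thus ?thesis by (simp add: mult.assoc[symmetric])
qed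

lemma circ_mean_Re_holomorphic:
  assumes "f holomorphic_on ball 0 R" "R > 1"
  shows "circ_mean (\<lambda>\<zeta>. Re (f \<zeta>)) = Re (f 0)"
proof -
  have "((\<lambda>t. Re (f (cis t))) has_integral Re (2 * pi * f 0)) {0..2*pi}"
    using has_integral_linear[OF holomorphic_mean_value[OF assms] bounded_linear_Re] by (simp add: o_def)
  thus ?thesis by (simp add: circ_mean_def integral_unique)
qed

section \<open>Trigonometric polynomials as boundary values of real parts of entire
  functions\<close>

inductive trig_poly :: "(complex \<Rightarrow> real) \<Rightarrow> bool" where
  monom: "trig_poly (\<lambda>\<zeta>. Re (a * \<zeta> ^ n))"
| add: "trig_poly f \<Longrightarrow> trig_poly g \<Longrightarrow> trig_poly (\<lambda>\<zeta>. f \<zeta> + g \<zeta>)"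

lemma trig_poly_entire:
  assumes "trig_poly f"
  shows "\<exists>p. p holomorphic_on UNIV \<and> (\<forall>\<zeta>. f \<zeta> = Re (p \<zeta>))"
  using assms
proof induction
  case (monom a n)
  show ?case by (rule exI[of _ "\<lambda>\<zeta>. a * \<zeta> ^ n"]) (auto intro!: holomorphic_intros)
next
  case (add f g)
  then obtain p q where "p holomorphic_on UNIV" "\<forall>\<zeta>. f \<zeta> = Re (p \<zeta>)"
    "q holomorphic_on UNIV" "\<forall>\<zeta>. g \<zeta> = Re (q \<zeta>)" by blast
  thus ?case by (intro exI[of _ "\<lambda>\<zeta>. p \<zeta> + q \<zeta>"]) (auto intro!: holomorphic_intros)
qed

lemma Re_mult_Re: "Re x * Re y = Re (x * y / 2) + Re (x * cnj y / 2)"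
  by (simp add: field_simps)

text \<open>On the unit circle \<open>cnj \<zeta>\<close> is the inverse of \<open>\<zeta>\<close>,
  so the conjugate produced by \<open>Re_mult_Re\<close> turns into a power of
  \<open>\<zeta>\<close>, with nonnegative exponent by \<open>n \<le> m\<close>. Off the circle a
  product of harmonic functions is in general not harmonic, so agreement is claimed on the circle
  only.\<close>

lemma trig_poly_monom_mult:
  assumes "n \<le> m"
  shows "\<exists>h. trig_poly h \<and> (\<forall>\<zeta>. cmod \<zeta> = 1 \<longrightarrow> h \<zeta> = Re (a * \<zeta> ^ m) * Re (b * \<zeta> ^ n))"
proof (intro exI conjI allI impI)
  show "trig_poly (\<lambda>\<zeta>. Re (a * b / 2 * \<zeta> ^ (m + n)) + Re (a * cnj b / 2 * \<zeta> ^ (m - n)))"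
    by (intro trig_poly.intros)
  fix \<zeta> :: complex assume "cmod \<zeta> = 1"
  hence 1: "\<zeta> * cnj \<zeta> = 1" by (simp add: complex_norm_square[symmetric])
  have "\<zeta> ^ m * cnj \<zeta> ^ n = \<zeta> ^ (m - n) * (\<zeta> * cnj \<zeta>) ^ n"
    using assms by (simp add: power_mult_distrib mult.assoc[symmetric] power_add[symmetric])
  with 1 have 2: "\<zeta> ^ m * cnj \<zeta> ^ n = \<zeta> ^ (m - n)" by simp
  have "a * \<zeta> ^ m * cnj (b * \<zeta> ^ n) / 2 = a * cnj b / 2 * (\<zeta> ^ m * cnj \<zeta> ^ n)"
    by simp
  also note 2
  finally have 3: "a * \<zeta> ^ m * cnj (b * \<zeta> ^ n) / 2 = a * cnj b / 2 * \<zeta> ^ (m - n)" .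
  have "a * \<zeta> ^ m * (b * \<zeta> ^ n) / 2 = a * b / 2 * \<zeta> ^ (m + n)"
    by (simp add: power_add)
  thus "Re (a * b / 2 * \<zeta> ^ (m + n)) + Re (a * cnj b / 2 * \<zeta> ^ (m - n)) = Re (a * \<zeta> ^ m) * Re (b * \<zeta> ^ n)"
    by (simp only: Re_mult_Re[of "a * \<zeta> ^ m"] 3)
qed

lemma trig_poly_mult:
  assumes "trig_poly f" "trig_poly g"
  shows "\<exists>h. trig_poly h \<and> (\<forall>\<zeta>. cmod \<zeta> = 1 \<longrightarrow> h \<zeta> = f \<zeta> * g \<zeta>)"
  using assms
proof (induction f)
  case (monom a m)
  from monom show ?case
  proof (induction g)
    case (monom b n)
    show ?case
    proof (cases "n \<le> m")
      case False
      then show ?thesis using trig_poly_monom_mult[of m n b a] by (auto simp: mult.commute)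
    qed (rule trig_poly_monom_mult)
  next
    case (add g1 g2)
    then obtain h1 h2 where "trig_poly h1" "trig_poly h2"
      "\<And>\<zeta>. cmod \<zeta> = 1 \<Longrightarrow> h1 \<zeta> = Re (a * \<zeta> ^ m) * g1 \<zeta>"
      "\<And>\<zeta>. cmod \<zeta> = 1 \<Longrightarrow> h2 \<zeta> = Re (a * \<zeta> ^ m) * g2 \<zeta>" by metis
    thus ?case
      by (intro exI[of _ "\<lambda>\<zeta>. h1 \<zeta> + h2 \<zeta>"]) (auto intro: trig_poly.intros simp: ring_distribs)
  qed
next
  case (add f1 f2)
  then obtain h1 h2 where "trig_poly h1" "trig_poly h2"
    "\<And>\<zeta>. cmod \<zeta> = 1 \<Longrightarrow> h1 \<zeta> = f1 \<zeta> * g \<zeta>"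
    "\<And>\<zeta>. cmod \<zeta> = 1 \<Longrightarrow> h2 \<zeta> = f2 \<zeta> * g \<zeta>" by metis
  thus ?case
    by (intro exI[of _ "\<lambda>\<zeta>. h1 \<zeta> + h2 \<zeta>"]) (auto intro: trig_poly.intros simp: ring_distribs)
qed

text \<open>Replaces the Poisson integral: Stone-Weierstrass yields an approximate harmonic
  extension of the boundary values that is the real part of an entire function, which can be
  exponentiated and raises no question of regularity at the boundary.\<close>

lemma continuous_on_circle_approx_Re_entire:
  fixes g :: "complex \<Rightarrow> real"
  assumes "continuous_on (sphere 0 1) g" "e > 0"
  obtains p where "p holomorphic_on UNIV" "\<And>\<zeta>. cmod \<zeta> = 1 \<Longrightarrow> \<bar>g \<zeta> - Re (p \<zeta>)\<bar> < e"
proof -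
  define P where "P f \<longleftrightarrow> (\<exists>h. trig_poly h \<and> (\<forall>\<zeta>. cmod \<zeta> = 1 \<longrightarrow> f \<zeta> = h \<zeta>))" for f
  have "\<exists>f. P f \<and> (\<forall>x\<in>sphere 0 1. \<bar>g x - f x\<bar> < e)"
  proof (rule Stone_Weierstrass_HOL)
    show "P (\<lambda>x. c)" for c
      unfolding P_def using trig_poly.monom[of "of_real c" 0] by (intro exI[of _ "\<lambda>_. c"]) simp
    show "continuous_on (sphere 0 1) f" if "P f" for f
    proof -
      from that obtain h where h: "trig_poly h" "\<And>\<zeta>. cmod \<zeta> = 1 \<Longrightarrow> f \<zeta> = h \<zeta>"
        unfolding P_def by auto
      from trig_poly_entire[OF h(1)] obtain p
        where p: "p holomorphic_on UNIV" "\<And>\<zeta>. h \<zeta> = Re (p \<zeta>)" by auto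
      have "continuous_on (sphere 0 1) (\<lambda>\<zeta>. Re (p \<zeta>))"
        by (intro continuous_intros holomorphic_on_imp_continuous_on holomorphic_on_subset[OF p(1)]) auto
      thus ?thesis by (rule continuous_on_eq) (use p h in auto)
    qed
    show "P (\<lambda>x. f x + g x)" if "P f \<and> P g" for f g
      using that unfolding P_def by (metis (mono_tags, lifting) trig_poly.add)
    show "P (\<lambda>x. f x * g x)" if "P f \<and> P g" for f g
      using that unfolding P_def by (metis (mono_tags, lifting) trig_poly_mult)
    show "\<exists>f. P f \<and> f x \<noteq> f y" if "x \<in> sphere 0 1 \<and> y \<in> sphere 0 1 \<and> x \<noteq> y" for x y
    proof (cases "Re x = Re y")
      case False
      have "P Re" unfolding P_def using trig_poly.monom[of 1 1] by (intro exI[of _ Re]) simp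
      thus ?thesis using False by blast
    next
      case True
      with that have "Im x \<noteq> Im y" by (auto simp: complex_eq_iff)
      moreover have "P Im" unfolding P_def using trig_poly.monom[of "-\<i>" 1]
        by (intro exI[of _ Im]) simp
      ultimately show ?thesis by blast
    qed
  qed (use assms in auto)
  then obtain f where f: "P f" "\<forall>x\<in>sphere 0 1. \<bar>g x - f x\<bar> < e" by blast
  then obtain h where h: "trig_poly h" "\<And>\<zeta>. cmod \<zeta> = 1 \<Longrightarrow> f \<zeta> = h \<zeta>"
    unfolding P_def by auto
  from trig_poly_entire[OF h(1)] obtain p
    where p: "p holomorphic_on UNIV" "\<And>\<zeta>. h \<zeta> = Re (p \<zeta>)" by auto
  show ?thesis
    by (rule that[OF p(1)]) (use p h f in auto)
qed

text \<open>Adding \<open>\<epsilon> |\<zeta>|\<^sup>2\<close> makes the local inequalities strict and so excludes interior maxima.\<close>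
lemma local_submean_maximum:
  fixes u :: "complex \<Rightarrow> real"
  assumes cont: "continuous_on (cball 0 1) u"
    and loc: "\<And>a. cmod a < 1 \<Longrightarrow> \<exists>\<rho>>0. cball a \<rho> \<subseteq> ball 0 1 \<and> u a \<le> circ_mean (\<lambda>\<zeta>. u (a + of_real \<rho> * \<zeta>))"
    and bd: "\<And>\<zeta>. cmod \<zeta> = 1 \<Longrightarrow> u \<zeta> \<le> M"
  shows "u 0 \<le> M"
proof (rule field_le_epsilon)
  fix e :: real assume e: "e > 0"
  define v where "v \<zeta> = u \<zeta> + e * (cmod \<zeta>)\<^sup>2" for \<zeta>
  have contv: "continuous_on (cball 0 1) v"
    unfolding v_def by (intro continuous_intros cont)
  obtain a where a: "a \<in> cball 0 1" "\<And>\<zeta>. \<zeta> \<in> cball 0 1 \<Longrightarrow> v \<zeta> \<le> v a"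
    using continuous_attains_sup[OF _ _ contv] by auto
  have "cmod a = 1"
  proof (rule ccontr)
    assume "cmod a \<noteq> 1"
    with a(1) have "cmod a < 1" by auto
    from loc[OF this] obtain \<rho> where \<rho>: "\<rho> > 0" "cball a \<rho> \<subseteq> ball 0 1"
      "u a \<le> circ_mean (\<lambda>\<zeta>. u (a + of_real \<rho> * \<zeta>))" by blast
    have sub: "a + of_real \<rho> * \<zeta> \<in> cball 0 1" if "cmod \<zeta> = 1" for \<zeta>
    proof -
      have "a + of_real \<rho> * \<zeta> \<in> cball a \<rho>" using that \<rho> by (simp add: dist_norm norm_mult)
      thus ?thesis using \<rho>(2) by auto
    qed
    have cu: "continuous_on (sphere 0 1) (\<lambda>\<zeta>. u (a + of_real \<rho> * \<zeta>))"
      by (rule continuous_on_compose2[OF cont]) (use sub in \<open>auto intro!: continuous_intros\<close>)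
    have eq: "(cmod (a + of_real \<rho> * \<zeta>))\<^sup>2 = (cmod a)\<^sup>2 + \<rho>\<^sup>2 + Re (2 * of_real \<rho> * cnj a * \<zeta>)"
      if "cmod \<zeta> = 1" for \<zeta>
    proof -
      have "(Re \<zeta>)\<^sup>2 + (Im \<zeta>)\<^sup>2 = 1" using that by (simp add: cmod_def)
      hence *: "\<rho>\<^sup>2 * ((Re \<zeta>)\<^sup>2 + (Im \<zeta>)\<^sup>2) = \<rho>\<^sup>2" by simp
      show ?thesis unfolding cmod_power2 using * by (simp add: power2_eq_square algebra_simps)
    qed
    have eq_mean: "circ_mean (\<lambda>\<zeta>. e * ((cmod a)\<^sup>2 + \<rho>\<^sup>2 + Re (2 * of_real \<rho> * cnj a * \<zeta>)))
        = e * ((cmod a)\<^sup>2 + \<rho>\<^sup>2)"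
    proof -
      have "circ_mean (\<lambda>\<zeta>. Re (2 * of_real \<rho> * cnj a * \<zeta>)) = 0"
        by (subst circ_mean_Re_holomorphic[of _ 2]) (auto intro!: holomorphic_intros)
      thus ?thesis
        unfolding circ_mean_cmult by (subst circ_mean_add) (auto intro!: continuous_intros simp del: times_complex.sel)
    qed
    have "circ_mean (\<lambda>\<zeta>. v (a + of_real \<rho> * \<zeta>)) = circ_mean (\<lambda>\<zeta>. u (a + of_real \<rho> * \<zeta>)) + e * ((cmod a)\<^sup>2 + \<rho>\<^sup>2)"
    proof -
      have "circ_mean (\<lambda>\<zeta>. v (a + of_real \<rho> * \<zeta>)) = circ_mean (\<lambda>\<zeta>. u (a + of_real \<rho> * \<zeta>)
          + e * ((cmod a)\<^sup>2 + \<rho>\<^sup>2 + Re (2 * of_real \<rho> * cnj a * \<zeta>)))"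
        by (rule circ_mean_cong) (simp only: v_def eq)
      also have "\<dots> = circ_mean (\<lambda>\<zeta>. u (a + of_real \<rho> * \<zeta>)) + e * ((cmod a)\<^sup>2 + \<rho>\<^sup>2)"
        unfolding eq_mean[symmetric] by (rule circ_mean_add) (auto intro!: cu continuous_intros)
      finally show ?thesis .
    qed
    moreover have "circ_mean (\<lambda>\<zeta>. v (a + of_real \<rho> * \<zeta>)) \<le> v a"
      by (rule circ_mean_le_const)
        (use sub a(2) in \<open>auto intro!: continuous_on_compose2[OF contv] continuous_intros simp del: mem_cball_0\<close>)
    ultimately have "e * \<rho>\<^sup>2 \<le> 0" using \<rho>(3) by (simp add: v_def ring_distribs)
    with \<rho>(1) e show False by (simp add: mult_le_0_iff)
  qed
  have "u 0 = v 0" by (simp add: v_def)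
  also have "\<dots> \<le> v a" using a by simp
  also have "\<dots> \<le> M + e" using bd[OF \<open>cmod a = 1\<close>] \<open>cmod a = 1\<close> by (simp add: v_def)
  finally show "u 0 \<le> M + e" .
qed

text \<open>Subtracting the real part of an entire function \<open>p\<close> that is close to
  \<open>u\<close> on the circle preserves the local inequalities and leaves boundary values of at
  most \<open>e/2\<close>. The maximum principle then compares \<open>u 0\<close> with
  \<open>Re (p 0)\<close>, which is itself a mean.\<close>

lemma local_submean_imp_submean:
  fixes u :: "complex \<Rightarrow> real"
  assumes cont: "continuous_on (cball 0 1) u"
    and loc: "\<And>a. cmod a < 1 \<Longrightarrow> \<exists>\<rho>>0. cball a \<rho> \<subseteq> ball 0 1 \<and> u a \<le> circ_mean (\<lambda>\<zeta>. u (a + of_real \<rho> * \<zeta>))"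
  shows "u 0 \<le> circ_mean u"
proof (rule field_le_epsilon)
  fix e :: real assume e: "e > 0"
  have cont': "continuous_on (sphere 0 1) u" by (rule continuous_on_subset[OF cont]) auto
  obtain p where p: "p holomorphic_on UNIV" "\<And>\<zeta>. cmod \<zeta> = 1 \<Longrightarrow> \<bar>u \<zeta> - Re (p \<zeta>)\<bar> < e/2"
    using continuous_on_circle_approx_Re_entire[OF cont', of "e/2"] e by auto
  have contp: "continuous_on S (\<lambda>\<zeta>. Re (p \<zeta>))" for S
    by (intro continuous_intros holomorphic_on_imp_continuous_on holomorphic_on_subset[OF p(1)]) auto
  have "u 0 - Re (p 0) \<le> e/2"
  proof (rule local_submean_maximum)
    show "continuous_on (cball 0 1) (\<lambda>\<zeta>. u \<zeta> - Re (p \<zeta>))"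
      by (intro continuous_intros cont contp)
    fix a assume "cmod a < 1"
    from loc[OF this] obtain \<rho> where \<rho>: "\<rho> > 0" "cball a \<rho> \<subseteq> ball 0 1"
      "u a \<le> circ_mean (\<lambda>\<zeta>. u (a + of_real \<rho> * \<zeta>))" by blast
    have sub: "a + of_real \<rho> * \<zeta> \<in> cball 0 1" if "cmod \<zeta> = 1" for \<zeta>
    proof -
      have "a + of_real \<rho> * \<zeta> \<in> cball a \<rho>" using that \<rho> by (simp add: dist_norm norm_mult)
      thus ?thesis using \<rho>(2) by auto
    qed
    have "circ_mean (\<lambda>\<zeta>. u (a + of_real \<rho> * \<zeta>) + Re (- p (a + of_real \<rho> * \<zeta>)))
       = circ_mean (\<lambda>\<zeta>. u (a + of_real \<rho> * \<zeta>)) + circ_mean (\<lambda>\<zeta>. Re (- p (a + of_real \<rho> * \<zeta>)))"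
      by (intro circ_mean_add)
       (use sub in \<open>auto intro!: continuous_on_compose2[OF cont] continuous_intros
          continuous_on_compose2[OF holomorphic_on_imp_continuous_on[OF p(1)]]\<close>)
    also have "circ_mean (\<lambda>\<zeta>. Re (- p (a + of_real \<rho> * \<zeta>))) = - Re (p a)"
      by (subst circ_mean_Re_holomorphic[of _ 2])
         (auto intro!: holomorphic_intros holomorphic_on_compose_gen[OF _ p(1), unfolded o_def])
    finally show "\<exists>\<rho>>0. cball a \<rho> \<subseteq> ball 0 1 \<and> u a - Re (p a)
        \<le> circ_mean (\<lambda>\<zeta>. u (a + of_real \<rho> * \<zeta>) - Re (p (a + of_real \<rho> * \<zeta>)))"
      using \<rho> by (intro exI[of _ \<rho>]) auto
  next
    show "u \<zeta> - Re (p \<zeta>) \<le> e/2" if "cmod \<zeta> = 1" for \<zeta> using p(2)[OF that] by linarith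
  qed
  also have "Re (p 0) = circ_mean (\<lambda>\<zeta>. Re (p \<zeta>))"
    by (rule circ_mean_Re_holomorphic[symmetric, of _ 2]) (auto intro: holomorphic_on_subset[OF p(1)])
  finally have "u 0 \<le> circ_mean (\<lambda>\<zeta>. Re (p \<zeta>)) + e/2"
    by (simp add: circ_mean_Re_holomorphic[of p 2] holomorphic_on_subset[OF p(1)])
  also have "circ_mean (\<lambda>\<zeta>. Re (p \<zeta>)) \<le> circ_mean (\<lambda>\<zeta>. u \<zeta> + e/2)"
    using p(2) by (intro circ_mean_mono contp continuous_intros cont') (smt (verit))
  also have "\<dots> = circ_mean u + e/2" by (subst circ_mean_add) (auto intro: cont')
  finally show "u 0 \<le> circ_mean u + e" by simp
qed

subsection \<open>Plurisubharmonic functions\<close>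

definition holo_map :: "real \<Rightarrow> (complex \<Rightarrow> complex ^ 'n) \<Rightarrow> bool" where
  "holo_map R H \<longleftrightarrow> R > 1 \<and> (\<forall>i. (\<lambda>\<zeta>. H \<zeta> $ i) holomorphic_on ball 0 R)"

text \<open>The inequality is required on all closed analytic discs that extend past their boundary,
  not only on affine ones. Linear changes of coordinates become trivial, and the curved discs of the
  pseudoconvexity proof are covered directly.\<close>

definition psh_on :: "(complex ^ 'n) set \<Rightarrow> (complex ^ 'n \<Rightarrow> real) \<Rightarrow> bool" where
  "psh_on U f \<longleftrightarrow> continuous_on U f \<and>
     (\<forall>H R. holo_map R H \<and> H ` cball 0 1 \<subseteq> U \<longrightarrow> f (H 0) \<le> circ_mean (\<lambda>\<zeta>. f (H \<zeta>)))"

lemma psh_onI: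
  assumes "continuous_on U f"
    and "\<And>H R. holo_map R H \<Longrightarrow> H ` cball 0 1 \<subseteq> U \<Longrightarrow> f (H 0) \<le> circ_mean (\<lambda>\<zeta>. f (H \<zeta>))"
  shows "psh_on U f"
  using assms unfolding psh_on_def by blast

lemma psh_on_submean:
  "psh_on U f \<Longrightarrow> holo_map R H \<Longrightarrow> H ` cball 0 1 \<subseteq> U \<Longrightarrow> f (H 0) \<le> circ_mean (\<lambda>\<zeta>. f (H \<zeta>))"
  unfolding psh_on_def by blast

lemma psh_on_continuous: "psh_on U f \<Longrightarrow> continuous_on U f"
  unfolding psh_on_def by blast

lemma holo_map_continuous:
  assumes "holo_map R H"
  shows "continuous_on (cball 0 1) H"
proof -
  have "continuous_on (cball 0 1) (\<lambda>\<zeta>. \<chi> i. H \<zeta> $ i)"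
  proof (rule continuous_on_vec_lambda)
    fix i
    have "(\<lambda>\<zeta>. H \<zeta> $ i) holomorphic_on ball 0 R" "R > 1"
      using assms by (auto simp: holo_map_def)
    thus "continuous_on (cball 0 1) (\<lambda>\<zeta>. H \<zeta> $ i)"
      by (intro continuous_on_subset[OF holomorphic_on_imp_continuous_on]) auto
  qed
  thus ?thesis by simp
qed

lemma continuous_on_holo_map:
  assumes "continuous_on U f" "holo_map R H" "H ` cball 0 1 \<subseteq> U"
  shows "continuous_on (cball 0 1) (\<lambda>\<zeta>. f (H \<zeta>))" "continuous_on (sphere 0 1) (\<lambda>\<zeta>. f (H \<zeta>))"
proof -
  show 1: "continuous_on (cball 0 1) (\<lambda>\<zeta>. f (H \<zeta>))"
    by (rule continuous_on_compose2[OF assms(1) holo_map_continuous[OF assms(2)] assms(3)])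
  show "continuous_on (sphere 0 1) (\<lambda>\<zeta>. f (H \<zeta>))"
    by (rule continuous_on_subset[OF 1]) auto
qed

lemma psh_on_subset: "psh_on U f \<Longrightarrow> V \<subseteq> U \<Longrightarrow> psh_on V f"
  unfolding psh_on_def by (meson continuous_on_subset order_trans)

lemma psh_on_cong:
  assumes "psh_on U f" "\<And>x. x \<in> U \<Longrightarrow> f x = g x"
  shows "psh_on U g"
proof (rule psh_onI)
  show "continuous_on U g"
    using psh_on_continuous[OF assms(1)] assms(2) by (rule continuous_on_eq)
  fix H R assume H: "holo_map R H" "H ` cball 0 1 \<subseteq> U"
  have *: "f (H \<zeta>) = g (H \<zeta>)" if "cmod \<zeta> \<le> 1" for \<zeta>
    using H(2) that by (intro assms(2)) auto
  have "circ_mean (\<lambda>\<zeta>. f (H \<zeta>)) = circ_mean (\<lambda>\<zeta>. g (H \<zeta>))"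
    by (intro circ_mean_cong *) auto
  thus "g (H 0) \<le> circ_mean (\<lambda>\<zeta>. g (H \<zeta>))"
    using psh_on_submean[OF assms(1) H] * by simp
qed

lemma psh_on_const: "psh_on U (\<lambda>_. c)"
  by (rule psh_onI) auto

lemma psh_on_add:
  assumes "psh_on U f" "psh_on U g"
  shows "psh_on U (\<lambda>x. f x + g x)"
proof (rule psh_onI)
  note c = assms[THEN psh_on_continuous]
  show "continuous_on U (\<lambda>x. f x + g x)" by (intro continuous_intros c)
  fix H R assume H: "holo_map R H" "H ` cball 0 1 \<subseteq> U"
  show "f (H 0) + g (H 0) \<le> circ_mean (\<lambda>\<zeta>. f (H \<zeta>) + g (H \<zeta>))"
    using psh_on_submean[OF assms(1) H] psh_on_submean[OF assms(2) H]
    by (subst circ_mean_add) (auto intro: continuous_on_holo_map(2)[OF c(1) H] continuous_on_holo_map(2)[OF c(2) H])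
qed

lemma psh_on_cmult:
  assumes "psh_on U f" "c \<ge> 0"
  shows "psh_on U (\<lambda>x. c * f x)"
proof (rule psh_onI)
  note c = assms(1)[THEN psh_on_continuous]
  show "continuous_on U (\<lambda>x. c * f x)" by (intro continuous_intros c)
  fix H R assume H: "holo_map R H" "H ` cball 0 1 \<subseteq> U"
  show "c * f (H 0) \<le> circ_mean (\<lambda>\<zeta>. c * f (H \<zeta>))"
    using psh_on_submean[OF assms(1) H] assms(2) by (simp add: circ_mean_cmult mult_left_mono)
qed

lemma psh_on_sum:
  assumes "finite I" "\<And>i. i \<in> I \<Longrightarrow> psh_on U (f i)"
  shows "psh_on U (\<lambda>x. \<Sum>i\<in>I. f i x)"
  using assms by (induction rule: finite_induct) (auto intro: psh_on_const psh_on_add)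

text \<open>This covers both convex increasing functions of \<open>f\<close> and regularised maxima of \<open>f\<close> and \<open>g\<close>.\<close>
lemma psh_on_supported:
  assumes f: "psh_on U f" and g: "psh_on U g" and cont: "continuous_on U F"
    and sup: "\<And>x. x \<in> U \<Longrightarrow> \<exists>\<alpha>\<ge>0. \<exists>\<beta>\<ge>0. \<forall>y\<in>U. F x + \<alpha> * (f y - f x) + \<beta> * (g y - g x) \<le> F y"
  shows "psh_on U F"
proof (rule psh_onI[OF cont])
  note c = f[THEN psh_on_continuous] g[THEN psh_on_continuous]
  fix H R assume H: "holo_map R H" "H ` cball 0 1 \<subseteq> U"
  hence H0: "H 0 \<in> U" by auto
  obtain \<alpha> \<beta> where ab: "\<alpha> \<ge> 0" "\<beta> \<ge> 0"
    "\<And>y. y \<in> U \<Longrightarrow> F (H 0) + \<alpha> * (f y - f (H 0)) + \<beta> * (g y - g (H 0)) \<le> F y"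
    using sup[OF H0] by blast
  define C where "C = F (H 0) - \<alpha> * f (H 0) - \<beta> * g (H 0)"
  note cc = continuous_on_holo_map(2)[OF _ H]
  have "F (H 0) = C + (\<alpha> * f (H 0) + \<beta> * g (H 0))" by (simp add: C_def)
  also have "\<dots> \<le> C + (\<alpha> * circ_mean (\<lambda>\<zeta>. f (H \<zeta>)) + \<beta> * circ_mean (\<lambda>\<zeta>. g (H \<zeta>)))"
    by (intro add_left_mono add_mono mult_left_mono psh_on_submean[OF f H] psh_on_submean[OF g H] ab)
  also have "\<dots> = circ_mean (\<lambda>_. C) + (circ_mean (\<lambda>\<zeta>. \<alpha> * f (H \<zeta>)) + circ_mean (\<lambda>\<zeta>. \<beta> * g (H \<zeta>)))"
    by (simp only: circ_mean_const circ_mean_cmult)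
  also have "\<dots> = circ_mean (\<lambda>_. C) + circ_mean (\<lambda>\<zeta>. \<alpha> * f (H \<zeta>) + \<beta> * g (H \<zeta>))"
    by (intro arg_cong2[of _ _ _ _ "(+)"] refl circ_mean_add[symmetric] continuous_on_mult_left cc c)
  also have "\<dots> = circ_mean (\<lambda>\<zeta>. C + (\<alpha> * f (H \<zeta>) + \<beta> * g (H \<zeta>)))"
    by (intro circ_mean_add[symmetric] continuous_on_const continuous_on_add continuous_on_mult_left cc c)
  also have "\<dots> \<le> circ_mean (\<lambda>\<zeta>. F (H \<zeta>))"
  proof (intro circ_mean_mono continuous_on_const continuous_on_add continuous_on_mult_left cc c cont)
    fix \<zeta> :: complex assume "cmod \<zeta> = 1"
    hence "H \<zeta> \<in> U" using H(2) by auto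
    from ab(3)[OF this] show "C + (\<alpha> * f (H \<zeta>) + \<beta> * g (H \<zeta>)) \<le> F (H \<zeta>)"
      by (simp add: C_def algebra_simps)
  qed
  finally show "F (H 0) \<le> circ_mean (\<lambda>\<zeta>. F (H \<zeta>))" .
qed

text \<open>The holomorphic function may depend on the disc. This admits
  \<open>ln (cmod (x $ i))\<close>, which is not globally the real part of a holomorphic
  function.\<close>

lemma psh_on_pluriharmonic:
  assumes "continuous_on U f"
    and "\<And>H R. holo_map R H \<Longrightarrow> H ` cball 0 1 \<subseteq> U \<Longrightarrow>
       \<exists>g R'. R' > 1 \<and> g holomorphic_on ball 0 R' \<and> (\<forall>\<zeta>. cmod \<zeta> \<le> 1 \<longrightarrow> f (H \<zeta>) = Re (g \<zeta>))"
  shows "psh_on U f"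
proof (rule psh_onI[OF assms(1)])
  fix H R assume "holo_map R H" "H ` cball 0 1 \<subseteq> U"
  from assms(2)[OF this] obtain g R' where g: "R' > 1" "g holomorphic_on ball 0 R'"
    "\<And>\<zeta>. cmod \<zeta> \<le> 1 \<Longrightarrow> f (H \<zeta>) = Re (g \<zeta>)" by blast
  have "circ_mean (\<lambda>\<zeta>. f (H \<zeta>)) = circ_mean (\<lambda>\<zeta>. Re (g \<zeta>))"
    by (intro circ_mean_cong g) auto
  thus "f (H 0) \<le> circ_mean (\<lambda>\<zeta>. f (H \<zeta>))"
    using circ_mean_Re_holomorphic[OF g(2,1)] g(3) by simp
qed

text \<open>By compactness, nonvanishing on the closed disc persists on a larger one, where
  quotients and logarithms are holomorphic; the mean value property needs this margin.\<close>

lemma holo_map_nonzero_nbhd: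
  assumes "holo_map R H" "\<And>\<zeta>. cmod \<zeta> \<le> 1 \<Longrightarrow> H \<zeta> $ i \<noteq> 0"
  obtains R' where "1 < R'" "R' \<le> R" "\<And>\<zeta>. \<zeta> \<in> ball 0 R' \<Longrightarrow> H \<zeta> $ i \<noteq> 0"
proof -
  have R: "R > 1" "(\<lambda>\<zeta>. H \<zeta> $ i) holomorphic_on ball 0 R" using assms by (auto simp: holo_map_def)
  have "open (ball 0 R \<inter> (\<lambda>\<zeta>. H \<zeta> $ i) -` (-{0}))"
    by (intro continuous_open_preimage holomorphic_on_imp_continuous_on[OF R(2)]) auto
  moreover have "cball 0 1 \<subseteq> ball 0 R \<inter> (\<lambda>\<zeta>. H \<zeta> $ i) -` (-{0})"
    using R(1) assms(2) by auto
  ultimately obtain e where e: "e > 0"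
    "(\<Union>x\<in>cball 0 1. ball x e) \<subseteq> ball 0 R \<inter> (\<lambda>\<zeta>. H \<zeta> $ i) -` (-{0})"
    by (rule compact_subset_open_imp_ball_epsilon_subset[OF compact_cball])
  have sub: "ball 0 (1 + e) \<subseteq> (\<Union>x\<in>cball (0::complex) 1. ball x e)"
  proof
    fix \<zeta> :: complex assume z: "\<zeta> \<in> ball 0 (1 + e)"
    show "\<zeta> \<in> (\<Union>x\<in>cball 0 1. ball x e)"
    proof (cases "cmod \<zeta> \<le> 1")
      case True thus ?thesis using e(1) by (intro UN_I[of \<zeta>]) auto
    next
      case False
      have "dist (sgn \<zeta>) \<zeta> < e"
      proof -
        have "sgn \<zeta> - \<zeta> = (1 - cmod \<zeta>) *\<^sub>R sgn \<zeta>"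
          using False by (subgoal_tac "cmod \<zeta> \<noteq> 0") (auto simp: sgn_div_norm algebra_simps)
        hence "dist (sgn \<zeta>) \<zeta> = \<bar>1 - cmod \<zeta>\<bar> * norm (sgn \<zeta>)" by (simp add: dist_norm)
        thus ?thesis using False z by (auto simp: norm_sgn)
      qed
      thus ?thesis by (intro UN_I[of "sgn \<zeta>"]) (auto simp: norm_sgn)
    qed
  qed
  have "ball (0::complex) (min R (1+e)) \<subseteq> ball 0 (1+e)" by auto
  with sub e(2) have "\<And>\<zeta>. \<zeta> \<in> ball 0 (min R (1+e)) \<Longrightarrow> H \<zeta> $ i \<noteq> 0" by fast
  thus ?thesis using R e(1) by (intro that[of "min R (1+e)"]) auto
qed

lemma psh_on_Re_quotient: "psh_on {x. x $ i \<noteq> 0} (\<lambda>x. - Re (x $ j / x $ i))"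
proof (rule psh_on_pluriharmonic)
  show "continuous_on {x. x $ i \<noteq> 0} (\<lambda>x. - Re (x $ j / x $ i))"
    by (auto intro!: continuous_intros)
  fix H :: "complex \<Rightarrow> complex ^ 'a" and R
  assume H: "holo_map R H" "H ` cball 0 1 \<subseteq> {x. x $ i \<noteq> 0}"
  have nz: "H \<zeta> $ i \<noteq> 0" if "cmod \<zeta> \<le> 1" for \<zeta>
    using H(2) that by (force simp: image_subset_iff)
  obtain R' where R': "1 < R'" "R' \<le> R" "\<And>\<zeta>. \<zeta> \<in> ball 0 R' \<Longrightarrow> H \<zeta> $ i \<noteq> 0"
    using holo_map_nonzero_nbhd[OF H(1) nz] by blast
  have "(\<lambda>\<zeta>. H \<zeta> $ j) holomorphic_on ball 0 R'" for j
    using H(1) R'(2) unfolding holo_map_def by (auto intro: holomorphic_on_subset)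
  hence "(\<lambda>\<zeta>. - (H \<zeta> $ j / H \<zeta> $ i)) holomorphic_on ball 0 R'"
    using R'(3) by (intro holomorphic_intros) auto
  thus "\<exists>g R'. R' > 1 \<and> g holomorphic_on ball 0 R' \<and> (\<forall>\<zeta>. cmod \<zeta> \<le> 1 \<longrightarrow> - Re (H \<zeta> $ j / H \<zeta> $ i) = Re (g \<zeta>))"
    using R'(1) by (intro exI[of _ "\<lambda>\<zeta>. - (H \<zeta> $ j / H \<zeta> $ i)"] exI[of _ R']) auto
qed

lemma psh_on_ln_norm: "psh_on {x. x $ i \<noteq> 0} (\<lambda>x. ln (cmod (x $ i)))"
proof (rule psh_on_pluriharmonic)
  show "continuous_on {x. x $ i \<noteq> 0} (\<lambda>x. ln (cmod (x $ i)))"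
    by (auto intro!: continuous_intros)
  fix H :: "complex \<Rightarrow> complex ^ 'a" and R
  assume H: "holo_map R H" "H ` cball 0 1 \<subseteq> {x. x $ i \<noteq> 0}"
  have nz: "H \<zeta> $ i \<noteq> 0" if "cmod \<zeta> \<le> 1" for \<zeta>
    using H(2) that by (force simp: image_subset_iff)
  obtain R' where R': "1 < R'" "R' \<le> R" "\<And>\<zeta>. \<zeta> \<in> ball 0 R' \<Longrightarrow> H \<zeta> $ i \<noteq> 0"
    using holo_map_nonzero_nbhd[OF H(1) nz] by blast
  have "(\<lambda>\<zeta>. H \<zeta> $ i) holomorphic_on ball 0 R'"
    using H(1) R'(2) unfolding holo_map_def by (auto intro: holomorphic_on_subset)
  then obtain g where g: "g holomorphic_on ball 0 R'" "\<And>\<zeta>. \<zeta> \<in> ball 0 R' \<Longrightarrow> exp (g \<zeta>) = H \<zeta> $ i"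
    using holomorphic_logarithm_exists[of "ball 0 R'" "\<lambda>\<zeta>. H \<zeta> $ i" 0] R' by auto
  have "ln (cmod (H \<zeta> $ i)) = Re (g \<zeta>)" if "cmod \<zeta> \<le> 1" for \<zeta>
    using g(2)[of \<zeta>, symmetric] that R'(1) by simp
  thus "\<exists>g R'. R' > 1 \<and> g holomorphic_on ball 0 R' \<and> (\<forall>\<zeta>. cmod \<zeta> \<le> 1 \<longrightarrow> ln (cmod (H \<zeta> $ i)) = Re (g \<zeta>))"
    using R'(1) g(1) by blast
qed

text \<open>The squared modulus lies above its tangent at \<open>g (H 0)\<close>, and the tangent is
  the real part of an affine function of \<open>g\<close>, hence harmonic along discs.\<close>

lemma psh_on_norm_square:
  assumes "continuous_on U g"
    and "\<And>H R. holo_map R H \<Longrightarrow> (\<lambda>\<zeta>. g (H \<zeta>)) holomorphic_on ball 0 R"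
  shows "psh_on U (\<lambda>x. (cmod (g x))\<^sup>2)"
proof (rule psh_onI)
  show "continuous_on U (\<lambda>x. (cmod (g x))\<^sup>2)" by (intro continuous_intros assms)
  fix H R assume H: "holo_map R H" "H ` cball 0 1 \<subseteq> U"
  let ?G = "\<lambda>\<zeta>. g (H \<zeta>)" and ?c = "cnj (g (H 0))"
  have hol: "?G holomorphic_on ball 0 R" "R > 1" using assms(2)[OF H(1)] H(1) by (auto simp: holo_map_def)
  have ge: "2 * Re (?c * ?G \<zeta>) + - (cmod (g (H 0)))\<^sup>2 \<le> (cmod (?G \<zeta>))\<^sup>2" for \<zeta>
  proof -
    have "0 \<le> (Re (?G \<zeta>) - Re (g (H 0)))\<^sup>2 + (Im (?G \<zeta>) - Im (g (H 0)))\<^sup>2" by simp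
    thus ?thesis by (simp add: cmod_power2 power2_diff algebra_simps)
  qed
  have contG: "continuous_on (sphere 0 1) ?G"
    using hol by (intro continuous_on_subset[OF holomorphic_on_imp_continuous_on[OF hol(1)]]) auto
  have "(cmod (g (H 0)))\<^sup>2 = 2 * Re (?c * ?G 0) + - (cmod (g (H 0)))\<^sup>2"
    unfolding cmod_power2 by (simp add: power2_eq_square)
  also have "Re (?c * ?G 0) = circ_mean (\<lambda>\<zeta>. Re (?c * ?G \<zeta>))"
    by (rule circ_mean_Re_holomorphic[symmetric, OF _ hol(2)]) (intro holomorphic_on_mult holomorphic_on_const hol)
  also have "2 * circ_mean (\<lambda>\<zeta>. Re (?c * ?G \<zeta>)) + - (cmod (g (H 0)))\<^sup>2
      = circ_mean (\<lambda>\<zeta>. 2 * Re (?c * ?G \<zeta>)) + circ_mean (\<lambda>_. - (cmod (g (H 0)))\<^sup>2)"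
    by (simp only: circ_mean_cmult circ_mean_const)
  also have "\<dots> = circ_mean (\<lambda>\<zeta>. 2 * Re (?c * ?G \<zeta>) + - (cmod (g (H 0)))\<^sup>2)"
    by (intro circ_mean_add[symmetric] continuous_intros contG)
  also have "\<dots> \<le> circ_mean (\<lambda>\<zeta>. (cmod (?G \<zeta>))\<^sup>2)"
    by (intro circ_mean_mono ge continuous_intros contG)
  finally show "(cmod (g (H 0)))\<^sup>2 \<le> circ_mean (\<lambda>\<zeta>. (cmod (g (H \<zeta>)))\<^sup>2)" .
qed

text \<open>This permits definitions by cases on an open cover: small subdiscs lie in a single set
  of the cover, and the resulting local inequalities imply the global one.\<close>

lemma psh_on_locally:
  assumes "\<And>x. x \<in> U \<Longrightarrow> \<exists>V. open V \<and> x \<in> V \<and> psh_on V f"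
  shows "psh_on U f"
proof (rule psh_onI)
  show cont: "continuous_on U f"
    unfolding continuous_on_eq_continuous_within
  proof
    fix x assume "x \<in> U"
    from assms[OF this] obtain V where V: "open V" "x \<in> V" "psh_on V f" by blast
    hence "continuous (at x) f"
      using continuous_on_eq_continuous_at psh_on_continuous by blast
    thus "continuous (at x within U) f" by (rule continuous_at_imp_continuous_at_within)
  qed
  fix H R assume H: "holo_map R H" "H ` cball 0 1 \<subseteq> U"
  show "f (H 0) \<le> circ_mean (\<lambda>\<zeta>. f (H \<zeta>))"
  proof (rule local_submean_imp_submean)
    show "continuous_on (cball 0 1) (\<lambda>\<zeta>. f (H \<zeta>))"
      by (rule continuous_on_holo_map(1)[OF cont H])
    fix a :: complex assume a: "cmod a < 1"
    hence "H a \<in> U" using H by auto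
    from assms[OF this] obtain V where V: "open V" "H a \<in> V" "psh_on V f" by blast
    have "open (ball 0 1 \<inter> H -` V)"
      by (rule continuous_open_preimage)
         (auto intro: continuous_on_subset[OF holo_map_continuous[OF H(1)]] V)
    moreover have "a \<in> ball 0 1 \<inter> H -` V" using a V by auto
    ultimately obtain e where e: "e > 0" "cball a e \<subseteq> ball 0 1 \<inter> H -` V"
      using open_contains_cball by blast
    \<comment> \<open>With radius \<open>e/2\<close> the map \<open>G\<close> is holomorphic on the
      disc of radius 2, so beyond the closed unit disc, as \<open>holo_map\<close> demands.\<close>
    define G where "G \<zeta> = H (a + of_real (e/2) * \<zeta>)" for \<zeta>
    have inb: "a + of_real (e/2) * \<zeta> \<in> cball a e" if "cmod \<zeta> \<le> 2" for \<zeta>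
    proof -
      have "cmod (of_real (e/2) * \<zeta>) = e/2 * cmod \<zeta>" unfolding norm_mult norm_of_real using e(1) by simp
      also have "\<dots> \<le> e/2 * 2" using that e(1) by (intro mult_left_mono) auto
      finally show ?thesis by (simp add: dist_norm)
    qed
    have "holo_map 2 G"
      unfolding holo_map_def G_def
    proof (intro conjI allI)
      fix i
      have h: "(\<lambda>\<zeta>. H \<zeta> $ i) holomorphic_on ball 0 R" using H by (auto simp: holo_map_def)
      have "a + of_real (e/2) * \<zeta> \<in> ball 0 R" if "cmod \<zeta> < 2" for \<zeta>
        using inb[of \<zeta>] that e(2) H(1) unfolding holo_map_def by fastforce
      thus "(\<lambda>\<zeta>. H (a + of_real (e/2) * \<zeta>) $ i) holomorphic_on ball 0 2"
        by (intro holomorphic_on_compose_gen[OF _ h, unfolded o_def] holomorphic_intros) auto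
    qed simp
    moreover have "G ` cball 0 1 \<subseteq> V"
    proof
      fix y assume "y \<in> G ` cball 0 1"
      then obtain \<zeta> where z: "cmod \<zeta> \<le> 1" "y = H (a + of_real (e/2) * \<zeta>)" by (auto simp: G_def)
      have "a + of_real (e/2) * \<zeta> \<in> cball a e" using z(1) by (intro inb) simp
      thus "y \<in> V" using z(2) e(2) by auto
    qed
    ultimately have "f (G 0) \<le> circ_mean (\<lambda>\<zeta>. f (G \<zeta>))"
      by (rule psh_on_submean[OF V(3)])
    moreover have "cball a (e/2) \<subseteq> ball 0 1" 
    proof -
      have "cball a (e/2) \<subseteq> cball a e" using e(1) by (intro subset_cball) auto
      thus ?thesis using e(2) by blast
    qed
    ultimately show "\<exists>\<rho>>0. cball a \<rho> \<subseteq> ball 0 1 \<and> f (H a) \<le> circ_mean (\<lambda>\<zeta>. f (H (a + of_real \<rho> * \<zeta>)))"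
      using e(1) by (intro exI[of _ "e/2"]) (auto simp: G_def)
  qed
qed

lemma psh_on_diagonal:
  assumes "psh_on UNIV f"
  shows "psh_on UNIV (\<lambda>x. f (\<chi> i. c i * x $ i))"
proof (rule psh_onI)
  show "continuous_on UNIV (\<lambda>x. f (\<chi> i. c i * x $ i))"
    by (rule continuous_on_compose2[OF psh_on_continuous[OF assms]])
       (auto intro!: continuous_intros continuous_on_vec_lambda)
  fix H :: "complex \<Rightarrow> complex ^ 'a" and R
  assume H: "holo_map R H" "H ` cball 0 1 \<subseteq> UNIV"
  have "holo_map R (\<lambda>\<zeta>. \<chi> i. c i * H \<zeta> $ i)"
    using H(1) by (auto simp: holo_map_def intro!: holomorphic_intros)
  from psh_on_submean[OF assms this]
  show "f (\<chi> i. c i * H 0 $ i) \<le> circ_mean (\<lambda>\<zeta>. f (\<chi> i. c i * H \<zeta> $ i))" by simp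
qed

lemma psh_on_limit:
  assumes psh: "\<And>n::nat. psh_on U (f n)" and cont: "continuous_on U g"
    and lim: "\<And>K. compact K \<Longrightarrow> K \<subseteq> U \<Longrightarrow> uniform_limit K f g sequentially"
  shows "psh_on U g"
proof (rule psh_onI[OF cont])
  fix H R assume H: "holo_map R H" "H ` cball 0 1 \<subseteq> U"
  show "g (H 0) \<le> circ_mean (\<lambda>\<zeta>. g (H \<zeta>))"
  proof (rule field_le_epsilon)
    fix e :: real assume e: "e > 0"
    have "compact (H ` cball 0 1)"
      by (intro compact_continuous_image holo_map_continuous[OF H(1)]) auto
    from uniform_limitD[OF lim[OF this H(2)], of "e/2"] e
    have "\<forall>\<^sub>F n in sequentially. \<forall>x\<in>H ` cball 0 1. dist (f n x) (g x) < e/2" by simp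
    then obtain n where "\<forall>x\<in>H ` cball 0 1. dist (f n x) (g x) < e/2"
      using eventually_happens trivial_limit_sequentially by blast
    hence n: "\<bar>f n (H \<zeta>) - g (H \<zeta>)\<bar> < e/2" if "cmod \<zeta> \<le> 1" for \<zeta>
      using that by (auto simp: dist_real_def)
    have "circ_mean (\<lambda>\<zeta>. f n (H \<zeta>)) \<le> circ_mean (\<lambda>\<zeta>. g (H \<zeta>) + e/2)"
      using n by (intro circ_mean_mono continuous_intros continuous_on_holo_map(2)[OF _ H] cont psh_on_continuous psh)
        (smt (verit))
    also have "\<dots> = circ_mean (\<lambda>\<zeta>. g (H \<zeta>)) + e/2"
      by (subst circ_mean_add) (auto intro: continuous_on_holo_map(2)[OF cont H])
    finally have "circ_mean (\<lambda>\<zeta>. f n (H \<zeta>)) \<le> circ_mean (\<lambda>\<zeta>. g (H \<zeta>)) + e/2" .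
    moreover have "g (H 0) < f n (H 0) + e/2"
      using n[of 0] by (auto simp: abs_if split: if_splits)
    ultimately show "g (H 0) \<le> circ_mean (\<lambda>\<zeta>. g (H \<zeta>)) + e"
      using psh_on_submean[OF psh H, of n] by linarith
  qed
qed

text \<open>Oka's argument: if \<open>-ln dist \<le> Re p\<close> on the boundary of a disc, then the discs translated by
  \<open>exp (-p) e\<close> with \<open>|e| < 1\<close> have their boundaries in \<open>D\<close>, hence by the submean property of \<open>\<rho>\<close>
  also their centres.\<close>
lemma pseudoconvex_sublevel:
  fixes \<rho> :: "complex ^ 3 \<Rightarrow> real"
  assumes psh: "psh_on UNIV \<rho>" and D: "D = {x. \<rho> x < 0}" and bdd: "bounded D"
  shows "pseudoconvex D"
proof -
  have cont: "continuous_on UNIV \<rho>" using psh by (rule psh_on_continuous)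
  have opn: "open D" unfolding D by (intro open_Collect_less cont continuous_intros)
  have ne: "- D \<noteq> {}" using bdd not_bounded_UNIV by (metis Compl_empty_eq double_complement)
  have clo: "closed (- D)" using opn by auto
  define d where "d x = infdist x (- D)" for x
  have dpos: "d x > 0" if "x \<in> D" for x
    using that in_closed_iff_infdist_zero[OF clo ne, of x] infdist_nonneg[of x "- D"]
    unfolding d_def by auto
  have dball: "y \<in> D" if "dist x y < d x" for x y
  proof (rule ccontr)
    assume "y \<notin> D"
    hence "d x \<le> dist x y" unfolding d_def by (intro infdist_le) auto
    with that show False by simp
  qed
  have contd: "continuous_on UNIV d" unfolding d_def by (intro continuous_intros)
  show ?thesis
    unfolding pseudoconvex_def Let_def d_def[symmetric]
  proof (intro allI impI)
    fix a b :: "complex ^ 3" and r :: real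
    assume asm: "a \<in> D \<and> r > 0 \<and> (\<forall>\<zeta>. cmod \<zeta> \<le> r \<longrightarrow> a + \<zeta> *s b \<in> D)"
    define A where "A \<zeta> = a + (of_real r * \<zeta>) *s b" for \<zeta>
    have contA: "continuous_on S A" for S
      unfolding A_def vector_scalar_mult_def
      by (auto intro!: continuous_intros continuous_on_vec_lambda)
    have AD: "A \<zeta> \<in> D" if "cmod \<zeta> \<le> 1" for \<zeta>
      using asm that unfolding A_def by (auto simp: norm_mult)
    define u where "u \<zeta> = - ln (d (A \<zeta>))" for \<zeta>
    have contu: "continuous_on (sphere 0 1) u"
      unfolding u_def
      by (intro continuous_intros continuous_on_compose2[OF contd] contA)
         (use dpos[OF AD] in \<open>auto simp: less_imp_neq[symmetric]\<close>)
    have "- ln (d a) \<le> circ_mean u"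
    proof (rule field_le_epsilon)
      fix e :: real assume e: "e > 0"
      obtain p0 where p0: "p0 holomorphic_on UNIV" "\<And>\<zeta>. cmod \<zeta> = 1 \<Longrightarrow> \<bar>u \<zeta> - Re (p0 \<zeta>)\<bar> < e/2"
        using continuous_on_circle_approx_Re_entire[OF contu, of "e/2"] e by auto
      \<comment> \<open>The shift by \<open>e/2\<close> makes \<open>Re p\<close> a strict majorant
        of \<open>u\<close> on the circle that is still within \<open>e\<close> of it.\<close>
      define p where "p \<zeta> = p0 \<zeta> + of_real (e/2)" for \<zeta>
      have holp: "p holomorphic_on S" for S
        unfolding p_def by (intro holomorphic_intros holomorphic_on_subset[OF p0(1)]) auto
      have p1: "u \<zeta> < Re (p \<zeta>)" "Re (p \<zeta>) < u \<zeta> + e" if "cmod \<zeta> = 1" for \<zeta>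
        using p0(2)[OF that] unfolding p_def by (auto simp: abs_if split: if_splits)
      have inD: "a + v \<in> D" if v: "norm v < exp (- Re (p 0))" for v
      proof -
        define H where "H \<zeta> = A \<zeta> + exp (p 0 - p \<zeta>) *s v" for \<zeta>
        have holo: "holo_map 2 H"
          unfolding holo_map_def H_def A_def by (auto intro!: holomorphic_intros holp)
        have neg: "\<rho> (H \<zeta>) < 0" if z: "cmod \<zeta> = 1" for \<zeta>
        proof -
          have "dist (A \<zeta>) (H \<zeta>) = norm (exp (p 0 - p \<zeta>) *s v)"
            by (simp add: H_def dist_norm)
          also have "\<dots> = exp (Re (p 0) - Re (p \<zeta>)) * norm v"
            by (simp add: norm_vec_def L2_set_def norm_mult power_mult_distrib sum_distrib_left[symmetric] real_sqrt_mult)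
          also have "\<dots> \<le> exp (Re (p 0) - Re (p \<zeta>)) * exp (- Re (p 0))"
            using v by (intro mult_left_mono) auto
          also have "\<dots> = exp (- Re (p \<zeta>))" by (simp add: exp_add[symmetric])
          also have "\<dots> < exp (- u \<zeta>)" using p1(1)[OF z] by simp
          also have "\<dots> = d (A \<zeta>)" using dpos[OF AD[of \<zeta>]] z by (simp add: u_def)
          finally have "H \<zeta> \<in> D" by (rule dball)
          thus ?thesis by (simp add: D)
        qed
        have "\<rho> (H 0) \<le> circ_mean (\<lambda>\<zeta>. \<rho> (H \<zeta>))"
          by (rule psh_on_submean[OF psh holo]) auto
        also have "\<dots> < 0"
          by (intro circ_mean_less_0 continuous_on_holo_map(2)[OF cont holo] neg) auto
        finally show ?thesis by (simp add: H_def A_def D)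
      qed
      have "exp (- Re (p 0)) \<le> d a"
        unfolding d_def
      proof (subst infdist_notempty[OF ne], rule cINF_greatest[OF ne])
        fix y assume "y \<in> - D"
        hence "\<not> norm (y - a) < exp (- Re (p 0))" using inD[of "y - a"] by auto
        thus "exp (- Re (p 0)) \<le> dist a y" by (simp add: dist_norm norm_minus_commute)
      qed
      hence "- Re (p 0) \<le> ln (d a)"
        using asm dpos[of a] by (simp add: ln_ge_iff)
      hence "- ln (d a) \<le> Re (p 0)" by simp
      also have "\<dots> = circ_mean (\<lambda>\<zeta>. Re (p \<zeta>))"
        by (rule circ_mean_Re_holomorphic[symmetric, of _ 2]) (auto intro: holp)
      also have "\<dots> \<le> circ_mean (\<lambda>\<zeta>. u \<zeta> + e)"
        using p1(2) by (intro circ_mean_mono continuous_intros contu holomorphic_on_imp_continuous_on holp) (auto intro: less_imp_le)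
      also have "\<dots> = circ_mean u + e" by (subst circ_mean_add) (auto intro: contu)
      finally show "- ln (d a) \<le> circ_mean u + e" .
    qed
    thus "- ln (d a) \<le> 1 / (2*pi) * integral {0..2*pi} (\<lambda>t. - ln (d (a + (of_real r * exp (\<i> * of_real t)) *s b)))"
      by (simp add: circ_mean_def u_def A_def cis_conv_exp)
  qed
qed

subsection \<open>Quantitative bounds on iterated derivatives\<close>

text \<open>The head of the list is the direction of the last differentiation.
  \<open>frechet_derivative\<close> is total, so differentiability is recorded separately, in
  \<open>Cbd\<close>.\<close>

primrec Dl :: "'a::real_normed_vector list \<Rightarrow> ('a \<Rightarrow> real) \<Rightarrow> 'a \<Rightarrow> real" where
  "Dl [] f = f"
| "Dl (h # vs) f = (\<lambda>x. frechet_derivative (Dl vs f) (at x) h)"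

lemma Dl_append: "Dl (us @ vs) f = Dl us (Dl vs f)"
  by (induction us) simp_all

lemma Dl_single:
  assumes "(f has_derivative f') (at x)"
  shows "Dl [h] f x = f' h"
  using frechet_derivative_at[OF assms] by simp

text \<open>A weighted C^k bound. Differentiability is asked only below order \<open>k\<close>;
  derivatives of order \<open>k\<close> are bounded but possibly discontinuous. The weight depends
  on the point so that growth at infinity can be expressed.\<close>

definition Cbd :: "nat \<Rightarrow> 'a::real_normed_vector set \<Rightarrow> ('a \<Rightarrow> real) \<Rightarrow> ('a \<Rightarrow> real) \<Rightarrow> bool" where
  "Cbd k U W f \<longleftrightarrow> (\<forall>vs. length vs \<le> k \<longrightarrow> (\<forall>x\<in>U. \<bar>Dl vs f x\<bar> \<le> W x * prod_list (map norm vs) \<and>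
      (length vs < k \<longrightarrow> Dl vs f differentiable (at x))))"

lemma Cbd_0: "Cbd 0 U W f \<longleftrightarrow> (\<forall>x\<in>U. \<bar>f x\<bar> \<le> W x)"
  by (simp add: Cbd_def)

text \<open>The innermost direction, the last of the list, is split off. Inductions on
  \<open>k\<close> thereby pass from \<open>f\<close> to the functions \<open>Dl [h] f\<close>, so
  product, chain and sum rules need first derivatives only.\<close>

lemma Cbd_Suc: "Cbd (Suc k) U W f \<longleftrightarrow> (\<forall>x\<in>U. \<bar>f x\<bar> \<le> W x \<and> f differentiable (at x)) \<and>
   (\<forall>h. Cbd k U (\<lambda>x. W x * norm h) (Dl [h] f))" (is "?L \<longleftrightarrow> ?R")
proof
  assume L: ?L
  have "Cbd k U (\<lambda>x. W x * norm h) (Dl [h] f)" for h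
    unfolding Cbd_def
  proof (intro allI impI ballI)
    fix vs :: "'a list" and x assume "length vs \<le> k" "x \<in> U"
    with L[unfolded Cbd_def, rule_format, of "vs @ [h]" x]
    show "\<bar>Dl vs (Dl [h] f) x\<bar> \<le> W x * norm h * prod_list (map norm vs) \<and>
         (length vs < k \<longrightarrow> Dl vs (Dl [h] f) differentiable at x)"
      unfolding Dl_append by (simp add: mult_ac)
  qed
  with L[unfolded Cbd_def, rule_format, of "[]"] show ?R by simp
next
  assume R: ?R
  show ?L
    unfolding Cbd_def
  proof (intro allI impI ballI)
    fix vs :: "'a list" and x assume vs: "length vs \<le> Suc k" and x: "x \<in> U"
    show "\<bar>Dl vs f x\<bar> \<le> W x * prod_list (map norm vs) \<and>
         (length vs < Suc k \<longrightarrow> Dl vs f differentiable at x)"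
    proof (cases vs rule: rev_cases)
      case Nil thus ?thesis using R x by simp
    next
      case (snoc us h)
      have "Cbd k U (\<lambda>x. W x * norm h) (Dl [h] f)" using R by blast
      from this[unfolded Cbd_def, rule_format, of us x] show ?thesis
        using vs x unfolding snoc Dl_append by (simp add: mult_ac)
    qed
  qed
qed

lemma Cbd_mono:
  assumes "Cbd k U W f" "\<And>x. x \<in> U \<Longrightarrow> W x \<le> V x"
  shows "Cbd k U V f"
  unfolding Cbd_def
proof (intro allI impI ballI)
  fix vs :: "'a list" and x assume *: "length vs \<le> k" "x \<in> U"
  have "prod_list (map norm vs) \<ge> 0" by (induction vs) auto
  hence "W x * prod_list (map norm vs) \<le> V x * prod_list (map norm vs)"
    by (intro mult_right_mono assms(2) *)
  with assms(1)[unfolded Cbd_def, rule_format, OF *]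
  show "\<bar>Dl vs f x\<bar> \<le> V x * prod_list (map norm vs) \<and> (length vs < k \<longrightarrow> Dl vs f differentiable at x)"
    by linarith
qed

lemma Cbd_lower: "Cbd k U W f \<Longrightarrow> j \<le> k \<Longrightarrow> Cbd j U W f"
  unfolding Cbd_def by auto

lemma Cbd_subset: "Cbd k U W f \<Longrightarrow> V \<subseteq> U \<Longrightarrow> Cbd k V W f"
  unfolding Cbd_def by blast

lemma Cbd_bound: "Cbd k U W f \<Longrightarrow> x \<in> U \<Longrightarrow> \<bar>f x\<bar> \<le> W x"
  using Cbd_lower[of k U W f 0] by (auto simp: Cbd_0)

lemma Cbd_locally:
  assumes "\<And>x. x \<in> U \<Longrightarrow> \<exists>V. x \<in> V \<and> Cbd k V W f"
  shows "Cbd k U W f"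
  using assms unfolding Cbd_def by meson

lemma has_derivative_cong_open:
  assumes "open U" "x \<in> U" "\<And>y. y \<in> U \<Longrightarrow> f y = g y"
  shows "(f has_derivative f') (at x) \<longleftrightarrow> (g has_derivative f') (at x)"
  using assms by (metis has_derivative_transform_within_open)

lemma Dl_cong_open:
  assumes "open U" "x \<in> U" "\<And>y. y \<in> U \<Longrightarrow> f y = g y"
  shows "Dl vs f x = Dl vs g x"
  using assms(2)
proof (induction vs arbitrary: x)
  case (Cons h vs)
  show ?case
    using has_derivative_cong_open[OF assms(1) Cons.prems Cons.IH] by (simp add: frechet_derivative_def)
qed (use assms in simp)

lemma Cbd_cong:
  assumes "Cbd k U W f" "open U" "\<And>y. y \<in> U \<Longrightarrow> f y = g y"
  shows "Cbd k U W g"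
  unfolding Cbd_def
proof (intro allI impI ballI)
  fix vs :: "'a list" and x assume *: "length vs \<le> k" "x \<in> U"
  have eq: "Dl vs f y = Dl vs g y" if "y \<in> U" for y
    by (rule Dl_cong_open[OF assms(2) that assms(3)])
  have "Dl vs f differentiable at x \<longleftrightarrow> Dl vs g differentiable at x"
    unfolding differentiable_def using has_derivative_cong_open[OF assms(2) *(2) eq] by simp
  with assms(1)[unfolded Cbd_def, rule_format, OF *] eq[OF *(2)]
  show "\<bar>Dl vs g x\<bar> \<le> W x * prod_list (map norm vs) \<and> (length vs < k \<longrightarrow> Dl vs g differentiable at x)"
    by simp
qed

lemma Cbd_SucI:
  assumes "open U" "\<And>x. x \<in> U \<Longrightarrow> \<bar>f x\<bar> \<le> W x"
    and "\<And>x. x \<in> U \<Longrightarrow> (f has_derivative (\<lambda>h. f' h x)) (at x)"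
    and "\<And>h. Cbd k U (\<lambda>x. W x * norm h) (f' h)"
  shows "Cbd (Suc k) U W f"
  unfolding Cbd_Suc
proof (intro conjI ballI allI)
  fix h
  show "Cbd k U (\<lambda>x. W x * norm h) (Dl [h] f)"
    by (rule Cbd_cong[OF assms(4,1)]) (use Dl_single[OF assms(3)] in auto)
qed (use assms(2,3) in \<open>auto simp: differentiable_def\<close>)

lemma Cbd_has_derivative:
  assumes "Cbd (Suc k) U W f" "x \<in> U"
  shows "(f has_derivative (\<lambda>h. Dl [h] f x)) (at x)"
  using assms frechet_derivative_works[of f "at x"] by (simp add: Cbd_Suc)

lemma Cbd_derivative: "Cbd (Suc k) U W f \<Longrightarrow> Cbd k U (\<lambda>x. W x * norm h) (Dl [h] f)"
  by (simp only: Cbd_Suc)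

lemma Cbd_const: "open U \<Longrightarrow> Cbd k U (\<lambda>_. \<bar>c\<bar>) (\<lambda>_. c)"
proof (induction k arbitrary: c)
  case (Suc k)
  show ?case
  proof (rule Cbd_SucI[where f' = "\<lambda>_ _. 0"])
    show "Cbd k U (\<lambda>x. \<bar>c\<bar> * norm h) (\<lambda>_. 0)" for h :: 'a
      using Suc.IH[OF Suc.prems, of 0] by (rule Cbd_mono) simp
  qed (use Suc in auto)
qed (simp add: Cbd_0)

lemma Cbd_add:
  assumes "open U" "Cbd k U W f" "Cbd k U V g"
  shows "Cbd k U (\<lambda>x. W x + V x) (\<lambda>x. f x + g x)"
  using assms(2,3)
proof (induction k arbitrary: W V f g)
  case 0 thus ?case by (auto simp: Cbd_0 intro: order_trans[OF abs_triangle_ineq] add_mono)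
next
  case (Suc k)
  note b = Suc.prems[THEN Cbd_bound]
  show ?case
  proof (rule Cbd_SucI[where f' = "\<lambda>h x. Dl [h] f x + Dl [h] g x", OF assms(1)])
    show "\<bar>f x + g x\<bar> \<le> W x + V x" if "x \<in> U" for x using b[OF that] by linarith
    show "((\<lambda>x. f x + g x) has_derivative (\<lambda>h. Dl [h] f x + Dl [h] g x)) (at x)" if "x \<in> U" for x
      by (intro has_derivative_add Cbd_has_derivative[OF Suc.prems(1) that] Cbd_has_derivative[OF Suc.prems(2) that])
    show "Cbd k U (\<lambda>x. (W x + V x) * norm h) (\<lambda>x. Dl [h] f x + Dl [h] g x)" for h
      using Suc.IH[OF Suc.prems[THEN Cbd_derivative], of h h] by (simp add: ring_distribs)
  qed
qed

lemma Cbd_mult: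
  assumes "open U" "Cbd k U W f" "Cbd k U V g"
  shows "Cbd k U (\<lambda>x. 2 ^ k * W x * V x) (\<lambda>x. f x * g x)"
  using assms(2,3)
proof (induction k arbitrary: W V f g)
  case 0 thus ?case by (auto simp: Cbd_0 abs_mult intro!: mult_mono order_trans[OF abs_ge_zero])
next
  case (Suc k)
  note b = Suc.prems[THEN Cbd_bound]
  show ?case
  proof (rule Cbd_SucI[where f' = "\<lambda>h x. f x * Dl [h] g x + Dl [h] f x * g x", OF assms(1)])
    show "\<bar>f x * g x\<bar> \<le> 2 ^ Suc k * W x * V x" if "x \<in> U" for x
    proof -
      have "\<bar>f x * g x\<bar> \<le> 1 * (W x * V x)"
        using b[OF that] by (auto simp: abs_mult intro!: mult_mono order_trans[OF abs_ge_zero])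
      also have "\<dots> \<le> 2 ^ Suc k * (W x * V x)"
        using b[OF that] one_le_power[of "2::real" "Suc k"] by (intro mult_right_mono mult_nonneg_nonneg) auto
      finally show ?thesis by (simp add: mult_ac)
    qed
    show "((\<lambda>x. f x * g x) has_derivative (\<lambda>h. f x * Dl [h] g x + Dl [h] f x * g x)) (at x)" if "x \<in> U" for x
      by (intro has_derivative_mult Cbd_has_derivative[OF Suc.prems(1) that] Cbd_has_derivative[OF Suc.prems(2) that])
    fix h
    have l: "Cbd k U W f" "Cbd k U V g" using Suc.prems by (auto elim: Cbd_lower)
    have "Cbd k U (\<lambda>x. 2 ^ k * W x * (V x * norm h) + 2 ^ k * (W x * norm h) * V x)
       (\<lambda>x. f x * Dl [h] g x + Dl [h] f x * g x)"
      by (intro Cbd_add assms(1) Suc.IH l Suc.prems[THEN Cbd_derivative])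
    thus "Cbd k U (\<lambda>x. 2 ^ Suc k * W x * V x * norm h) (\<lambda>x. f x * Dl [h] g x + Dl [h] f x * g x)"
      by (rule Cbd_mono) (simp add: algebra_simps)
  qed
qed

lemma Cbd_cmult:
  assumes "open U" "Cbd k U W f"
  shows "Cbd k U (\<lambda>x. \<bar>c\<bar> * W x) (\<lambda>x. c * f x)"
  using assms(2)
proof (induction k arbitrary: W f)
  case 0 thus ?case by (auto simp: Cbd_0 abs_mult intro!: mult_left_mono)
next
  case (Suc k)
  note b = Suc.prems[THEN Cbd_bound]
  show ?case
  proof (rule Cbd_SucI[where f' = "\<lambda>h x. c * Dl [h] f x", OF assms(1)])
    show "\<bar>c * f x\<bar> \<le> \<bar>c\<bar> * W x" if "x \<in> U" for x using b[OF that] by (simp add: abs_mult mult_left_mono)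
    show "((\<lambda>x. c * f x) has_derivative (\<lambda>h. c * Dl [h] f x)) (at x)" if "x \<in> U" for x
      by (intro has_derivative_mult_right Cbd_has_derivative[OF Suc.prems that])
    show "Cbd k U (\<lambda>x. \<bar>c\<bar> * W x * norm h) (\<lambda>x. c * Dl [h] f x)" for h
      using Suc.IH[OF Suc.prems[THEN Cbd_derivative], of h] by (simp add: mult_ac)
  qed
qed

text \<open>A crude Faa di Bruno estimate. Each order contributes a further derivative of
  \<open>f\<close>, hence a factor \<open>W x\<close>, and the factor \<open>2 ^ k\<close> of
  \<open>Cbd_mult\<close>; the induction closes by \<open>k + k * k \<le> Suc k * Suc k\<close>.
  Since \<open>W x \<ge> 1\<close>, lower powers of \<open>W x\<close> are absorbed.\<close>

lemma Cbd_compose: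
  fixes g :: "real \<Rightarrow> real"
  assumes "open U" "open J" "f ` U \<subseteq> J" "Cbd k U W f" "Cbd k J V g" "\<And>x. x \<in> U \<Longrightarrow> W x \<ge> 1"
  shows "Cbd k U (\<lambda>x. 2 ^ (k * k) * V (f x) * W x ^ k) (\<lambda>x. g (f x))"
  using assms(4,5)
proof (induction k arbitrary: V g)
  case 0 thus ?case using assms(3) by (auto simp: Cbd_0)
next
  case (Suc k)
  note b = Suc.prems[THEN Cbd_bound]
  have fJ: "f x \<in> J" if "x \<in> U" for x using assms(3) that by auto
  have Vpos: "V (f x) \<ge> 0" if "x \<in> U" for x using b(2)[OF fJ[OF that]] by linarith
  have W1: "W x ^ n \<ge> 1" if "x \<in> U" for x n using assms(6)[OF that] by (rule one_le_power)
  show ?case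
  proof (rule Cbd_SucI[where f' = "\<lambda>h x. Dl [1] g (f x) * Dl [h] f x", OF assms(1)])
    show "\<bar>g (f x)\<bar> \<le> 2 ^ (Suc k * Suc k) * V (f x) * W x ^ Suc k" if "x \<in> U" for x
    proof -
      have "\<bar>g (f x)\<bar> \<le> 1 * V (f x) * 1" using b(2)[OF fJ[OF that]] by simp
      also have "\<dots> \<le> 2 ^ (Suc k * Suc k) * V (f x) * W x ^ Suc k"
        using Vpos[OF that] W1[OF that, of "Suc k"] one_le_power[of "2::real" "Suc k * Suc k"]
        by (intro mult_mono mult_nonneg_nonneg) auto
      finally show ?thesis .
    qed
    show "((\<lambda>x. g (f x)) has_derivative (\<lambda>h. Dl [1] g (f x) * Dl [h] f x)) (at x)" if x: "x \<in> U" for x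
    proof -
      have g': "(g has_derivative (\<lambda>h. Dl [h] g (f x))) (at (f x))"
        by (rule Cbd_has_derivative[OF Suc.prems(2) fJ[OF x]])
      have "Dl [h] g (f x) = Dl [1] g (f x) * h" for h
      proof -
        interpret bounded_linear "\<lambda>h. Dl [h] g (f x)" using g' by (rule has_derivative_bounded_linear)
        show ?thesis using scaleR[of h 1] by simp
      qed
      hence "(\<lambda>h. Dl [h] g (f x)) = (\<lambda>h. Dl [1] g (f x) * h)" by (rule ext)
      from back_subst[of "\<lambda>d. (g has_derivative d) (at (f x))", OF g' this]
      have "(g has_derivative (\<lambda>h. Dl [1] g (f x) * h)) (at (f x))" .
      from has_derivative_compose[OF Cbd_has_derivative[OF Suc.prems(1) x] this] show ?thesis .
    qed
    fix h
    have l: "Cbd k U W f" using Suc.prems by (auto elim: Cbd_lower)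
    have "Cbd k J V (Dl [1] g)" using Cbd_derivative[OF Suc.prems(2), of 1] by simp
    from Suc.IH[OF l this]
    have "Cbd k U (\<lambda>x. 2 ^ k * (2 ^ (k * k) * V (f x) * W x ^ k) * (W x * norm h)) (\<lambda>x. Dl [1] g (f x) * Dl [h] f x)"
      by (intro Cbd_mult assms(1) Suc.prems(1)[THEN Cbd_derivative])
    thus "Cbd k U (\<lambda>x. 2 ^ (Suc k * Suc k) * V (f x) * W x ^ Suc k * norm h) (\<lambda>x. Dl [1] g (f x) * Dl [h] f x)"
    proof (rule Cbd_mono)
      fix x assume x: "x \<in> U"
      have "(2::real) ^ k * 2 ^ (k * k) \<le> 2 ^ (Suc k * Suc k)"
        unfolding power_add[symmetric] by (rule power_increasing) auto
      hence "(2 ^ k * 2 ^ (k * k)) * (V (f x) * W x ^ Suc k * norm h) \<le> 2 ^ (Suc k * Suc k) * (V (f x) * W x ^ Suc k * norm h)"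
        using Vpos[OF x] W1[OF x, of "Suc k"] by (intro mult_right_mono mult_nonneg_nonneg) auto
      thus "2 ^ k * (2 ^ (k * k) * V (f x) * W x ^ k) * (W x * norm h) \<le> 2 ^ (Suc k * Suc k) * V (f x) * W x ^ Suc k * norm h"
        by (simp add: mult_ac)
    qed
  qed
qed

lemma Cbd_linear_compose:
  fixes L :: "'a::real_normed_vector \<Rightarrow> 'a"
  assumes "bounded_linear L" "\<And>v. norm (L v) \<le> c * norm v" "c \<ge> 1" "Cbd k UNIV W f"
  shows "Cbd k UNIV (\<lambda>x. c ^ k * W (L x)) (\<lambda>x. f (L x))"
  using assms(4)
proof (induction k arbitrary: W f)
  case 0 thus ?case by (auto simp: Cbd_0)
next
  case (Suc k)
  note b = Suc.prems[THEN Cbd_bound]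
  have Wpos: "W x \<ge> 0" for x using b[of x] by (auto intro: order_trans[OF abs_ge_zero])
  show ?case
  proof (rule Cbd_SucI[where f' = "\<lambda>h x. Dl [L h] f (L x)", OF open_UNIV])
    fix x :: 'a
    have "\<bar>f (L x)\<bar> \<le> 1 * W (L x)" using b[of "L x"] by simp
    also have "\<dots> \<le> c ^ Suc k * W (L x)"
      using one_le_power[OF assms(3), of "Suc k"] Wpos by (intro mult_right_mono) auto
    finally show "\<bar>f (L x)\<bar> \<le> c ^ Suc k * W (L x)" .
    show "((\<lambda>x. f (L x)) has_derivative (\<lambda>h. Dl [L h] f (L x))) (at x)"
      using has_derivative_compose[OF bounded_linear_imp_has_derivative[OF assms(1)]
         Cbd_has_derivative[OF Suc.prems, of "L x"]] by simp
  next
    fix h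
    from Suc.IH[OF Cbd_derivative[OF Suc.prems, of "L h"]]
    show "Cbd k UNIV (\<lambda>x. c ^ Suc k * W (L x) * norm h) (\<lambda>x. Dl [L h] f (L x))"
    proof (rule Cbd_mono)
      fix x
      have "c ^ k * W (L x) * norm (L h) \<le> c ^ k * W (L x) * (c * norm h)"
        using assms(2,3) Wpos by (intro mult_left_mono mult_nonneg_nonneg) auto
      thus "c ^ k * (W (L x) * norm (L h)) \<le> c ^ Suc k * W (L x) * norm h" by (simp add: mult_ac)
    qed
  qed
qed

text \<open>The Weierstrass criterion: \<open>M i\<close> majorises the summands and, per unit of
  direction, their derivatives, so the differentiated series converges uniformly on the convex set
  \<open>U\<close>.\<close>

lemma Cbd_suminf_has_derivative:
  assumes U: "open U" "convex U"
    and f: "\<And>i::nat. Cbd (Suc k) U (\<lambda>_. M i) (f i)" and M: "summable M" and x0: "x0 \<in> U"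
  shows "((\<lambda>x. \<Sum>i. f i x) has_derivative (\<lambda>h. \<Sum>i. Dl [h] (f i) x0)) (at x0)"
proof -
  note b = f[THEN Cbd_bound]
  have summ: "summable (\<lambda>i. g i x)" if "\<And>i. \<bar>g i x\<bar> \<le> M' i" "summable M'" for g :: "nat \<Rightarrow> 'a \<Rightarrow> real" and M' x
    by (rule summable_comparison_test'[OF that(2), of 0]) (use that(1) in auto)
  have db: "\<bar>Dl [h] (f i) x\<bar> \<le> M i * norm h" if "x \<in> U" for h i x
    using Cbd_bound[OF Cbd_derivative[OF f] that] .
  have dsum: "summable (\<lambda>i. Dl [h] (f i) x)" if "x \<in> U" for h x
    by (rule summ[where g = "\<lambda>i. Dl [h] (f i)" and M' = "\<lambda>i. M i * norm h" and x = x])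
       (rule db[OF that], rule summable_mult2[OF M])
  let ?g = "\<lambda>x h. \<Sum>i. Dl [h] (f i) x"
  have "\<exists>g. \<forall>x\<in>U. (\<lambda>n. f n x) sums (g x) \<and> (g has_derivative ?g x) (at x within U)"
  proof (rule has_derivative_series[where f = f and f' = "\<lambda>i x h. Dl [h] (f i) x" and g' = ?g
        and x = x0 and l = "\<Sum>n. f n x0", OF U(2)])
    show "(f n has_derivative (\<lambda>h. Dl [h] (f n) x)) (at x within U)" if "x \<in> U" for n x
      by (rule has_derivative_at_withinI[OF Cbd_has_derivative[OF f that]])
    fix e :: real assume e: "e > 0"
    from suminf_exist_split[OF e M] obtain N
      where N: "\<And>n. n \<ge> N \<Longrightarrow> norm (\<Sum>i. M (i + n)) < e" by blast
    show "\<forall>\<^sub>F n in sequentially. \<forall>x\<in>U. \<forall>h. norm ((\<Sum>i<n. Dl [h] (f i) x) - ?g x h) \<le> e * norm h"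
    proof (rule eventually_sequentiallyI, intro ballI allI)
      fix n x h assume n: "n \<ge> N" and x: "x \<in> U"
      have Ms: "summable (\<lambda>i. M (i + n))" using M by (rule summable_ignore_initial_segment)
      have "?g x h - (\<Sum>i<n. Dl [h] (f i) x) = (\<Sum>i. Dl [h] (f (i + n)) x)"
        using suminf_split_initial_segment[OF dsum[OF x, of h], of n] by linarith
      also have "\<bar>\<dots>\<bar> \<le> (\<Sum>i. M (i + n) * norm h)"
        using norm_suminf_le[OF _ summable_mult2[OF Ms], of "\<lambda>i. Dl [h] (f (i + n)) x"] db[OF x]
        by (simp only: real_norm_def)
      also have "\<dots> = (\<Sum>i. M (i + n)) * norm h" by (rule suminf_mult2[OF Ms, symmetric])
      also have "\<dots> \<le> e * norm h"
        using N[OF n] by (intro mult_right_mono) auto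
      finally show "norm ((\<Sum>i<n. Dl [h] (f i) x) - ?g x h) \<le> e * norm h"
        by (simp add: norm_minus_commute abs_minus_commute)
    qed
  next
    show "(\<lambda>n. f n x0) sums (\<Sum>n. f n x0)"
      by (rule summable_sums, rule summ[where g = f and M' = M and x = x0]) (rule b[OF x0], rule M)
  qed (rule x0)
  then obtain g where g: "\<And>x. x \<in> U \<Longrightarrow> (\<lambda>n. f n x) sums (g x)"
    "\<And>x. x \<in> U \<Longrightarrow> (g has_derivative ?g x) (at x within U)" by blast
  have eq: "g x = (\<Sum>i. f i x)" if "x \<in> U" for x using g(1)[OF that] by (rule sums_unique)
  have "(g has_derivative ?g x0) (at x0)" using g(2)[OF x0] at_within_open[OF x0 U(1)] by simp
  thus ?thesis using has_derivative_cong_open[OF U(1) x0 eq] by simp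
qed

lemma Cbd_suminf:
  assumes U: "open U" "convex U"
    and f: "\<And>i::nat. Cbd k U (\<lambda>_. M i) (f i)" and M: "summable M"
  shows "Cbd k U (\<lambda>_. suminf M) (\<lambda>x. \<Sum>i. f i x)"
  using f M
proof (induction k arbitrary: f M)
  case 0
  thus ?case using norm_suminf_le[of "\<lambda>i. f i _" M] by (simp add: Cbd_0)
next
  case (Suc k)
  show ?case
  proof (rule Cbd_SucI[OF U(1), where f' = "\<lambda>h x. \<Sum>i. Dl [h] (f i) x"])
    fix x assume x: "x \<in> U"
    show "\<bar>\<Sum>i. f i x\<bar> \<le> suminf M"
      using norm_suminf_le[OF _ Suc.prems(2), of "\<lambda>i. f i x"] Cbd_bound[OF Suc.prems(1) x]
      by (simp only: real_norm_def)
    show "((\<lambda>x. \<Sum>i. f i x) has_derivative (\<lambda>h. \<Sum>i. Dl [h] (f i) x)) (at x)"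
      by (rule Cbd_suminf_has_derivative[OF U Suc.prems x])
  next
    fix h
    have "Cbd k U (\<lambda>_. \<Sum>i. M i * norm h) (\<lambda>x. \<Sum>i. Dl [h] (f i) x)"
      by (rule Suc.IH) (use Suc.prems in \<open>auto intro: summable_mult2 Cbd_derivative simp del: Dl.simps\<close>)
    thus "Cbd k U (\<lambda>x. suminf M * norm h) (\<lambda>x. \<Sum>i. Dl [h] (f i) x)"
      by (simp only: suminf_mult2[OF Suc.prems(2), symmetric])
  qed
qed

lemma Cbd_Lipschitz:
  assumes "convex U" "Cbd (Suc k) U (\<lambda>_. M) f" "x \<in> U" "y \<in> U"
  shows "\<bar>f x - f y\<bar> \<le> M * norm (x - y)"
proof -
  have "norm (f x - f y) \<le> M * norm (x - y)"
  proof (rule differentiable_bound[OF assms(1)])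
    fix z assume z: "z \<in> U"
    show "(f has_derivative (\<lambda>h. Dl [h] f z)) (at z within U)"
      by (rule has_derivative_at_withinI[OF Cbd_has_derivative[OF assms(2) z]])
    have "M \<ge> 0" using Cbd_bound[OF assms(2) z] by (auto intro: order_trans[OF abs_ge_zero])
    moreover have "norm (Dl [h] f z) \<le> M * norm h" for h
      using Cbd_bound[OF Cbd_derivative[OF assms(2)] z] by (simp only: real_norm_def)
    ultimately show "onorm (\<lambda>h. Dl [h] f z) \<le> M" by (rule onorm_bound)
  qed (use assms in auto)
  thus ?thesis by simp
qed

text \<open>One order is lost, because continuity of the derivatives of order \<open>k\<close> is
  inferred from their differentiability.\<close>

lemma Cbd_imp_Ck_on:
  assumes "open U" "Cbd (Suc k) U W f"
  shows "Ck_on k U f"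
  unfolding Ck_on_def
proof (intro conjI exI[of _ "\<lambda>vs. Dl vs f"] allI impI ballI assms(1))
  have d: "Dl vs f differentiable (at x)" if "length vs \<le> k" "x \<in> U" for vs x
    using assms(2) that unfolding Cbd_def by (meson le_imp_less_Suc le_SucI)
  fix vs :: "'a list"
  show "continuous_on U (Dl vs f)" if "length vs \<le> k"
    using d[OF that] by (meson continuous_at_imp_continuous_on differentiable_imp_continuous_within)
  show "(Dl vs f has_derivative (\<lambda>h. Dl (h # vs) f x)) (at x)" if "length vs < k" "x \<in> U" for x
    using d[of vs x] that frechet_derivative_works[of "Dl vs f" "at x"] by simp
qed simp

text \<open>\<open>C\<close> and \<open>m\<close> are uniform over the index set. This matters for
  the family \<open>Phi s\<close>, since every scale uses its own \<open>s\<close>. Under dilation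
  by powers of \<open>1 / r\<close>, polynomially growing derivatives increase only by powers of
  \<open>1 / r\<close>, which a power of \<open>r\<close> can compensate.\<close>

definition pgrow :: "nat \<Rightarrow> 'a::real_normed_vector set \<Rightarrow> 'i set \<Rightarrow> ('i \<Rightarrow> 'a \<Rightarrow> real) \<Rightarrow> bool" where
  "pgrow k U S F \<longleftrightarrow> open U \<and> (\<exists>C\<ge>1. \<exists>m. \<forall>s\<in>S. Cbd k U (\<lambda>x. C * (1 + norm x) ^ m) (F s))"

lemma pgrowI:
  assumes "open U" "\<And>s. s \<in> S \<Longrightarrow> Cbd k U (\<lambda>x. C * (1 + norm x) ^ m) (F s)"
  shows "pgrow k U S F"
  unfolding pgrow_def
proof (intro conjI exI[of _ "max 1 C"] exI[of _ m] ballI assms(1))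
  fix s assume "s \<in> S"
  from assms(2)[OF this] show "Cbd k U (\<lambda>x. max 1 C * (1 + norm x) ^ m) (F s)"
    by (rule Cbd_mono) (auto intro!: mult_right_mono)
qed simp

lemma pgrow_const:
  assumes "open U" "\<And>s. s \<in> S \<Longrightarrow> \<bar>c s\<bar> \<le> B"
  shows "pgrow k U S (\<lambda>s _. c s)"
  by (rule pgrowI[where C = B and m = 0], fact, rule Cbd_mono[OF Cbd_const])
     (use assms in auto)

lemma pgrow_linear:
  assumes "open U" "bounded_linear l"
  shows "pgrow k U S (\<lambda>_. l)"
proof -
  interpret bounded_linear l by fact
  obtain K where K: "K \<ge> 0" "\<And>x. norm (l x) \<le> norm x * K" using nonneg_bounded by blast
  have b: "\<bar>l x\<bar> \<le> K * (1 + norm x) ^ 1" for x using K(2)[of x] K(1) by (simp add: algebra_simps)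
  show ?thesis
  proof (rule pgrowI[OF assms(1)])
    show "Cbd k U (\<lambda>x. K * (1 + norm x) ^ 1) l"
    proof (cases k)
      case 0 thus ?thesis using b by (simp add: Cbd_0)
    next
      case (Suc j)
      have "Cbd (Suc j) U (\<lambda>x. K * (1 + norm x) ^ 1) l"
      proof (rule Cbd_SucI[OF assms(1) b, where f' = "\<lambda>h _. l h"])
        show "(l has_derivative l) (at x)" for x by (rule bounded_linear_imp_has_derivative[OF assms(2)])
        fix h
        show "Cbd j U (\<lambda>x. K * (1 + norm x) ^ 1 * norm h) (\<lambda>_. l h)"
        proof (rule Cbd_mono[OF Cbd_const[OF assms(1)]])
          fix x
          have "\<bar>l h\<bar> \<le> (K * 1) * norm h" using K(2)[of h] by (simp add: mult_ac)
          also have "\<dots> \<le> (K * (1 + norm x) ^ 1) * norm h"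
            using K(1) by (intro mult_right_mono mult_left_mono) auto
          finally show "\<bar>l h\<bar> \<le> K * (1 + norm x) ^ 1 * norm h" .
        qed
      qed
      thus ?thesis unfolding Suc .
    qed
  qed
qed

lemma pgrow_add:
  assumes "pgrow k U S F" "pgrow k U S G"
  shows "pgrow k U S (\<lambda>s x. F s x + G s x)"
proof -
  from assms obtain C m D n where U: "open U" and C: "C \<ge> 1" "D \<ge> 1"
    "\<And>s. s \<in> S \<Longrightarrow> Cbd k U (\<lambda>x. C * (1 + norm x) ^ m) (F s)"
    "\<And>s. s \<in> S \<Longrightarrow> Cbd k U (\<lambda>x. D * (1 + norm x) ^ n) (G s)"
    unfolding pgrow_def by blast
  show ?thesis
  proof (rule pgrowI[OF U, where C = "C + D" and m = "m + n"])
    fix s assume s: "s \<in> S"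
    show "Cbd k U (\<lambda>x. (C + D) * (1 + norm x) ^ (m + n)) (\<lambda>x. F s x + G s x)"
    proof (rule Cbd_mono[OF Cbd_add[OF U C(3,4)[OF s]]])
      fix x :: 'a
      have "(1 + norm x) ^ m \<le> (1 + norm x) ^ (m + n)" "(1 + norm x) ^ n \<le> (1 + norm x) ^ (m + n)"
        by (auto intro: power_increasing)
      thus "C * (1 + norm x) ^ m + D * (1 + norm x) ^ n \<le> (C + D) * (1 + norm x) ^ (m + n)"
        using C(1,2) by (auto simp: ring_distribs intro!: add_mono mult_left_mono)
    qed
  qed
qed

lemma pgrow_mult:
  assumes "pgrow k U S F" "pgrow k U S G"
  shows "pgrow k U S (\<lambda>s x. F s x * G s x)"
proof -
  from assms obtain C m D n where U: "open U" and C: "C \<ge> 1" "D \<ge> 1"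
    "\<And>s. s \<in> S \<Longrightarrow> Cbd k U (\<lambda>x. C * (1 + norm x) ^ m) (F s)"
    "\<And>s. s \<in> S \<Longrightarrow> Cbd k U (\<lambda>x. D * (1 + norm x) ^ n) (G s)"
    unfolding pgrow_def by blast
  show ?thesis
    by (rule pgrowI[OF U, where C = "2 ^ k * C * D" and m = "m + n"],
        rule Cbd_mono[OF Cbd_mult[OF U C(3,4)]]) (auto simp: power_add)
qed

lemma pgrow_uminus: "pgrow k U S F \<Longrightarrow> pgrow k U S (\<lambda>s x. - F s x)"
  using pgrow_mult[OF pgrow_const[of U S "\<lambda>_. -1" 1], of k F] by (auto simp: pgrow_def)

lemma pgrow_diff: "pgrow k U S F \<Longrightarrow> pgrow k U S G \<Longrightarrow> pgrow k U S (\<lambda>s x. F s x - G s x)"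
  using pgrow_add[OF _ pgrow_uminus, of k U S F G] by simp

lemma pgrow_power: "pgrow k U S F \<Longrightarrow> pgrow k U S (\<lambda>s x. F s x ^ n)"
proof (induction n)
  case 0
  thus ?case using pgrow_const[of U S "\<lambda>_. 1" 1] by (auto simp: pgrow_def)
next
  case (Suc n)
  thus ?case using pgrow_mult[of k U S F] by simp
qed

lemma pgrow_compose:
  fixes g :: "real \<Rightarrow> real"
  assumes "pgrow k U S F" "pgrow k J S (\<lambda>_. g)" "\<And>s x. s \<in> S \<Longrightarrow> x \<in> U \<Longrightarrow> F s x \<in> J"
  shows "pgrow k U S (\<lambda>s x. g (F s x))"
proof -
  from assms obtain C m D n where U: "open U" "open J" and C: "C \<ge> 1" "D \<ge> 1"
    "\<And>s. s \<in> S \<Longrightarrow> Cbd k U (\<lambda>x. C * (1 + norm x) ^ m) (F s)"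
    "\<And>s. s \<in> S \<Longrightarrow> Cbd k J (\<lambda>x. D * (1 + norm x) ^ n) g"
    unfolding pgrow_def by blast
  show ?thesis
  proof (rule pgrowI[OF U(1), where C = "2 ^ (k * k) * D * (2 * C) ^ n * C ^ k" and m = "m * n + m * k"])
    fix s assume s: "s \<in> S"
    have W1: "C * (1 + norm x) ^ m \<ge> 1" for x :: 'a
    proof -
      have "1 * 1 \<le> C * (1 + norm x) ^ m"
        using C(1) by (intro mult_mono one_le_power) auto
      thus ?thesis by simp
    qed
    show "Cbd k U (\<lambda>x. 2 ^ (k * k) * D * (2 * C) ^ n * C ^ k * (1 + norm x) ^ (m * n + m * k)) (\<lambda>x. g (F s x))"
    proof (rule Cbd_mono[OF Cbd_compose[OF U _ C(3)[OF s] C(4)[OF s] W1]])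
      show "F s ` U \<subseteq> J" using assms(3)[OF s] by auto
      fix x assume x: "x \<in> U"
      have "1 + norm (F s x) \<le> 2 * C * (1 + norm x) ^ m"
        using Cbd_bound[OF C(3)[OF s] x] W1[of x] by simp
      hence "(1 + norm (F s x)) ^ n \<le> (2 * C * (1 + norm x) ^ m) ^ n" by (intro power_mono) auto
      hence "2 ^ (k * k) * (D * (1 + norm (F s x)) ^ n) * (C * (1 + norm x) ^ m) ^ k
         \<le> 2 ^ (k * k) * (D * (2 * C * (1 + norm x) ^ m) ^ n) * (C * (1 + norm x) ^ m) ^ k"
        using C(1,2) by (intro mult_right_mono mult_left_mono) auto
      also have "\<dots> = 2 ^ (k * k) * D * (2 * C) ^ n * C ^ k * (1 + norm x) ^ (m * n + m * k)"
        by (simp add: power_mult_distrib power_add power_mult[symmetric] mult_ac)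
      finally show "2 ^ (k * k) * (D * (1 + norm (F s x)) ^ n) * (C * (1 + norm x) ^ m) ^ k
         \<le> 2 ^ (k * k) * D * (2 * C) ^ n * C ^ k * (1 + norm x) ^ (m * n + m * k)" .
    qed
  qed
qed

lemma pgrow_cong:
  assumes "pgrow k U S F" "\<And>s x. s \<in> S \<Longrightarrow> x \<in> U \<Longrightarrow> F s x = G s x"
  shows "pgrow k U S G"
  using assms unfolding pgrow_def by (metis Cbd_cong)

lemma pgrow_subset: "pgrow k U S F \<Longrightarrow> open V \<Longrightarrow> V \<subseteq> U \<Longrightarrow> pgrow k V S F"
  unfolding pgrow_def by (meson Cbd_subset)

text \<open>Derivative bounds are pointwise statements on open sets, so a function given by several
  formulas is treated one set of an open cover at a time.\<close>

lemma pgrow_Un: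
  assumes "pgrow k U S F" "pgrow k V S F"
  shows "pgrow k (U \<union> V) S F"
proof -
  from assms obtain C m D n where U: "open U" "open V" and C: "C \<ge> 1" "D \<ge> 1"
    "\<And>s. s \<in> S \<Longrightarrow> Cbd k U (\<lambda>x. C * (1 + norm x) ^ m) (F s)"
    "\<And>s. s \<in> S \<Longrightarrow> Cbd k V (\<lambda>x. D * (1 + norm x) ^ n) (F s)"
    unfolding pgrow_def by blast
  show ?thesis
  proof (rule pgrowI[where C = "C + D" and m = "m + n"])
    fix s assume s: "s \<in> S"
    have le: "C * (1 + norm x) ^ m \<le> (C + D) * (1 + norm x) ^ (m + n)"
      "D * (1 + norm x) ^ n \<le> (C + D) * (1 + norm x) ^ (m + n)" for x :: 'a
      using C(1,2) by (auto intro!: mult_mono power_increasing)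
    show "Cbd k (U \<union> V) (\<lambda>x. (C + D) * (1 + norm x) ^ (m + n)) (F s)"
      by (rule Cbd_locally) (use Cbd_mono[OF C(3)[OF s] le(1)] Cbd_mono[OF C(4)[OF s] le(2)] in blast)
  qed (use U in auto)
qed

subsection \<open>A smooth convex ramp\<close>

lemma has_real_derivative_imp_has_derivative:
  fixes f :: "real \<Rightarrow> real"
  shows
  "(f has_real_derivative d) (at t) \<Longrightarrow> (f has_derivative (\<lambda>h. h * d)) (at t)"
  by (simp add: has_field_derivative_def mult_commute_abs)

text \<open>Integration gains one order. The growth of \<open>f\<close> itself is a separate
  assumption, as \<open>U\<close> may be any open set.\<close>

lemma pgrow_antiderivative:
  fixes f :: "real \<Rightarrow> real"
  assumes g: "pgrow k U S (\<lambda>_. g)" and der: "\<And>t. t \<in> U \<Longrightarrow> (f has_real_derivative g t) (at t)"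
    and bd: "\<And>t. t \<in> U \<Longrightarrow> \<bar>f t\<bar> \<le> A * (1 + \<bar>t\<bar>)"
  shows "pgrow (Suc k) U S (\<lambda>_. f)"
proof (cases "S = {}")
  case False
  then obtain C m where U: "open U" and C: "C \<ge> 1" "Cbd k U (\<lambda>x. C * (1 + norm x) ^ m) g"
    using g unfolding pgrow_def by blast
  have pw: "(1 + norm t) ^ m \<le> (1 + norm t) ^ Suc m" for t :: real
    by (rule power_increasing) auto
  show ?thesis
  proof (rule pgrowI[OF U, where C = "max A C" and m = "Suc m"], rule Cbd_SucI[OF U, where f' = "\<lambda>h t. h * g t"])
    fix t assume t: "t \<in> U"
    have "\<bar>f t\<bar> \<le> A * (1 + \<bar>t\<bar>) ^ 1" using bd[OF t] by simp
    also have "\<dots> \<le> max A C * (1 + \<bar>t\<bar>) ^ Suc m"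
      using C(1) by (intro mult_mono power_increasing) auto
    finally show "\<bar>f t\<bar> \<le> max A C * (1 + norm t) ^ Suc m" by simp
    show "(f has_derivative (\<lambda>h. h * g t)) (at t)"
      by (rule has_real_derivative_imp_has_derivative[OF der[OF t]])
  next
    fix h :: real
    show "Cbd k U (\<lambda>x. max A C * (1 + norm x) ^ Suc m * norm h) (\<lambda>t. h * g t)"
    proof (rule Cbd_mono[OF Cbd_cmult[OF U C(2), of h]])
      fix t :: real
      have "C * (1 + norm t) ^ m \<le> max A C * (1 + norm t) ^ Suc m"
        using C(1) pw[of t] by (intro mult_mono) auto
      hence "\<bar>h\<bar> * (C * (1 + norm t) ^ m) \<le> \<bar>h\<bar> * (max A C * (1 + norm t) ^ Suc m)"
        by (rule mult_left_mono) simp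
      thus "\<bar>h\<bar> * (C * (1 + norm t) ^ m) \<le> max A C * (1 + norm t) ^ Suc m * norm h"
        by (simp only: real_norm_def mult.commute)
    qed
  qed
qed (use g in \<open>auto simp: pgrow_def intro: exI[of _ 1]\<close>)

lemma pgrow_inverse:
  assumes "c > 0"
  shows "pgrow k {c<..} S (\<lambda>_. inverse :: real \<Rightarrow> real)"
proof -
  have "\<exists>C. Cbd k {c<..} (\<lambda>_. C) inverse"
  proof (induction k)
    case 0
    have "\<bar>inverse t\<bar> \<le> inverse c" if "t \<in> {c<..}" for t
      using that assms by (auto intro!: le_imp_inverse_le)
    thus ?case by (intro exI[of _ "inverse c"]) (simp add: Cbd_0)
  next
    case (Suc k)
    then obtain C where C: "Cbd k {c<..} (\<lambda>_. C) inverse" by blast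
    let ?D = "max (inverse c) (2 ^ k * C * C)"
    have "Cbd (Suc k) {c<..} (\<lambda>_. ?D) inverse"
    proof (rule Cbd_SucI[where f' = "\<lambda>h t. - h * (inverse t * inverse t)"])
      show "\<bar>inverse t\<bar> \<le> ?D" if "t \<in> {c<..}" for t
        using that assms by (intro max.coboundedI1) (auto intro!: le_imp_inverse_le)
      show "(inverse has_derivative (\<lambda>h. - h * (inverse t * inverse t))) (at t)" if "t \<in> {c<..}" for t
        using that assms by (auto intro!: derivative_eq_intros simp: mult_ac)
      show "Cbd k {c<..} (\<lambda>x. ?D * norm h) (\<lambda>t. - h * (inverse t * inverse t))" for h
        by (rule Cbd_mono[OF Cbd_cmult[OF _ Cbd_mult[OF _ C C]]])
           (simp_all add: mult.commute[of _ "\<bar>h\<bar>"] mult_left_mono)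
    qed auto
    thus ?case by blast
  qed
  then obtain C where "Cbd k {c<..} (\<lambda>_. C) inverse" ..
  thus ?thesis by (intro pgrowI[where C = C and m = 0]) auto
qed

lemma pgrow_lower: "pgrow k U S F \<Longrightarrow> j \<le> k \<Longrightarrow> pgrow j U S F"
  unfolding pgrow_def by (meson Cbd_lower)

lemma pgrow_ln:
  assumes "c > 0"
  shows "pgrow k {c<..} S (\<lambda>_. ln :: real \<Rightarrow> real)"
proof (rule pgrow_lower)
  show "pgrow (Suc k) {c<..} S (\<lambda>_. ln :: real \<Rightarrow> real)"
  proof (rule pgrow_antiderivative[OF pgrow_inverse[OF assms], where A = "1 + 1 / c"])
    fix t assume t: "t \<in> {c<..}"
    hence "t > 0" using assms by auto
    thus "(ln has_real_derivative inverse t) (at t)" by (rule DERIV_ln)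
    have "ln t \<le> t" using \<open>t > 0\<close> ln_bound by blast
    moreover have "- ln t \<le> 1 / t" using ln_bound[of "1 / t"] \<open>t > 0\<close> by (simp add: ln_div)
    moreover have "1 / t \<le> 1 / c" using t assms by (auto intro!: divide_left_mono)
    moreover have "(1 + 1 / c) * (1 + \<bar>t\<bar>) = 1 + t + 1/c + t / c" using \<open>t > 0\<close> by (simp add: ring_distribs add_divide_distrib)
    moreover have "1 / c > 0" "t / c > 0" using assms \<open>t > 0\<close> by auto
    ultimately show "\<bar>ln t\<bar> \<le> (1 + 1 / c) * (1 + \<bar>t\<bar>)" using \<open>t > 0\<close> by linarith
  qed
qed auto

lemma DERIV_pos_part_power:
  assumes "n \<ge> 1"
  shows "((\<lambda>t. max 0 t ^ Suc n) has_real_derivative (real (Suc n) * max 0 t ^ n)) (at t)"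
proof -
  consider "t < 0" | "t > 0" | "t = 0" by linarith
  thus ?thesis
  proof cases
    case 1
    have "((\<lambda>_. 0) has_real_derivative 0) (at t)" by simp
    hence "((\<lambda>t. max 0 t ^ Suc n) has_real_derivative 0) (at t)"
      by (rule has_field_derivative_transform_within_open[where S = "{..<0}"]) (use 1 in auto)
    thus ?thesis using 1 assms by (simp add: max_def power_0_left)
  next
    case 2
    have "((\<lambda>t. t ^ Suc n) has_real_derivative (real (Suc n) * t ^ n)) (at t)"
      using DERIV_pow[of "Suc n" t] by simp
    hence "((\<lambda>t. max 0 t ^ Suc n) has_real_derivative (real (Suc n) * t ^ n)) (at t)"
      by (rule has_field_derivative_transform_within_open[where S = "{0<..}"]) (use 2 in auto)
    thus ?thesis using 2 by (simp add: max_def)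
  next
    case 3
    have "((\<lambda>y. max 0 y ^ n) \<longlongrightarrow> max 0 0 ^ n) (at (0::real))"
      by (intro tendsto_intros)
    moreover have "\<forall>\<^sub>F y in at (0::real). max 0 y ^ n = (max 0 y ^ Suc n - max 0 0 ^ Suc n) / (y - 0)"
      unfolding eventually_at using assms
      by (intro exI[of _ 1]) (auto simp: max_def power_0_left)
    ultimately have "((\<lambda>y. (max 0 y ^ Suc n - max 0 0 ^ Suc n) / (y - 0)) \<longlongrightarrow> max 0 0 ^ n) (at (0::real))"
      by (rule Lim_transform_eventually)
    thus ?thesis using 3 assms by (simp add: has_field_derivative_iff power_0_left)
  qed
qed

text \<open>Each differentiation lowers the exponent by one, and \<open>n > k\<close> keeps every
  exponent that still has to be differentiated at least 2, which secures the derivative at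
  0.\<close>

lemma pgrow_pos_part_power:
  assumes "n > k"
  shows "pgrow k UNIV S (\<lambda>_ t. max 0 t ^ n :: real)"
proof -
  have "\<exists>C. Cbd k UNIV (\<lambda>t. C * (1 + norm t) ^ n) (\<lambda>t::real. max 0 t ^ n)"
    using assms
  proof (induction k arbitrary: n)
    case 0
    have "\<bar>max 0 t ^ n\<bar> \<le> 1 * (1 + norm t) ^ n" for t :: real
      by (simp add: power_abs) (auto intro!: power_mono)
    thus ?case by (intro exI[of _ 1]) (simp add: Cbd_0)
  next
    case (Suc k)
    then obtain n' where n: "n = Suc n'" "n' > k" "n' \<ge> 1" by (cases n) auto
    from Suc.IH[OF n(2)] obtain C where C: "Cbd k UNIV (\<lambda>t. C * (1 + norm t) ^ n') (\<lambda>t::real. max 0 t ^ n')" by blast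
    have "C \<ge> 0" using Cbd_bound[OF C, of 0] n(3) by (simp add: power_0_left)
    let ?D = "1 + real n * C"
    have "Cbd (Suc k) UNIV (\<lambda>t. ?D * (1 + norm t) ^ n) (\<lambda>t::real. max 0 t ^ n)"
    proof (rule Cbd_SucI[where f' = "\<lambda>h t. (h * real n) * max 0 t ^ n'", OF open_UNIV])
      fix t h :: real
      have "\<bar>max 0 t ^ n\<bar> \<le> 1 * (1 + norm t) ^ n"
        by (simp add: power_abs) (auto intro!: power_mono)
      also have "\<dots> \<le> ?D * (1 + norm t) ^ n" using \<open>C \<ge> 0\<close> by (intro mult_right_mono) auto
      finally show "\<bar>max 0 t ^ n\<bar> \<le> ?D * (1 + norm t) ^ n" .
      show "((\<lambda>t. max 0 t ^ n) has_derivative (\<lambda>h. (h * real n) * max 0 t ^ n')) (at t)"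
        using has_real_derivative_imp_has_derivative[OF DERIV_pos_part_power[OF n(3), of t]]
        unfolding n(1) by (simp only: mult.assoc)
      show "Cbd k UNIV (\<lambda>t. ?D * (1 + norm t) ^ n * norm h) (\<lambda>t. (h * real n) * max 0 t ^ n')"
      proof (rule Cbd_mono[OF Cbd_cmult[OF open_UNIV C]])
        fix t :: real
        have "(1 + norm t) ^ n' \<le> (1 + norm t) ^ n" unfolding n(1) by (rule power_increasing) auto
        hence "(real n * C) * (1 + norm t) ^ n' \<le> ?D * (1 + norm t) ^ n" using \<open>C \<ge> 0\<close> by (intro mult_mono) auto
        hence "\<bar>h\<bar> * (real n * C * (1 + norm t) ^ n') \<le> \<bar>h\<bar> * (?D * (1 + norm t) ^ n)" by (rule mult_left_mono) simp
        thus "\<bar>h * real n\<bar> * (C * (1 + norm t) ^ n') \<le> ?D * (1 + norm t) ^ n * norm h"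
          by (simp add: abs_mult mult_ac)
      qed
    qed
    thus ?case by blast
  qed
  thus ?thesis by (auto intro: pgrowI)
qed

lemma mono_deriv_imp_above_tangent:
  fixes f g :: "real \<Rightarrow> real"
  assumes der: "\<And>t. (f has_real_derivative g t) (at t)" and mono: "\<And>x y. x \<le> y \<Longrightarrow> g x \<le> g y"
  shows "f x + g x * (y - x) \<le> f y"
proof -
  have "convex_on UNIV f" by (rule convex_on_realI[OF _ _ mono]) (use der in auto)
  from convex_on_imp_above_tangent[OF this, of x y "g x"] der[of x] show ?thesis by simp
qed

text \<open>The slope \<open>s\<close> rises from 0 to 1 as a quotient of truncated powers; its
  antiderivative is convex and is shifted so as to become the identity on the right. With such a
  ramp, \<open>g + ramp (f - g)\<close> is a regularised maximum of \<open>f\<close> and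
  \<open>g\<close>. The support lines in the last clause are what plurisubharmonicity of this
  maximum rests on.\<close>

lemma smooth_convex_ramp:
  obtains ramp :: "real \<Rightarrow> real" where
    "\<And>S. pgrow k UNIV (S :: 'i set) (\<lambda>_. ramp)"
    "continuous_on UNIV ramp"
    "\<And>t. t \<le> -1 \<Longrightarrow> ramp t = 0" "\<And>t. t \<ge> 1 \<Longrightarrow> ramp t = t"
    "\<And>x. \<exists>m. 0 \<le> m \<and> m \<le> 1 \<and> (\<forall>y. ramp x + m * (y - x) \<le> ramp y)"
proof -
  define p where "p t = max 0 t ^ (k + 2)" for t :: real
  define d where "d t = p t + p (1 - t)" for t
  define s where "s t = p t / d t" for t
  \<comment> \<open>One of \<open>t\<close> and \<open>1 - t\<close> is at least 1/2, so
    \<open>d t\<close> is at least \<open>(1/2) ^ (k + 2)\<close>. The exponent \<open>k + 3\<close>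
    makes the bound strict, as the open half-line of \<open>pgrow_inverse\<close> requires.\<close>
  define c0 :: real where "c0 = (1/2) ^ (k + 3)"
  have c0: "c0 > 0" by (simp add: c0_def)
  have p0: "p t \<ge> 0" for t by (simp add: p_def)
  have pmono: "p x \<le> p y" if "x \<le> y" for x y
    using that unfolding p_def by (intro power_mono) auto
  have d: "d t > c0" for t
  proof -
    have "c0 < (1/2) ^ (k + 2)" unfolding c0_def by (rule power_strict_decreasing) auto
    also have "\<dots> = p (1/2)" by (simp add: p_def)
    also have "\<dots> \<le> d t"
    proof (cases "t \<ge> 1/2")
      case True
      have "p (1/2) \<le> p t" by (rule pmono[OF True])
      thus ?thesis using p0[of "1 - t"] by (simp add: d_def)
    next
      case False
      hence "p (1/2) \<le> p (1 - t)" by (intro pmono) auto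
      thus ?thesis using p0[of t] by (simp add: d_def)
    qed
    finally show ?thesis .
  qed
  have d0: "d t > 0" for t using d[of t] c0 by linarith
  have s01: "0 \<le> s t" "s t \<le> 1" for t
    using d0[of t] p0[of t] p0[of "1 - t"] by (auto simp: s_def d_def)
  have smono: "s x \<le> s y" if "x \<le> y" for x y
  proof -
    have "p x * p (1 - y) \<le> p y * p (1 - x)"
      using that by (intro mult_mono pmono p0) auto
    thus ?thesis unfolding s_def using d0[of x] d0[of y] by (simp add: field_simps d_def)
  qed
  have s0: "s t = 0" if "t \<le> 0" for t using that by (simp add: s_def p_def max_def)
  have s1: "s t = 1" if "t \<ge> 1" for t using that d0[of t] by (simp add: s_def d_def p_def max_def)
  have conts: "continuous_on UNIV s"
    unfolding s_def d_def p_def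
    by (intro continuous_intros) (use d0 in \<open>auto simp: d_def p_def less_imp_neq[symmetric]\<close>)
  have "\<exists>F. \<forall>x::real. -\<infinity> < ereal x \<longrightarrow> ereal x < \<infinity> \<longrightarrow> (F has_vector_derivative s x) (at x)"
    by (rule einterval_antiderivative) (use conts in \<open>auto simp: continuous_on_eq_continuous_at\<close>)
  then obtain F where F: "\<And>x. (F has_real_derivative s x) (at x)"
    by (auto simp: has_real_derivative_iff_has_vector_derivative)
  define G where "G t = F t - F 0" for t
  have G: "(G has_real_derivative s x) (at x)" for x
    unfolding G_def by (auto intro!: derivative_eq_intros F)
  have tang: "G x + s x * (y - x) \<le> G y" for x y
    by (rule mono_deriv_imp_above_tangent[OF G smono])
  have G0: "G t = 0" if "t \<le> 0" for t
    using tang[of t 0] tang[of 0 t] s0[of 0] s0[OF that] by (simp add: G_def)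
  have G1: "G t = t + (G 1 - 1)" if "t \<ge> 1" for t
    using tang[of t 1] tang[of 1 t] s1[of 1] s1[OF that] by simp
  \<comment> \<open>Right of 1 the graph of \<open>G\<close> is parallel to the diagonal and lies
    \<open>c\<close> below it. As \<open>c\<close> is between 0 and 1, shifting the argument by
    \<open>c\<close> keeps the ramp zero left of -1.\<close>
  define c where "c = 1 - G 1"
  have c01: "0 \<le> c" "c \<le> 1"
    using tang[of 1 0] tang[of 0 1] s1[of 1] s0[of 0] G0[of 0] by (auto simp: c_def)
  define ramp where "ramp t = G (t + c)" for t
  have pp: "pgrow k UNIV S (\<lambda>_. p)" for S :: "'i set"
    unfolding p_def by (rule pgrow_pos_part_power) simp
  have lin: "pgrow k UNIV S (\<lambda>_ t. t + c)" for S :: "'i set"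
    by (intro pgrow_add pgrow_linear[where l = "\<lambda>t. t"] pgrow_const[where B = "\<bar>c\<bar>"]) auto
  have lin1: "pgrow k UNIV S (\<lambda>_ t. 1 - (t + c))" for S :: "'i set"
    by (intro pgrow_diff lin pgrow_const[where B = 1]) auto
  have ps: "pgrow k UNIV S (\<lambda>_ t. s (t + c))" for S :: "'i set"
    unfolding s_def divide_inverse
  proof (rule pgrow_mult[OF pgrow_compose[OF lin pp] pgrow_compose[OF _ pgrow_inverse[OF c0]]])
    show "pgrow k UNIV S (\<lambda>_ x. d (x + c))"
      unfolding d_def by (intro pgrow_add pgrow_compose[OF lin pp] pgrow_compose[OF lin1 pp]) auto
  qed (use d in auto)
  have tangramp: "ramp x + s (x + c) * (y - x) \<le> ramp y" for x y
    using tang[of "x + c" "y + c"] by (simp add: ramp_def)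
  have neg: "ramp t = 0" if "t \<le> -1" for t using that c01 by (simp add: ramp_def G0)
  have bd: "\<bar>ramp t\<bar> \<le> 1 * (1 + \<bar>t\<bar>)" for t
  proof -
    have "s (-1 + c) * (t + 1) \<le> ramp t" using tangramp[of "-1" t] neg[of "-1"] by simp
    hence "0 \<le> ramp t" using neg[of t] s01(1)[of "-1 + c"] by (cases "t \<le> -1") (auto intro: order_trans[rotated])
    moreover have "ramp t \<le> s (t + c) * (t + 1)" using tangramp[of t "-1"] neg[of "-1"] by (simp add: algebra_simps)
    moreover have "s (t + c) * (t + 1) \<le> s (t + c) * (1 + \<bar>t\<bar>)" using s01 by (intro mult_left_mono) auto
    moreover have "s (t + c) * (1 + \<bar>t\<bar>) \<le> 1 * (1 + \<bar>t\<bar>)" using s01 by (intro mult_right_mono) auto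
    ultimately show ?thesis by linarith
  qed
  have der: "(ramp has_real_derivative s (t + c)) (at t)" for t
    unfolding ramp_def using G[of "t + c"] by (simp add: DERIV_shift)
  show ?thesis
  proof (rule that[of ramp])
    show "pgrow k UNIV (S :: 'i set) (\<lambda>_. ramp)" for S
      by (rule pgrow_lower[OF pgrow_antiderivative[OF ps der, where A = 1]]) (use bd in auto)
    show "continuous_on UNIV ramp"
      using der by (meson DERIV_isCont continuous_at_imp_continuous_on)
    show "ramp t = 0" if "t \<le> -1" for t by (rule neg[OF that])
    show "ramp t = t" if "t \<ge> 1" for t
      using G1[of "t + c"] that c01 by (simp add: ramp_def c_def)
    show "\<exists>m. 0 \<le> m \<and> m \<le> 1 \<and> (\<forall>y. ramp x + m * (y - x) \<le> ramp y)" for x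
      using s01 tangramp by blast
  qed
qed

subsection \<open>The building block adapted to a cusp\<close>

definition cgrow :: "nat \<Rightarrow> 'a::real_normed_vector set \<Rightarrow> 'i set \<Rightarrow> ('a \<Rightarrow> complex) \<Rightarrow> bool" where
  "cgrow k U S f \<longleftrightarrow> pgrow k U S (\<lambda>_ x. Re (f x)) \<and> pgrow k U S (\<lambda>_ x. Im (f x))"

lemma cgrow_coord:
  assumes "open U"
  shows "cgrow k U S (\<lambda>x :: complex ^ 'n. x $ i)"
  unfolding cgrow_def using assms
  by (intro conjI pgrow_linear bounded_linear_compose[OF bounded_linear_Re]
        bounded_linear_compose[OF bounded_linear_Im] bounded_linear_vec_nth)

lemma cgrow_mult: "cgrow k U S f \<Longrightarrow> cgrow k U S g \<Longrightarrow> cgrow k U S (\<lambda>x. f x * g x)"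
  unfolding cgrow_def times_complex.sel
  by (elim conjE, intro conjI pgrow_add pgrow_diff pgrow_mult)

lemma cgrow_diff: "cgrow k U S f \<Longrightarrow> cgrow k U S g \<Longrightarrow> cgrow k U S (\<lambda>x. f x - g x)"
  unfolding cgrow_def minus_complex.sel by (elim conjE, intro conjI pgrow_diff)

lemma cgrow_cnj: "cgrow k U S f \<Longrightarrow> cgrow k U S (\<lambda>x. cnj (f x))"
  unfolding cgrow_def complex_cnj by (auto intro: pgrow_uminus)

lemma cgrow_norm_square: "cgrow k U S f \<Longrightarrow> pgrow k U S (\<lambda>_ x. (cmod (f x))\<^sup>2)"
  unfolding cgrow_def cmod_power2 by (elim conjE, intro pgrow_add pgrow_power)

section \<open>The cusp equation, the barrier and the weight\<close>

definition cusp :: "complex ^ 3 \<Rightarrow> complex" where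
  "cusp x = (x $ 2) ^ 3 - (x $ 3)\<^sup>2"

text \<open>The factor \<open>1 + (cmod (x $ 2))\<^sup>2\<close> lets it outgrow
  \<open>weight\<close>, which is at most linear in \<open>cmod (x $ 2)\<close>, wherever
  \<open>cusp x\<close> is bounded away from 0; with 14 it is at least
  \<open>5 + 7 * (cmod (x $ 2))\<^sup>2\<close> once \<open>(cmod (cusp x))\<^sup>2 > 1/2\<close>.
  The value -2 on the cusp is 1 below everything that is at least -1, the gap at which
  \<open>ramp\<close> is the identity.\<close>

definition barrier :: "complex ^ 3 \<Rightarrow> real" where
  "barrier x = 14 * ((cmod (cusp x))\<^sup>2 * (1 + (cmod (x $ 2))\<^sup>2)) - 2"

text \<open>On the cusp, parametrised by \<open>\<xi> \<mapsto> (\<xi>\<^sup>2, \<xi>\<^sup>3)\<close>, this is \<open>8 ln (|\<xi>|\<^sup>2 / 4) - Re \<xi>\<close>.\<close>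
definition weight :: "complex ^ 3 \<Rightarrow> real" where
  "weight x = 8 * ln (cmod (x $ 2) / 4) - Re (x $ 3 / x $ 2)"

lemma continuous_on_cusp: "continuous_on S cusp"
  unfolding cusp_def by (intro continuous_intros)

lemma cgrow_cusp: "open U \<Longrightarrow> cgrow k U S cusp"
  unfolding cusp_def power3_eq_cube power2_eq_square
  by (intro cgrow_diff cgrow_mult cgrow_coord)

lemma pgrow_barrier: "open U \<Longrightarrow> pgrow k U S (\<lambda>_. barrier)"
  unfolding barrier_def
  by (intro pgrow_diff pgrow_add pgrow_mult cgrow_norm_square cgrow_cusp cgrow_coord pgrow_const[where B = 14]) auto

lemma pgrow_weight: "pgrow k {x. cmod (x $ 2) > 1} S (\<lambda>_. weight)"
proof (rule pgrow_cong)
  let ?U = "{x :: complex ^ 3. cmod (x $ 2) > 1}"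
  have U: "open ?U" by (intro open_Collect_less continuous_intros)
  have n2: "pgrow k ?U S (\<lambda>_ x. (cmod (x $ 2))\<^sup>2)" by (intro cgrow_norm_square cgrow_coord U)
  have m: "1 < (cmod (x $ 2))\<^sup>2" if "x \<in> ?U" for x using that by (auto intro: one_less_power)
  have "cgrow k ?U S (\<lambda>x. x $ 3 * cnj (x $ 2))" by (intro cgrow_mult cgrow_cnj cgrow_coord U)
  hence re: "pgrow k ?U S (\<lambda>_ x. Re (x $ 3 * cnj (x $ 2)))" by (simp only: cgrow_def)
  show "pgrow k ?U S (\<lambda>_ x. 4 * ln ((cmod (x $ 2))\<^sup>2) - 8 * ln 4 - Re (x $ 3 * cnj (x $ 2)) * inverse ((cmod (x $ 2))\<^sup>2))"
    by (intro pgrow_diff pgrow_mult re pgrow_const[OF U, where B = 4] pgrow_const[OF U, where B = "8 * ln 4"]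
          pgrow_compose[OF n2 pgrow_ln[of 1]] pgrow_compose[OF n2 pgrow_inverse[of 1]])
       (use m in auto)
  fix x assume "x \<in> ?U"
  hence p: "cmod (x $ 2) > 0" by auto
  have "Re (x $ 3 / x $ 2) = Re (x $ 3 * cnj (x $ 2)) * inverse ((cmod (x $ 2))\<^sup>2)"
    by (subst complex_div_cnj) (simp only: Re_divide_of_real divide_inverse[of "Re _"])
  thus "4 * ln ((cmod (x $ 2))\<^sup>2) - 8 * ln 4 - Re (x $ 3 * cnj (x $ 2)) * inverse ((cmod (x $ 2))\<^sup>2) = weight x"
    using p by (simp add: weight_def ln_div ln_realpow)
qed

lemma psh_on_barrier: "psh_on U barrier"
proof (rule psh_on_subset[OF _ subset_UNIV])
  have hol: "(\<lambda>\<zeta>. cusp (H \<zeta>)) holomorphic_on ball 0 R" if "holo_map R H" for H R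
    using that unfolding cusp_def holo_map_def by (intro holomorphic_intros) auto
  have hol2: "(\<lambda>\<zeta>. cusp (H \<zeta>) * H \<zeta> $ 2) holomorphic_on ball 0 R" if "holo_map R H" for H R
    using hol[OF that] that unfolding holo_map_def by (intro holomorphic_intros) auto
  have "psh_on UNIV (\<lambda>x. 14 * ((cmod (cusp x))\<^sup>2 + (cmod (cusp x * x $ 2))\<^sup>2) + (-2))"
    by (intro psh_on_add psh_on_cmult psh_on_const psh_on_norm_square hol hol2 continuous_intros continuous_on_cusp) auto
  thus "psh_on UNIV barrier"
    by (rule psh_on_cong) (simp add: barrier_def norm_mult power_mult_distrib ring_distribs)
qed

lemma psh_on_weight: "psh_on {x. x $ 2 \<noteq> 0} weight"
proof -
  have "psh_on {x :: complex ^ 3. x $ 2 \<noteq> 0} (\<lambda>x. (8 * ln (cmod (x $ 2)) + (- 8 * ln 4)) + (- Re (x $ 3 / x $ 2)))"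
    by (intro psh_on_add psh_on_cmult psh_on_const psh_on_ln_norm psh_on_Re_quotient) auto
  thus ?thesis by (rule psh_on_cong) (simp add: weight_def ln_div)
qed

text \<open>Near the cusp the quotient still has the size of \<open>\<xi>\<close>, a square root of
  \<open>x $ 2\<close>; the second summand is the effect of
  \<open>cusp x \<noteq> 0\<close>.\<close>

lemma slope_bound:
  assumes "cmod (cusp x) < 1" "cmod (x $ 2) > 0"
  shows "(cmod (x $ 3 / x $ 2))\<^sup>2 \<le> cmod (x $ 2) + 1 / (cmod (x $ 2))\<^sup>2"
proof -
  have "(x $ 3)\<^sup>2 = (x $ 2) ^ 3 - cusp x" by (simp add: cusp_def)
  hence "(cmod (x $ 3))\<^sup>2 = cmod ((x $ 2) ^ 3 - cusp x)" by (simp add: norm_power[symmetric])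
  also have "\<dots> \<le> cmod (x $ 2) ^ 3 + 1"
    using norm_triangle_ineq4[of "(x $ 2) ^ 3" "cusp x"] assms(1) by (simp add: norm_power)
  finally have "(cmod (x $ 3))\<^sup>2 / (cmod (x $ 2))\<^sup>2 \<le> (cmod (x $ 2) ^ 3 + 1) / (cmod (x $ 2))\<^sup>2"
    by (rule divide_right_mono) simp
  also have "\<dots> = cmod (x $ 2) + 1 / (cmod (x $ 2))\<^sup>2"
    using assms(2) by (simp add: add_divide_distrib power3_eq_cube power2_eq_square)
  finally show ?thesis by (simp add: norm_divide power_divide)
qed

lemma weight_upper:
  assumes "cmod (cusp x) < 1" "cmod (x $ 2) > 1"
  shows "weight x \<le> 3 * cmod (x $ 2) + 1"
proof -
  let ?y = "cmod (x $ 2)" and ?q = "x $ 3 / x $ 2"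
  have "1 / ?y\<^sup>2 \<le> 1" using assms(2) by (simp add: divide_le_eq one_le_power)
  hence "(cmod ?q)\<^sup>2 \<le> ?y + 1" using slope_bound[OF assms(1)] assms(2) by force
  also have "\<dots> \<le> (?y + 1)\<^sup>2" using assms(2) by (simp add: power2_eq_square algebra_simps)
  finally have "cmod ?q \<le> ?y + 1" by (rule power2_le_imp_le) simp
  hence "- Re ?q \<le> ?y + 1" using abs_Re_le_cmod[of ?q] by linarith
  moreover have "ln (?y / 4) \<le> ?y / 4" using assms(2) by (intro ln_bound) auto
  ultimately show ?thesis unfolding weight_def by linarith
qed

text \<open>Here and in \<open>weight_outer\<close> the constants of \<open>weight\<close> find
  their reason: \<open>8 * ln 2 \<ge> 16/3\<close> beats the quotient, whose modulus is at most 2 on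
  the inner and at most 4 on the outer annulus, with at least 1 to spare, and the divisor 4 puts the
  sign change of the logarithm between the annuli.\<close>

lemma weight_inner:
  assumes "cmod (cusp x) < 1" "3/2 < cmod (x $ 2)" "cmod (x $ 2) < 2"
  shows "weight x \<le> -1"
proof -
  let ?y = "cmod (x $ 2)" and ?q = "x $ 3 / x $ 2"
  have "1 / ?y\<^sup>2 \<le> 1" using assms(2) by (simp add: divide_le_eq one_le_power)
  hence "(cmod ?q)\<^sup>2 \<le> 2\<^sup>2" using slope_bound[OF assms(1)] assms(2,3) by simp force
  hence "cmod ?q \<le> 2" by (rule power2_le_imp_le) simp
  hence "- Re ?q \<le> 2" using abs_Re_le_cmod[of ?q] by linarith
  moreover have "ln (?y / 4) \<le> ln (1 / 2)" using assms by (intro ln_mono) auto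
  moreover have "ln (1 / 2 :: real) \<le> - (2 / 3)" using ln2_ge_two_thirds by (simp add: ln_div)
  ultimately show ?thesis unfolding weight_def by linarith
qed

lemma weight_outer:
  assumes "cmod (cusp x) < 1" "8 < cmod (x $ 2)" "cmod (x $ 2) < 9"
  shows "weight x \<ge> 1"
proof -
  let ?y = "cmod (x $ 2)" and ?q = "x $ 3 / x $ 2"
  have "1 / ?y\<^sup>2 \<le> 1" using assms(2) by (simp add: divide_le_eq one_le_power)
  hence "(cmod ?q)\<^sup>2 \<le> 4\<^sup>2" using slope_bound[OF assms(1)] assms(2,3) by simp force
  hence "cmod ?q \<le> 4" by (rule power2_le_imp_le) simp
  hence "Re ?q \<le> 4" using abs_Re_le_cmod[of ?q] by linarith
  moreover have "ln (?y / 4) \<ge> ln 2" using assms by (intro ln_mono) auto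
  moreover have "ln (2 :: real) \<ge> 2 / 3" using ln2_ge_two_thirds by simp
  ultimately show ?thesis unfolding weight_def by linarith
qed

section \<open>Gluing by regularised maxima\<close>

locale smooth_ramp =
  fixes k :: nat and ramp :: "real \<Rightarrow> real"
  assumes grow: "pgrow k UNIV {0..1::real} (\<lambda>_. ramp)"
    and cont: "continuous_on UNIV ramp"
    and neg: "\<And>t. t \<le> -1 \<Longrightarrow> ramp t = 0"
    and pos: "\<And>t. t \<ge> 1 \<Longrightarrow> ramp t = t"
    and tangent: "\<And>x. \<exists>m. 0 \<le> m \<and> m \<le> 1 \<and> (\<forall>y. ramp x + m * (y - x) \<le> ramp y)"
begin

lemma ramp_nonneg: "0 \<le> ramp t"
proof (cases "t \<le> -1")
  case False
  obtain m where "0 \<le> m" "ramp (-1) + m * (t - (-1)) \<le> ramp t" using tangent[of "-1"] by blast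
  moreover have "0 \<le> m * (t + 1)" using False \<open>0 \<le> m\<close> by (intro mult_nonneg_nonneg) auto
  ultimately show ?thesis using neg[of "-1"] by simp
qed (simp add: neg)

lemma ramp_upper: "ramp t \<le> max 0 (t + 1)"
proof -
  obtain m where m: "0 \<le> m" "m \<le> 1" "ramp t + m * ((-1) - t) \<le> ramp (-1)" using tangent[of t] by blast
  hence "ramp t \<le> m * (t + 1)" using neg[of "-1"] by (simp add: algebra_simps)
  also have "m * (t + 1) \<le> m * max 0 (t + 1)" using m by (intro mult_left_mono) auto
  also have "\<dots> \<le> 1 * max 0 (t + 1)" using m by (intro mult_right_mono) auto
  finally show ?thesis by simp
qed

lemma pgrow_ramp: "pgrow k U {0..1::real} F \<Longrightarrow> pgrow k U {0..1} (\<lambda>s x. ramp (F s x))"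
  by (rule pgrow_compose[OF _ grow]) auto

text \<open>A support line of slope \<open>m\<close> bounds the regularised maximum from below by
  \<open>m * f + (1 - m) * g\<close> plus a constant, and both coefficients are nonnegative because
  \<open>m\<close> lies between 0 and 1.\<close>

lemma psh_on_ramp_max:
  assumes "psh_on U f" "psh_on U g"
  shows "psh_on U (\<lambda>x. g x + ramp (f x - g x))"
proof (rule psh_on_supported[OF assms])
  show "continuous_on U (\<lambda>x. g x + ramp (f x - g x))"
    by (intro continuous_intros continuous_on_compose2[OF cont] assms[THEN psh_on_continuous]) auto
  fix x assume "x \<in> U"
  obtain m where m: "0 \<le> m" "m \<le> 1" "\<And>t. ramp (f x - g x) + m * (t - (f x - g x)) \<le> ramp t"
    using tangent[of "f x - g x"] by blast
  show "\<exists>\<alpha>\<ge>0. \<exists>\<beta>\<ge>0. \<forall>y\<in>U. g x + ramp (f x - g x) + \<alpha> * (f y - f x) + \<beta> * (g y - g x) \<le> g y + ramp (f y - g y)"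
  proof (rule exI[of _ m], rule conjI[OF m(1)], rule exI[of _ "1 - m"], intro conjI ballI)
    fix y
    from m(3)[of "f y - g y"]
    show "g x + ramp (f x - g x) + m * (f y - f x) + (1 - m) * (g y - g x) \<le> g y + ramp (f y - g y)"
      by (simp add: algebra_simps)
  qed (use m in auto)
qed

lemma psh_on_ramp: "psh_on U f \<Longrightarrow> psh_on U (\<lambda>x. ramp (f x))"
  using psh_on_ramp_max[OF _ psh_on_const, of U f 0] by simp

text \<open>Near the cusp, the regularised maximum of \<open>barrier\<close> with, from inside out,
  0, \<open>s\<close> times the regularised maximum of 0 and \<open>weight\<close>, and
  \<open>s * weight\<close>. The factor \<open>s\<close> is there because \<open>- Re \<xi>\<close>
  eventually drops below the value -2 of \<open>barrier\<close> on the cusp. For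
  \<open>s = r\<close> the weight prevails up to \<open>cmod \<xi> = 1 / r\<close>, which is 1
  before rescaling.\<close>

definition Phi :: "real \<Rightarrow> complex ^ 3 \<Rightarrow> real" where
  "Phi s x = (if cmod (cusp x) \<ge> 1 then barrier x
     else if cmod (x $ 2) < 2 then barrier x + ramp (- barrier x)
     else if cmod (x $ 2) < 9 then barrier x + ramp (s * ramp (weight x) - barrier x)
     else barrier x + ramp (s * weight x - barrier x))"

text \<open>Every competitor of \<open>barrier\<close> stays at least 1 below it here, where
  \<open>ramp\<close> vanishes.\<close>

lemma Phi_far:
  assumes s: "s \<in> {0..1}" and F: "(cmod (cusp x))\<^sup>2 > 1/2"
  shows "Phi s x = barrier x"
proof (cases "cmod (cusp x) \<ge> 1")
  case False
  let ?y = "cmod (x $ 2)"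
  have "1/2 * (1 + ?y\<^sup>2) \<le> (cmod (cusp x))\<^sup>2 * (1 + ?y\<^sup>2)" using F by (intro mult_right_mono) auto
  hence b: "5 + 7 * ?y\<^sup>2 \<le> barrier x" unfolding barrier_def by (simp add: algebra_simps)
  have "0 \<le> (?y - 1)\<^sup>2" by simp
  hence "2 * ?y \<le> 1 + ?y\<^sup>2" by (simp add: power2_eq_square algebra_simps)
  hence b': "3 * ?y + 3 \<le> barrier x" using b zero_le_power2[of ?y] by linarith
  have b5: "5 \<le> barrier x" using b zero_le_power2[of ?y] by linarith
  have u: "s * u \<le> 3 * ?y + 2" if "u \<le> 3 * ?y + 2" for u
  proof -
    have "s * u \<le> s * (3 * ?y + 2)" using that s by (intro mult_left_mono) auto
    also have "\<dots> \<le> 1 * (3 * ?y + 2)" using s by (intro mult_right_mono) auto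
    finally show ?thesis by simp
  qed
  have w: "weight x \<le> 3 * ?y + 1" if "?y \<ge> 2" using weight_upper[of x] False that by auto
  have "ramp (weight x) \<le> 3 * ?y + 2" if "?y \<ge> 2" using ramp_upper[of "weight x"] w[OF that] that by (smt (verit))
  hence "ramp (- barrier x) = 0" "?y \<ge> 2 \<Longrightarrow> ramp (s * ramp (weight x) - barrier x) = 0"
    "?y \<ge> 2 \<Longrightarrow> ramp (s * weight x - barrier x) = 0"
    using u[of "ramp (weight x)"] u[of "weight x"] w b5 b' by (auto intro!: neg)
  thus ?thesis unfolding Phi_def by auto
qed (simp add: Phi_def)

text \<open>\<open>ramp (weight x)\<close> vanishes where \<open>cmod (x $ 2)\<close> is between 3/2
  and 2, so the middle formula continues into the inner zone; \<open>Phi_outer\<close> continues the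
  outer formula inwards in the same way. The zones thus become overlapping open sets.\<close>

lemma Phi_middle:
  assumes "cmod (cusp x) < 1" "3/2 < cmod (x $ 2)" "cmod (x $ 2) < 9"
  shows "Phi s x = barrier x + ramp (s * ramp (weight x) - barrier x)"
  using assms weight_inner[OF assms(1,2)] by (auto simp: Phi_def neg)

lemma Phi_outer:
  assumes "cmod (cusp x) < 1" "8 < cmod (x $ 2)"
  shows "Phi s x = barrier x + ramp (s * weight x - barrier x)"
  using assms weight_outer[OF assms] by (auto simp: Phi_def pos)

lemma open_regions:
  "open {x. (cmod (cusp x))\<^sup>2 > 1/2}"
  "open {x. cmod (cusp x) < 1 \<and> cmod (x $ 2) < 2}"
  "open {x. cmod (cusp x) < 1 \<and> 3/2 < cmod (x $ 2) \<and> cmod (x $ 2) < 9}"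
  "open {x. cmod (cusp x) < 1 \<and> 8 < cmod (x $ 2)}"
  by (intro open_Collect_conj open_Collect_less continuous_intros continuous_on_cusp)+

lemma regions_cover:
  "{x. (cmod (cusp x))\<^sup>2 > 1/2} \<union> ({x. cmod (cusp x) < 1 \<and> cmod (x $ 2) < 2}
    \<union> ({x. cmod (cusp x) < 1 \<and> 3/2 < cmod (x $ 2) \<and> cmod (x $ 2) < 9}
    \<union> {x. cmod (cusp x) < 1 \<and> 8 < cmod (x $ 2)})) = UNIV"
proof -
  have "(cmod (cusp x))\<^sup>2 > 1/2" if "\<not> cmod (cusp x) < 1" for x
  proof -
    have "1 \<le> (cmod (cusp x))\<^sup>2" using that by (intro one_le_power) auto
    thus ?thesis by linarith
  qed
  thus ?thesis by fastforce
qed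

lemma pgrow_Phi: "pgrow k UNIV {0..1} Phi"
  unfolding regions_cover[symmetric]
proof (intro pgrow_Un)
  note o = open_regions
  have id: "open U \<Longrightarrow> pgrow k U {0..1::real} (\<lambda>s _. s)" for U :: "(complex ^ 3) set"
    by (rule pgrow_const[where B = 1]) auto
  note w = pgrow_subset[OF pgrow_weight]
  show "pgrow k {x. (cmod (cusp x))\<^sup>2 > 1/2} {0..1} Phi"
    by (rule pgrow_cong[OF pgrow_barrier[OF o(1)]]) (simp add: Phi_far)
  show "pgrow k {x. cmod (cusp x) < 1 \<and> cmod (x $ 2) < 2} {0..1} Phi"
    by (rule pgrow_cong[OF pgrow_add[OF pgrow_barrier pgrow_ramp[OF pgrow_uminus[OF pgrow_barrier]]]])
       (use o in \<open>auto simp: Phi_def\<close>)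
  show "pgrow k {x. cmod (cusp x) < 1 \<and> 3/2 < cmod (x $ 2) \<and> cmod (x $ 2) < 9} {0..1} Phi"
    by (rule pgrow_cong[OF pgrow_add[OF pgrow_barrier
          pgrow_ramp[OF pgrow_diff[OF pgrow_mult[OF id pgrow_ramp[OF w]] pgrow_barrier]]]])
       (use o in \<open>auto simp: Phi_middle\<close>)
  show "pgrow k {x. cmod (cusp x) < 1 \<and> 8 < cmod (x $ 2)} {0..1} Phi"
    by (rule pgrow_cong[OF pgrow_add[OF pgrow_barrier
          pgrow_ramp[OF pgrow_diff[OF pgrow_mult[OF id w] pgrow_barrier]]]])
       (use o in \<open>auto simp: Phi_outer\<close>)
qed

lemma psh_on_Phi:
  assumes s: "s \<in> {0..1}"
  shows "psh_on UNIV (Phi s)"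
proof (rule psh_on_locally)
  fix x :: "complex ^ 3"
  note o = open_regions
  have s0: "s \<ge> 0" using s by simp
  note w = psh_on_subset[OF psh_on_weight]
  have 1: "psh_on {x. (cmod (cusp x))\<^sup>2 > 1/2} (Phi s)"
    by (rule psh_on_cong[OF psh_on_barrier]) (use s in \<open>simp add: Phi_far\<close>)
  have 2: "psh_on {x. cmod (cusp x) < 1 \<and> cmod (x $ 2) < 2} (Phi s)"
    by (rule psh_on_cong[OF psh_on_ramp_max[OF psh_on_const[of _ 0] psh_on_barrier]]) (auto simp: Phi_def)
  have 3: "psh_on {x. cmod (cusp x) < 1 \<and> 3/2 < cmod (x $ 2) \<and> cmod (x $ 2) < 9} (Phi s)"
    by (rule psh_on_cong[OF psh_on_ramp_max[OF psh_on_cmult[OF psh_on_ramp[OF w] s0] psh_on_barrier]])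
       (auto simp: Phi_middle)
  have 4: "psh_on {x. cmod (cusp x) < 1 \<and> 8 < cmod (x $ 2)} (Phi s)"
    by (rule psh_on_cong[OF psh_on_ramp_max[OF psh_on_cmult[OF w s0] psh_on_barrier]])
       (auto simp: Phi_outer)
  have "x \<in> {x. (cmod (cusp x))\<^sup>2 > 1/2} \<or> x \<in> {x. cmod (cusp x) < 1 \<and> cmod (x $ 2) < 2}
    \<or> x \<in> {x. cmod (cusp x) < 1 \<and> 3/2 < cmod (x $ 2) \<and> cmod (x $ 2) < 9}
    \<or> x \<in> {x. cmod (cusp x) < 1 \<and> 8 < cmod (x $ 2)}"
    using UNIV_I[of x] unfolding regions_cover[symmetric] Un_iff .
  thus "\<exists>V. open V \<and> x \<in> V \<and> psh_on V (Phi s)"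
    by - (elim disjE; intro exI conjI; (rule o 1 2 3 4 | assumption))
qed

lemma Phi_lower: "-2 \<le> Phi s x"
proof -
  have "-2 \<le> barrier x" by (simp add: barrier_def)
  moreover have "barrier x \<le> Phi s x" using ramp_nonneg by (simp add: Phi_def)
  ultimately show ?thesis by linarith
qed

lemma Phi_cusp_zero:
  assumes "x $ 2 = \<xi>\<^sup>2" "x $ 3 = \<xi> ^ 3" "(cmod \<xi>)\<^sup>2 < 2"
  shows "Phi s x = 0"
proof -
  have "cusp x = 0" using assms by (simp add: cusp_def power_mult[symmetric])
  thus ?thesis using assms pos[of 2] by (simp add: Phi_def barrier_def norm_power)
qed

text \<open>Beyond \<open>(cmod \<xi>)\<^sup>2 = 9\<close> the logarithm is nonnegative, so
  \<open>weight x \<ge> - T\<close> and \<open>weight x / T\<close> is at least 1 above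
  \<open>barrier x\<close>: the ramp acts as the identity and the value is exact. Closer in, 17
  absorbs the excess of 1 caused by \<open>ramp\<close> and the size of \<open>Re \<xi>\<close>,
  which is below 3.\<close>

lemma Phi_cusp_upper:
  assumes x: "x $ 2 = \<xi>\<^sup>2" "x $ 3 = \<xi> ^ 3" and T: "1 \<le> T" "cmod \<xi> \<le> T"
  shows "T * Phi (1 / T) x \<le> 17 + 8 * ln (1 + (cmod \<xi>)\<^sup>2) - Re \<xi>"
proof -
  have F: "cusp x = 0" using x by (simp add: cusp_def power_mult[symmetric])
  hence b: "barrier x = -2" by (simp add: barrier_def)
  have y: "cmod (x $ 2) = (cmod \<xi>)\<^sup>2" using x by (simp add: norm_power)
  have l: "ln (1 + (cmod \<xi>)\<^sup>2) \<ge> 0" by (intro ln_ge_zero) simp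
  have re: "\<bar>Re \<xi>\<bar> \<le> cmod \<xi>" by (rule abs_Re_le_cmod)
  have w: "weight x = 8 * ln ((cmod \<xi>)\<^sup>2 / 4) - Re \<xi>" if "\<xi> \<noteq> 0"
    using x that by (simp add: weight_def norm_power norm_mult power3_eq_cube power2_eq_square)
  have lm: "ln ((cmod \<xi>)\<^sup>2 / 4) \<le> ln (1 + (cmod \<xi>)\<^sup>2)" if "\<xi> \<noteq> 0"
    using that by (intro ln_mono) (auto intro: add_pos_nonneg)
  show ?thesis
  proof (cases "(cmod \<xi>)\<^sup>2 < 9")
    case True
    hence "cmod \<xi> < 3" using power2_less_imp_less[of "cmod \<xi>" 3] by simp
    show ?thesis
    proof (cases "(cmod \<xi>)\<^sup>2 < 2")
      case True
      hence "T * Phi (1 / T) x = 0" by (simp add: Phi_cusp_zero[OF x])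
      thus ?thesis using l re \<open>cmod \<xi> < 3\<close> by linarith
    next
      case False
      hence n0: "\<xi> \<noteq> 0" by auto
      have "1 / T * ramp (weight x) \<ge> 0" using T ramp_nonneg by simp
      hence "Phi (1 / T) x = 1 / T * ramp (weight x)"
        using False True F b y pos[of "1 / T * ramp (weight x) + 2"] by (simp add: Phi_def)
      hence "T * Phi (1 / T) x = ramp (weight x)" using T by simp
      also have "\<dots> \<le> max 0 (weight x + 1)" by (rule ramp_upper)
      also have "\<dots> \<le> 17 + 8 * ln (1 + (cmod \<xi>)\<^sup>2) - Re \<xi>"
        using w[OF n0] lm[OF n0] l re \<open>cmod \<xi> < 3\<close> by (intro max.boundedI) linarith+
      finally show ?thesis .
    qed
  next
    case False
    hence n0: "\<xi> \<noteq> 0" by auto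
    have "ln ((cmod \<xi>)\<^sup>2 / 4) \<ge> 0" using False by (intro ln_ge_zero) simp
    hence "weight x \<ge> - T" using w[OF n0] re T by linarith
    hence "1 / T * weight x \<ge> 1 / T * (- T)" using T by (intro mult_left_mono) auto
    hence "1 / T * weight x \<ge> -1" using T by simp
    hence "Phi (1 / T) x = 1 / T * weight x"
      using False F b y pos[of "1 / T * weight x + 2"] by (simp add: Phi_def)
    hence "T * Phi (1 / T) x = weight x" using T by simp
    thus ?thesis using w[OF n0] lm[OF n0] l by simp
  qed
qed

end

subsection \<open>Superposition over all scales\<close>

text \<open>\<open>C\<close> and \<open>m\<close> are parameters because the exponent
  \<open>K\<close> and the scales depend on the growth of \<open>Phi\<close>, which is determined by
  \<open>ramp\<close>. Here \<open>k\<close> is one more than the smoothness class obtained in the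
  end.\<close>

locale cusp_series = smooth_ramp k ramp for k ramp +
  fixes C :: real and m :: nat
  assumes k1: "k \<ge> 1" and C1: "C \<ge> 1"
    and Phi_bound: "\<And>s. s \<in> {0..1} \<Longrightarrow> Cbd k UNIV (\<lambda>x. C * (1 + norm x) ^ m) (Phi s)"
begin

text \<open>\<open>K\<close> is large enough for the factor \<open>r ^ (K - 1)\<close> of \<open>piece r\<close> to absorb both the powers of \<open>1 / r ^ 3\<close>
  coming from \<open>k\<close> derivatives and those from the polynomial growth of degree \<open>m\<close>, leaving \<open>r ^ a\<close>;
  it equals \<open>2 a\<close> because the next summand, of size \<open>(r ^ 4) ^ a\<close>, still has to be below \<open>r ^ K\<close>.\<close>
definition a :: nat where "a = 1 + 3 * (k + m)"
definition K :: nat where "K = 2 * a"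
definition B :: real where "B = C * 4 ^ m"
text \<open>\<open>B\<close> is the growth bound at radius 3. The term \<open>32 * B\<close> makes
  \<open>series\<close> at most 1/16 in that ball, and the whole denominator gives
  \<open>q * (79 + 2 * B) < 1\<close>, by which the discs fit into the domain.\<close>

definition q :: real where "q = 1 / (100 + 32 * B)"
definition rad :: "nat \<Rightarrow> real" where "rad \<nu> = q ^ (4 ^ \<nu>)"

text \<open>The weighted dilation that preserves the cusp and sends \<open>\<xi>\<close> to
  \<open>\<xi> / r\<close>.\<close>

definition scale :: "real \<Rightarrow> complex ^ 3 \<Rightarrow> complex ^ 3" where
  "scale r x = (\<chi> i. (if i = 1 then 1 else if i = 2 then of_real (1 / r ^ 2) else of_real (1 / r ^ 3)) * x $ i)"

text \<open>The exponent is \<open>K - 1\<close> because \<open>Phi r\<close> carries the weight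
  with the factor \<open>r\<close>: on the cusp it is \<open>Phi r\<close> divided by
  \<open>r\<close> that behaves like \<open>weight\<close>.\<close>

definition piece :: "real \<Rightarrow> complex ^ 3 \<Rightarrow> real" where
  "piece r x = r ^ (K - 1) * Phi r (scale r x)"

definition series :: "complex ^ 3 \<Rightarrow> real" where
  "series x = (\<Sum>\<nu>. piece (rad \<nu>) x)"

lemma a_pos: "a \<ge> 1" by (simp add: a_def)
lemma K_ge: "K \<ge> 2" using a_pos by (simp add: K_def)

lemma B_ge: "B \<ge> 1"
proof -
  have "1 * 1 \<le> C * 4 ^ m" using C1 by (intro mult_mono one_le_power) auto
  thus ?thesis by (simp add: B_def)
qed

lemma q_pos: "0 < q" using B_ge by (simp add: q_def)
lemma q_small: "q \<le> 1/100" using B_ge unfolding q_def by (intro divide_left_mono) auto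
lemma q_B: "B * q \<le> 1/32" using B_ge by (simp add: q_def field_simps)

lemma rad_pos: "0 < rad \<nu>" using q_pos by (simp add: rad_def)

lemma four_power_ge: "(4::nat) ^ (\<nu> + j) \<ge> 4 ^ \<nu> + j"
proof (induction j)
  case (Suc j)
  have "(4::nat) ^ (\<nu> + Suc j) = 4 * 4 ^ (\<nu> + j)" by simp
  moreover have "(4::nat) ^ (\<nu> + j) \<ge> 1" by simp
  ultimately show ?case using Suc by linarith
qed simp

text \<open>The fourth powers matter between neighbouring scales; for convergence of sums this
  geometric decay is enough.\<close>

lemma rad_add: "rad (\<nu> + j) \<le> rad \<nu> * q ^ j"
proof -
  have "rad (\<nu> + j) \<le> q ^ (4 ^ \<nu> + j)"
    unfolding rad_def using q_pos q_small by (intro power_decreasing four_power_ge) auto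
  thus ?thesis by (simp add: power_add rad_def)
qed

lemma rad_le: "rad \<nu> \<le> q ^ Suc \<nu>"
  using rad_add[of 0 \<nu>] by (simp add: rad_def)

lemma rad_le_q: "rad \<nu> \<le> q"
proof -
  have "q ^ Suc \<nu> \<le> q ^ 1" using q_pos q_small by (intro power_decreasing) auto
  thus ?thesis using rad_le[of \<nu>] by simp
qed

lemma rad_le_1: "rad \<nu> \<le> 1" using rad_le_q[of \<nu>] q_small by linarith

lemma rad_Suc: "rad (Suc \<nu>) = rad \<nu> ^ 4"
  by (simp add: rad_def power_mult[symmetric] mult.commute)

lemma rad_Suc_less: "rad (Suc \<nu>) < rad \<nu>"
proof -
  have "rad \<nu> ^ 4 < rad \<nu> ^ 1"
    using rad_pos[of \<nu>] rad_le_q[of \<nu>] q_small by (intro power_strict_decreasing) auto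
  thus ?thesis by (simp add: rad_Suc)
qed

lemma rad_mono: "\<mu> \<le> \<nu> \<Longrightarrow> rad \<nu> \<le> rad \<mu>"
  by (rule lift_Suc_antimono_le[of rad]) (use rad_Suc_less in \<open>auto intro: less_imp_le\<close>)

lemma scale_norm:
  assumes "0 < r" "r \<le> 1"
  shows "norm (scale r x) \<le> 1 / r ^ 3 * norm x"
proof -
  have "r ^ 3 \<le> 1" "r ^ 3 \<le> r ^ 2" "0 < r ^ 3"
    using assms by (auto intro: power_le_one power_decreasing)
  hence *: "1 \<le> 1 / r ^ 3" "1 / r ^ 2 \<le> 1 / r ^ 3"
    using assms by (auto simp: le_divide_eq intro: divide_left_mono)
  have "norm (scale r x) \<le> norm ((1 / r ^ 3) *\<^sub>R x)"
  proof (rule norm_le_componentwise_cart)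
    fix i :: 3
    have "norm (if i = 1 then 1 else if i = 2 then of_real (1 / r ^ 2) else of_real (1 / r ^ 3) :: complex) \<le> 1 / r ^ 3"
      using * assms by (auto simp: norm_divide norm_power)
    hence "norm (scale r x $ i) \<le> 1 / r ^ 3 * norm (x $ i)"
      unfolding scale_def by (simp only: vec_lambda_beta norm_mult) (rule mult_right_mono, auto)
    thus "norm (scale r x $ i) \<le> norm (((1 / r ^ 3) *\<^sub>R x) $ i)" using assms by simp
  qed
  thus ?thesis using assms by simp
qed

lemma scale_linear:
  assumes "0 < r" "r \<le> 1"
  shows "bounded_linear (scale r)"
proof (rule bounded_linear_intro)
  show "scale r (x + y) = scale r x + scale r y" for x y
    by (simp add: scale_def vec_eq_iff ring_distribs)
  show "scale r (t *\<^sub>R x) = t *\<^sub>R scale r x" for t x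
    by (simp add: scale_def vec_eq_iff)
  show "norm (scale r x) \<le> norm x * (1 / r ^ 3)" for x
    using scale_norm[OF assms, of x] by (simp add: mult.commute)
qed

lemma piece_bound:
  assumes r: "0 < r" "r \<le> 1" and n: "n \<ge> 0"
  shows "Cbd k (ball 0 n) (\<lambda>_. C * (1 + n) ^ m * r ^ a) (piece r)"
proof -
  let ?c = "1 / r ^ 3"
  have r3: "0 < r ^ 3" "r ^ 3 \<le> 1" using r by (auto intro: power_le_one)
  hence c1: "?c \<ge> 1" by simp
  have "Cbd k UNIV (\<lambda>x. \<bar>r ^ (K - 1)\<bar> * (?c ^ k * (C * (1 + norm (scale r x)) ^ m))) (piece r)"
    unfolding piece_def
    by (intro Cbd_cmult open_UNIV Cbd_linear_compose scale_linear scale_norm r c1 Phi_bound) (use r in auto)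
  hence "Cbd k (ball 0 n) (\<lambda>x. \<bar>r ^ (K - 1)\<bar> * (?c ^ k * (C * (1 + norm (scale r x)) ^ m))) (piece r)"
    by (rule Cbd_subset) simp
  thus ?thesis
  proof (rule Cbd_mono)
    fix x :: "complex ^ 3" assume "x \<in> ball 0 n"
    hence x: "norm x \<le> n" by simp
    have "1 + norm (scale r x) \<le> 1 * ?c + ?c * norm x" using scale_norm[OF r, of x] c1 by linarith
    also have "\<dots> \<le> ?c * (1 + n)" using x r3(1) by (simp add: field_simps)
    finally have "(1 + norm (scale r x)) ^ m \<le> (?c * (1 + n)) ^ m" by (intro power_mono) auto
    hence "r ^ (K - 1) * (?c ^ k * (C * (1 + norm (scale r x)) ^ m)) \<le> r ^ (K - 1) * (?c ^ k * (C * (?c * (1 + n)) ^ m))"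
      using r C1 by (intro mult_left_mono mult_nonneg_nonneg) auto
    also have "\<dots> = C * (1 + n) ^ m * (r ^ (K - 1) * ?c ^ (k + m))"
      by (simp only: power_mult_distrib power_add mult_ac)
    also have "r ^ (K - 1) * ?c ^ (k + m) = r ^ a"
    proof -
      have "r ^ (K - 1) = r ^ a * (r ^ 3) ^ (k + m)"
        unfolding power_mult[symmetric] power_add[symmetric] K_def a_def by simp
      thus ?thesis using r3(1) by (simp add: power_divide)
    qed
    finally show "\<bar>r ^ (K - 1)\<bar> * (?c ^ k * (C * (1 + norm (scale r x)) ^ m)) \<le> C * (1 + n) ^ m * r ^ a"
      using r by simp
  qed
qed

lemma rad_power_a: "rad \<nu> ^ a \<le> rad \<nu>"
  using power_decreasing[OF a_pos, of "rad \<nu>"] rad_pos[of \<nu>] rad_le_1[of \<nu>] by simp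

lemma piece_rad_bound:
  assumes "n \<ge> 0"
  shows "Cbd k (ball 0 n) (\<lambda>_. C * (1 + n) ^ m * q ^ Suc \<nu>) (piece (rad \<nu>))"
proof (rule Cbd_mono[OF piece_bound[OF rad_pos rad_le_1 assms]])
  have "rad \<nu> ^ a \<le> q ^ Suc \<nu>" using rad_power_a[of \<nu>] rad_le[of \<nu>] by linarith
  thus "C * (1 + n) ^ m * rad \<nu> ^ a \<le> C * (1 + n) ^ m * q ^ Suc \<nu>"
    using C1 assms by (intro mult_left_mono mult_nonneg_nonneg) auto
qed

lemma q_sums: "(\<lambda>\<nu>. q ^ Suc \<nu>) sums (q / (1 - q))"
  using sums_mult[OF geometric_sums[of q], of q] q_pos q_small by simp

lemma q_suminf: "(\<Sum>\<nu>. q ^ Suc \<nu>) \<le> 2 * q"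
proof -
  have "q / (1 - q) \<le> q / (1/2)" using q_pos q_small by (intro divide_left_mono) auto
  thus ?thesis using sums_unique[OF q_sums] by simp
qed

lemma series_bound:
  assumes "n \<ge> 0"
  shows "Cbd k (ball 0 n) (\<lambda>_. C * (1 + n) ^ m * (2 * q)) series"
proof -
  have "Cbd k (ball 0 n) (\<lambda>_. \<Sum>\<nu>. C * (1 + n) ^ m * q ^ Suc \<nu>) series"
    unfolding series_def
    by (rule Cbd_suminf[OF open_ball convex_ball piece_rad_bound[OF assms]
          summable_mult[OF sums_summable[OF q_sums]]])
  thus ?thesis
  proof (rule Cbd_mono)
    have "C * (1 + n) ^ m * (\<Sum>\<nu>. q ^ Suc \<nu>) \<le> C * (1 + n) ^ m * (2 * q)"
      using C1 assms by (intro mult_left_mono mult_nonneg_nonneg q_suminf) auto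
    thus "(\<Sum>\<nu>. C * (1 + n) ^ m * q ^ Suc \<nu>) \<le> C * (1 + n) ^ m * (2 * q)"
      using suminf_mult[OF sums_summable[OF q_sums], of "C * (1 + n) ^ m"] by simp
  qed
qed

text \<open>The ball of radius 3 contains the set where \<open>rho x \<le> 0\<close>
  (\<open>rho_nonpos_norm\<close>), and 1/16 is small enough for \<open>series\<close> to be a
  perturbation of \<open>Nrm\<close> there, in value and in slope.\<close>

lemma series_bound_3: "Cbd k (ball 0 3) (\<lambda>_. 1/16) series"
proof (rule Cbd_mono[OF series_bound])
  show "C * (1 + 3) ^ m * (2 * q) \<le> 1/16" using q_B by (simp add: B_def)
qed simp

lemma series_small: "norm x < 3 \<Longrightarrow> \<bar>series x\<bar> \<le> 1/16"
  using Cbd_bound[OF series_bound_3] by simp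

lemma series_Lipschitz: "norm x < 3 \<Longrightarrow> norm y < 3 \<Longrightarrow> \<bar>series x - series y\<bar> \<le> 1/16 * norm (x - y)"
  using Cbd_Lipschitz[OF convex_ball, of "k - 1" 0 3 "1/16" series x y] series_bound_3 k1 by simp

lemma continuous_on_series: "continuous_on UNIV series"
proof (rule continuous_at_imp_continuous_on, rule ballI)
  fix x :: "complex ^ 3"
  have "Cbd (Suc (k - 1)) (ball 0 (norm x + 1)) (\<lambda>_. C * (1 + (norm x + 1)) ^ m * (2 * q)) series"
    using series_bound[of "norm x + 1"] k1 by simp
  from Cbd_has_derivative[OF this, of x] show "isCont series x"
    by (auto intro: has_derivative_continuous)
qed

lemma psh_on_piece:
  assumes "0 < r" "r \<le> 1"
  shows "psh_on UNIV (piece r)"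
proof -
  have "psh_on UNIV (\<lambda>x. Phi r (scale r x))"
    unfolding scale_def by (rule psh_on_diagonal[OF psh_on_Phi]) (use assms in auto)
  thus ?thesis unfolding piece_def by (rule psh_on_cmult) (use assms in auto)
qed

lemma summable_piece: "summable (\<lambda>\<nu>. piece (rad \<nu>) x)"
proof (rule summable_comparison_test'[where N = 0])
  show "summable (\<lambda>\<nu>. C * (1 + (norm x + 1)) ^ m * q ^ Suc \<nu>)"
    by (rule summable_mult[OF sums_summable[OF q_sums]])
  show "norm (piece (rad \<nu>) x) \<le> C * (1 + (norm x + 1)) ^ m * q ^ Suc \<nu>" for \<nu>
    using Cbd_bound[OF piece_rad_bound[of "norm x + 1" \<nu>], of x] by simp
qed

lemma psh_on_series: "psh_on UNIV series"
proof (rule psh_on_limit[where f = "\<lambda>n x. \<Sum>\<nu><n. piece (rad \<nu>) x"])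
  show "psh_on UNIV (\<lambda>x. \<Sum>\<nu><n. piece (rad \<nu>) x)" for n
    by (intro psh_on_sum psh_on_piece rad_pos rad_le_1) auto
  fix L :: "(complex ^ 3) set" assume "compact L"
  then obtain n where n: "\<And>x. x \<in> L \<Longrightarrow> norm x \<le> n"
    using compact_imp_bounded[of L] by (auto simp: bounded_iff)
  show "uniform_limit L (\<lambda>n x. \<Sum>\<nu><n. piece (rad \<nu>) x) series sequentially"
    unfolding series_def
  proof (rule Weierstrass_m_test)
    show "summable (\<lambda>\<nu>. C * (1 + (\<bar>n\<bar> + 1)) ^ m * q ^ Suc \<nu>)"
      by (rule summable_mult[OF sums_summable[OF q_sums]])
    fix \<nu> x assume "x \<in> L"
    with n[of x] show "norm (piece (rad \<nu>) x) \<le> C * (1 + (\<bar>n\<bar> + 1)) ^ m * q ^ Suc \<nu>"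
      using Cbd_bound[OF piece_rad_bound[of "\<bar>n\<bar> + 1" \<nu>], of x] by simp
  qed
qed (rule continuous_on_series)

text \<open>This holds at every point, since \<open>Phi\<close> is bounded below by -2 globally. It
  is what confines the sublevel set to the ball in which the two-sided bound
  \<open>series_small\<close> becomes available.\<close>

lemma series_lower: "- (1/16) \<le> series x"
proof -
  have "- 2 * q ^ Suc \<nu> \<le> piece (rad \<nu>) x" for \<nu>
  proof -
    have "rad \<nu> ^ (K - 1) \<le> rad \<nu> ^ 1"
      using K_ge rad_pos[of \<nu>] rad_le_1[of \<nu>] by (intro power_decreasing) auto
    hence "rad \<nu> ^ (K - 1) \<le> q ^ Suc \<nu>" using rad_le[of \<nu>] by simp
    hence "- 2 * q ^ Suc \<nu> \<le> - 2 * rad \<nu> ^ (K - 1)" by simp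
    also have "\<dots> = rad \<nu> ^ (K - 1) * (-2)" by simp
    also have "\<dots> \<le> piece (rad \<nu>) x"
      unfolding piece_def using rad_pos[of \<nu>] by (intro mult_left_mono Phi_lower) auto
    finally show ?thesis .
  qed
  hence "(\<Sum>\<nu>. - 2 * q ^ Suc \<nu>) \<le> series x"
    unfolding series_def by (intro suminf_le summable_piece summable_mult sums_summable[OF q_sums])
  moreover have "(\<Sum>\<nu>. - 2 * q ^ Suc \<nu>) = - 2 * (\<Sum>\<nu>. q ^ Suc \<nu>)"
    by (rule suminf_mult[OF sums_summable[OF q_sums]])
  ultimately show ?thesis using q_suminf q_small by linarith
qed

lemma series_cong:
  assumes "x $ 2 = y $ 2" "x $ 3 = y $ 3"
  shows "series x = series y"
proof -
  have "Phi s (scale r x) = Phi s (scale r y)" for s r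
    unfolding Phi_def cusp_def barrier_def weight_def scale_def using assms by simp
  thus ?thesis by (simp add: series_def piece_def)
qed

lemma Phi_near_0:
  obtains V where "open V" "0 \<in> V" "\<And>s x. x \<in> V \<Longrightarrow> Phi s x = 0"
proof (rule that)
  let ?V = "{x. barrier x < -1 \<and> cmod (cusp x) < 1 \<and> cmod (x $ 2) < 2}"
  show "open ?V"
    by (intro open_Collect_conj open_Collect_less continuous_intros continuous_on_cusp
        psh_on_continuous[OF psh_on_barrier])
  show "0 \<in> ?V" by (simp add: cusp_def barrier_def)
  show "Phi s x = 0" if "x \<in> ?V" for s x using that pos[of "- barrier x"] by (simp add: Phi_def)
qed

lemma piece_0: "piece r 0 = 0"
proof -
  have "scale r 0 = 0" by (simp add: scale_def vec_eq_iff)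
  thus ?thesis using Phi_near_0 by (metis mult_zero_right piece_def)
qed

lemma series_0: "series 0 = 0"
  by (simp add: series_def piece_0)

text \<open>Each summand vanishes near 0, but on neighbourhoods that shrink with the scale, so the
  sum is differentiated term by term.\<close>

lemma series_derivative_0: "(series has_derivative (\<lambda>_. 0)) (at 0)"
proof -
  have Dl0: "Dl [h] (piece r) 0 = 0" if r: "0 < r" "r \<le> 1" for h r
  proof -
    obtain V where V: "open V" "0 \<in> V" "\<And>s x. x \<in> V \<Longrightarrow> Phi s x = 0" using Phi_near_0 by blast
    have "open (scale r -` V)"
      by (intro open_vimage V linear_continuous_on scale_linear r)
    moreover have "0 \<in> scale r -` V"
      using V(2) by (simp add: scale_def zero_vec_def[symmetric])
    moreover have "piece r y = (\<lambda>_. 0) y" if "y \<in> scale r -` V" for y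
      using V(3) that by (simp add: piece_def)
    ultimately have "Dl [h] (piece r) 0 = Dl [h] (\<lambda>_. 0) 0" by (rule Dl_cong_open)
    also have "\<dots> = 0" by (rule Dl_single) simp
    finally show ?thesis .
  qed
  have "((\<lambda>x. \<Sum>\<nu>. piece (rad \<nu>) x) has_derivative (\<lambda>h. \<Sum>\<nu>. Dl [h] (piece (rad \<nu>)) 0)) (at 0)"
  proof (rule Cbd_suminf_has_derivative[OF open_ball convex_ball])
    show "Cbd (Suc (k - 1)) (ball 0 3) (\<lambda>_. C * (1 + 3) ^ m * q ^ Suc \<nu>) (piece (rad \<nu>))" for \<nu>
      using piece_rad_bound[of 3 \<nu>] k1 by simp
  qed (auto intro!: summable_mult sums_summable[OF q_sums] simp del: power_Suc)
  thus ?thesis by (simp only: Dl0[OF rad_pos rad_le_1] suminf_zero series_def[symmetric])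
qed

lemma piece_cusp_zero:
  assumes "x $ 2 = \<xi>\<^sup>2" "x $ 3 = \<xi> ^ 3" "cmod \<xi> \<le> r" "r > 0"
  shows "piece r x = 0"
proof -
  have "Phi r (scale r x) = 0"
  proof (rule Phi_cusp_zero[where \<xi> = "\<xi> / of_real r"])
    have "cmod (\<xi> / of_real r) \<le> 1" using assms by (simp add: norm_divide)
    hence "(cmod (\<xi> / of_real r))\<^sup>2 \<le> 1" by (intro power_le_one) auto
    thus "(cmod (\<xi> / of_real r))\<^sup>2 < 2" by linarith
  qed (use assms in \<open>simp_all add: scale_def power_divide\<close>)
  thus ?thesis by (simp add: piece_def)
qed

lemma piece_cusp_upper:
  assumes "x $ 2 = \<xi>\<^sup>2" "x $ 3 = \<xi> ^ 3" "cmod \<xi> \<le> 1" "0 < r" "r \<le> 1"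
  shows "piece r x \<le> r ^ K * (17 + 8 * ln (1 + (cmod \<xi> / r)\<^sup>2)) - r ^ (K - 1) * Re \<xi>"
proof -
  have "1 / r * Phi (1 / (1 / r)) (scale r x) \<le> 17 + 8 * ln (1 + (cmod (\<xi> / of_real r))\<^sup>2) - Re (\<xi> / of_real r)"
  proof (rule Phi_cusp_upper)
    show "cmod (\<xi> / complex_of_real r) \<le> 1 / r" using assms by (simp add: norm_divide divide_right_mono)
  qed (use assms in \<open>simp_all add: scale_def power_divide\<close>)
  hence "r ^ K * (1 / r * Phi r (scale r x)) \<le> r ^ K * (17 + 8 * ln (1 + (cmod \<xi> / r)\<^sup>2) - Re \<xi> / r)"
    using assms by (intro mult_left_mono) (auto simp: norm_divide)
  moreover have "r ^ K = r ^ (K - 1) * r" using K_ge by (simp add: power_Suc2[symmetric] del: power_Suc)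
  ultimately show ?thesis using assms by (simp add: piece_def algebra_simps)
qed

lemma series_tail:
  assumes "norm x < 3"
  shows "(\<Sum>j. piece (rad (j + \<nu>)) x) \<le> 2 * B * rad \<nu> ^ a"
proof -
  have le: "norm (piece (rad (j + \<nu>)) x) \<le> B * rad \<nu> ^ a * (1/2) ^ j" for j
  proof -
    have "norm (piece (rad (j + \<nu>)) x) \<le> B * rad (j + \<nu>) ^ a"
      using Cbd_bound[OF piece_bound[OF rad_pos rad_le_1, of 3 "j + \<nu>"], of x] assms by (simp add: B_def)
    also have "rad (j + \<nu>) ^ a \<le> (rad \<nu> * (1/2) ^ j) ^ a"
    proof (rule power_mono)
      have "q ^ j \<le> (1/2) ^ j" using q_pos q_small by (intro power_mono) auto
      hence "rad \<nu> * q ^ j \<le> rad \<nu> * (1/2) ^ j" using rad_pos[of \<nu>] by (intro mult_left_mono) auto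
      thus "rad (j + \<nu>) \<le> rad \<nu> * (1/2) ^ j" using rad_add[of \<nu> j] by (simp add: add.commute)
    qed (use rad_pos[of "j + \<nu>"] in simp)
    also have "\<dots> = rad \<nu> ^ a * ((1/2) ^ j) ^ a" by (simp add: power_mult_distrib)
    also have "((1/2) ^ j) ^ a \<le> ((1/2::real) ^ j) ^ 1"
      by (rule power_decreasing[OF a_pos]) (auto simp: power_le_one)
    finally show ?thesis using B_ge rad_pos[of \<nu>] by (simp add: mult_left_mono mult.assoc)
  qed
  have s: "(\<lambda>j. B * rad \<nu> ^ a * (1/2) ^ j) sums (B * rad \<nu> ^ a * 2)"
    using sums_mult[OF geometric_sums[of "1/2::real"], of "B * rad \<nu> ^ a"] by simp
  have "norm (\<Sum>j. piece (rad (j + \<nu>)) x) \<le> (\<Sum>j. B * rad \<nu> ^ a * (1/2) ^ j)"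
    by (rule norm_suminf_le[OF le sums_summable[OF s]])
  thus ?thesis using sums_unique[OF s] by (simp add: mult_ac)
qed

text \<open>With \<open>R = rad \<nu>\<close>, the summands up to index \<open>\<nu>\<close> vanish,
  as \<open>cmod \<xi>\<close> does not exceed their scale. The summand \<open>Suc \<nu>\<close>, of
  scale \<open>R ^ 4\<close>, supplies the linear term, and the tail is at most
  \<open>2 * B * R ^ (8 * K)\<close> because \<open>16 * a = 8 * K\<close>.\<close>

lemma series_on_disc:
  assumes x: "x $ 2 = (of_real (rad \<nu>) * \<zeta>)\<^sup>2" "x $ 3 = (of_real (rad \<nu>) * \<zeta>) ^ 3"
    and z: "cmod \<zeta> \<le> 1" and n: "norm x < 3"
  shows "series x \<le> rad \<nu> ^ (4 * K - 1) * (73 + 2 * B) - rad \<nu> ^ (4 * K - 3) * Re \<zeta>"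
proof -
  define R where "R = rad \<nu>"
  have R: "0 < R" "R \<le> 1" "R \<le> 1/100"
    using rad_pos[of \<nu>] rad_le_1[of \<nu>] rad_le_q[of \<nu>] q_small by (auto simp: R_def)
  let ?\<xi> = "of_real R * \<zeta>"
  have xi: "cmod ?\<xi> \<le> R" using z R by (simp add: norm_mult mult_left_le)
  have low: "piece (rad \<mu>) x = 0" if "\<mu> < Suc \<nu>" for \<mu>
  proof (rule piece_cusp_zero[where \<xi> = "?\<xi>"])
    show "cmod ?\<xi> \<le> rad \<mu>" using xi rad_mono[of \<mu> \<nu>] that by (simp add: R_def)
  qed (use x rad_pos in \<open>auto simp: R_def\<close>)
  have "series x = (\<Sum>j. piece (rad (j + Suc (Suc \<nu>))) x) + (\<Sum>\<mu><Suc (Suc \<nu>). piece (rad \<mu>) x)"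
    unfolding series_def by (rule suminf_split_initial_segment[OF summable_piece])
  also have "(\<Sum>\<mu><Suc (Suc \<nu>). piece (rad \<mu>) x) = piece (rad (Suc \<nu>)) x"
    using low by simp
  also have "(\<Sum>j. piece (rad (j + Suc (Suc \<nu>))) x) \<le> 2 * B * rad (Suc (Suc \<nu>)) ^ a"
    by (rule series_tail[OF n])
  also have "rad (Suc (Suc \<nu>)) ^ a = R ^ (8 * K)"
    by (simp add: rad_Suc R_def power_mult[symmetric] K_def)
  also have "R ^ (8 * K) \<le> R ^ (4 * K - 1)"
    using R by (intro power_decreasing) auto
  also have "piece (rad (Suc \<nu>)) x \<le> R ^ (4 * K - 1) * 73 - R ^ (4 * K - 3) * Re \<zeta>"
  proof -
    let ?r = "R ^ 4"
    have r: "rad (Suc \<nu>) = ?r" by (simp add: rad_Suc R_def)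
    have "piece ?r x \<le> ?r ^ K * (17 + 8 * ln (1 + (cmod ?\<xi> / ?r)\<^sup>2)) - ?r ^ (K - 1) * Re ?\<xi>"
      by (rule piece_cusp_upper) (use x xi R in \<open>auto simp: R_def[symmetric] power_le_one\<close>)
    also have "?r ^ (K - 1) * Re ?\<xi> = R ^ (4 * K - 3) * Re \<zeta>"
    proof -
      have "4 * (K - 1) + 1 = 4 * K - 3" using K_ge by simp
      hence "?r ^ (K - 1) * R = R ^ (4 * K - 3)" by (simp add: power_mult[symmetric] power_Suc2[symmetric] del: power_Suc)
      thus ?thesis by (simp add: mult.assoc[symmetric])
    qed
    \<comment> \<open>The rescaled parameter is at most \<open>1 / R ^ 3\<close> in modulus, so the
      logarithm is at most \<open>7 * ln (1 / R)\<close>. Bounding \<open>ln\<close> by its argument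
      costs a factor \<open>1 / R\<close>, which the exponent \<open>4 * K - 1\<close> in place of
      \<open>4 * K\<close> allows.\<close>
    also have "ln (1 + (cmod ?\<xi> / ?r)\<^sup>2) \<le> 7 / R"
    proof -
      have "cmod ?\<xi> / ?r \<le> R / ?r" using xi R by (intro divide_right_mono) auto
      also have "\<dots> = 1 / R ^ 3" using R by (simp add: power_numeral_reduce)
      finally have "(cmod ?\<xi> / ?r)\<^sup>2 \<le> (1 / R ^ 3)\<^sup>2" using R by (intro power_mono) auto
      also have "\<dots> = (1 / R) ^ 6" by (simp add: power_divide power_mult[symmetric])
      finally have "1 + (cmod ?\<xi> / ?r)\<^sup>2 \<le> 1 + (1 / R) ^ 6" by simp
      also have "\<dots> \<le> 2 * (1 / R) ^ 6" using R by (simp add: one_le_power)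
      also have "\<dots> \<le> (1 / R) * (1 / R) ^ 6" using R by (intro mult_right_mono) (auto simp: field_simps)
      finally have "1 + (cmod ?\<xi> / ?r)\<^sup>2 \<le> (1 / R) ^ 7" by (simp add: power_numeral_reduce)
      hence "ln (1 + (cmod ?\<xi> / ?r)\<^sup>2) \<le> ln ((1 / R) ^ 7)" by (intro ln_mono) (auto intro: add_pos_nonneg)
      also have "\<dots> = 7 * ln (1 / R)" using R by (simp add: ln_realpow)
      also have "\<dots> \<le> 7 * (1 / R)" using R by (intro mult_left_mono ln_bound) auto
      finally show ?thesis by simp
    qed
    also have "?r ^ K * (17 + 8 * (7 / R)) \<le> R ^ (4 * K - 1) * 73"
    proof -
      have "4 * K = Suc (4 * K - 1)" using K_ge by simp
      hence "?r ^ K = R ^ (4 * K - 1) * R" by (metis power_Suc2 power_mult)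
      hence "?r ^ K * (17 + 8 * (7 / R)) = R ^ (4 * K - 1) * (17 * R + 56)" using R by (simp add: field_simps)
      also have "\<dots> \<le> R ^ (4 * K - 1) * 73" using R by (intro mult_left_mono) auto
      finally show ?thesis .
    qed
    finally show ?thesis unfolding r using R by simp
  qed
  finally show ?thesis using B_ge by (simp add: R_def algebra_simps)
qed

end

subsection \<open>The domain\<close>

lemma cgrow_power: "cgrow k U S f \<Longrightarrow> cgrow k U S (\<lambda>x. f x ^ Suc n)"
  by (induction n) (auto intro: cgrow_mult)

lemma derivative_along_line:
  fixes f :: "'a::real_normed_vector \<Rightarrow> real"
  assumes "(f has_derivative L) (at p)"
  shows "((\<lambda>t. f (p + t *\<^sub>R h)) has_real_derivative L h) (at 0)"
proof -
  interpret bounded_linear L using assms by (rule has_derivative_bounded_linear)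
  have "((\<lambda>t. p + t *\<^sub>R h) has_derivative (\<lambda>t. t *\<^sub>R h)) (at 0)"
    by (auto intro!: derivative_eq_intros)
  from has_derivative_compose[OF this, of f L] assms
  have "((\<lambda>t. f (p + t *\<^sub>R h)) has_derivative (\<lambda>t. L (t *\<^sub>R h))) (at 0)" by simp
  thus ?thesis by (simp add: has_field_derivative_def scaleR mult_commute_abs)
qed

text \<open>Detects a nonvanishing gradient by growth along a ray, so that no derivative of
  \<open>series\<close> has to be computed.\<close>

lemma nonzero_derivative_of_growth:
  fixes f :: "'a::real_normed_vector \<Rightarrow> real"
  assumes "(f has_derivative L) (at p)" "c > 0" "d > 0"
    and "\<And>t. 0 < t \<Longrightarrow> t < d \<Longrightarrow> f p + c * t \<le> f (p + t *\<^sub>R h)"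
  shows "L \<noteq> (\<lambda>_. 0)"
proof
  assume "L = (\<lambda>_. 0)"
  hence "((\<lambda>t. f (p + t *\<^sub>R h)) has_real_derivative 0) (at 0)"
    using derivative_along_line[OF assms(1), of h] by simp
  hence "((\<lambda>t. f (p + t *\<^sub>R h) - c * t) has_real_derivative - c) (at 0)"
    by (auto intro!: derivative_eq_intros)
  from DERIV_neg_dec_right[OF this] assms(2) obtain e
    where e: "e > 0" "\<And>t. 0 < t \<Longrightarrow> t < e \<Longrightarrow> f (p + t *\<^sub>R h) - c * t < f p" by auto
  define t where "t = min d e / 2"
  have "0 < t" "t < d" "t < e" using assms(3) e(1) by (auto simp: t_def)
  with e(2)[of t] assms(4)[of t] show False by linarith
qed

text \<open>A normal may come from any local defining function \<open>\<sigma>\<close>, while the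
  theorem speaks of all normals at \<open>P\<close>. A direction with \<open>inner n0 h < 0\<close>
  leads into \<open>D\<close>, so \<open>\<sigma>\<close> cannot increase along it; one open
  half-space therefore lies in the closed half-space of the other vector, and the unit vectors
  agree.\<close>

lemma unit_outward_normal_unique:
  assumes D: "D = {x. \<rho> x < 0}" and \<rho>: "(\<rho> has_derivative (\<lambda>h. inner n0 h)) (at P)" "\<rho> P = 0" "norm n0 = 1"
    and n: "unit_outward_normal D P n"
  shows "n = n0"
proof -
  from n obtain U \<sigma> L c where U: "open U" "P \<in> U" "D \<inter> U = {z\<in>U. \<sigma> z < 0}"
    "(\<sigma> has_derivative L) (at P)" "c > 0" "\<And>h. L h = c * inner n h" and n1: "norm n = 1"
    unfolding unit_outward_normal_def by blast
  have P: "\<sigma> P \<ge> 0"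
    using U(2,3) \<rho>(2) D by force
  have le: "inner n h \<le> 0" if h: "inner n0 h < 0" for h
  proof (rule ccontr)
    assume "\<not> inner n h \<le> 0"
    hence "L h > 0" using U(5,6) by simp
    from DERIV_pos_inc_right[OF derivative_along_line[OF U(4)] this] P obtain d1
      where d1: "d1 > 0" "\<And>t. 0 < t \<Longrightarrow> t < d1 \<Longrightarrow> \<sigma> (P + t *\<^sub>R h) > 0"
      by (auto intro: le_less_trans)
    from DERIV_neg_dec_right[OF derivative_along_line[OF \<rho>(1)] h] \<rho>(2) obtain d2
      where d2: "d2 > 0" "\<And>t. 0 < t \<Longrightarrow> t < d2 \<Longrightarrow> \<rho> (P + t *\<^sub>R h) < 0" by auto
    have "open ((\<lambda>t. P + t *\<^sub>R h) -` U)"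
      by (intro open_vimage U continuous_intros)
    moreover have "0 \<in> (\<lambda>t. P + t *\<^sub>R h) -` U" using U(2) by simp
    ultimately obtain d3 where d3: "d3 > 0" "ball 0 d3 \<subseteq> (\<lambda>t. P + t *\<^sub>R h) -` U"
      using open_contains_ball by blast
    define t where "t = min d1 (min d2 d3) / 2"
    have t: "0 < t" "t < d1" "t < d2" "t < d3" using d1 d2 d3 by (auto simp: t_def)
    have "P + t *\<^sub>R h \<in> U" using d3(2) t by (auto simp: subset_iff)
    moreover have "P + t *\<^sub>R h \<in> D" using d2(2)[of t] t D by simp
    ultimately have "\<sigma> (P + t *\<^sub>R h) < 0" using U(3) by blast
    with d1(2)[of t] t show False by simp
  qed
  have n00: "inner n0 n0 = 1" "inner n n = 1" using \<rho>(3) n1 by (simp_all add: dot_square_norm)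
  let ?i = "inner n0 n"
  have "inner n (- n0) \<le> 0" by (rule le) (simp add: n00)
  hence i0: "?i \<ge> 0" by (simp add: inner_commute)
  have "1 - ?i\<^sup>2 \<le> e" if "e > 0" for e
  proof -
    \<comment> \<open>The test direction is the part of \<open>n\<close> orthogonal to
      \<open>n0\<close>, tilted inwards by \<open>e\<close>; letting \<open>e\<close> tend to 0
      gives equality in the Cauchy-Schwarz inequality.\<close>
    have "inner n (n - ?i *\<^sub>R n0 - e *\<^sub>R n0) \<le> 0"
      by (rule le) (use that n00 in \<open>simp add: inner_diff_right\<close>)
    hence "1 - ?i\<^sup>2 \<le> e * ?i" using n00 by (simp add: inner_diff_right inner_commute power2_eq_square)
    also have "\<dots> \<le> e * 1" using that norm_cauchy_schwarz[of n0 n] \<rho>(3) n1 by (intro mult_left_mono) auto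
    finally show ?thesis by simp
  qed
  hence "1 - ?i\<^sup>2 \<le> 0" by (rule field_le_epsilon[of _ 0, simplified])
  hence "1\<^sup>2 \<le> ?i\<^sup>2" by simp
  hence "1 \<le> ?i" using i0 by (rule power2_le_imp_le)
  hence "?i = 1" using norm_cauchy_schwarz[of n0 n] \<rho>(3) n1 by simp
  hence "(norm (n - n0))\<^sup>2 = 0"
    using n00 by (simp add: power2_norm_eq_inner inner_diff inner_commute)
  thus ?thesis by simp
qed

section \<open>The defining function and the geometry of its sublevel set\<close>

context cusp_series
begin

text \<open>Confines the last two coordinates. On the discs these are at most \<open>R ^ 2\<close>
  and \<open>R ^ 3\<close> in modulus, so the exponent \<open>2 * K\<close> keeps this term below
  the admissible error; being even, it also gives squared moduli of holomorphic functions.\<close>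

definition Nrm :: "complex ^ 3 \<Rightarrow> real" where
  "Nrm x = cmod (x $ 2) ^ (2 * K) + cmod (x $ 3) ^ (2 * K)"

definition Q :: "complex ^ 3 \<Rightarrow> real" where
  "Q x = series x + Nrm x"

text \<open>With \<open>w = x $ 1\<close> the first part is \<open>Re w + (cmod w)\<^sup>2\<close>:
  linear in the normal direction at 0, and bounding the first coordinate.\<close>

definition rho :: "complex ^ 3 \<Rightarrow> real" where
  "rho x = (cmod (x $ 1 + 1/2))\<^sup>2 - 1/4 + Q x"

definition Dom :: "(complex ^ 3) set" where
  "Dom = {x. rho x < 0}"

lemma Nrm_eq: "Nrm x = (cmod ((x $ 2) ^ K))\<^sup>2 + (cmod ((x $ 3) ^ K))\<^sup>2"
  by (simp only: Nrm_def norm_power power_mult[symmetric] mult.commute[of K 2])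

lemma Nrm_nonneg: "0 \<le> Nrm x" by (simp add: Nrm_def)

lemma Nrm_scaleR: "Nrm (t *\<^sub>R x) = \<bar>t\<bar> ^ (2 * K) * Nrm x"
  by (simp add: Nrm_def power_mult_distrib ring_distribs)

lemma Q_cong: "x $ 2 = y $ 2 \<Longrightarrow> x $ 3 = y $ 3 \<Longrightarrow> Q x = Q y"
  using series_cong[of x y] by (simp add: Q_def Nrm_def)

lemma Q_0: "Q 0 = 0"
  using K_ge by (simp add: Q_def series_0 Nrm_def)

lemma rho_0: "rho 0 = 0"
  by (simp add: rho_def Q_0 power2_eq_square norm_divide)

lemma psh_on_rho: "psh_on UNIV rho"
proof -
  have "psh_on UNIV (\<lambda>x. ((cmod (x $ 1 + 1/2))\<^sup>2 + (- 1/4)) + (series x + ((cmod ((x $ 2) ^ K))\<^sup>2 + (cmod ((x $ 3) ^ K))\<^sup>2)))"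
    by (intro psh_on_add psh_on_const psh_on_series psh_on_norm_square continuous_intros)
       (auto simp: holo_map_def intro!: holomorphic_intros)
  thus ?thesis by (rule psh_on_cong) (simp add: rho_def Q_def Nrm_eq)
qed

lemma continuous_on_rho: "continuous_on S rho"
  using psh_on_continuous[OF psh_on_rho] by (rule continuous_on_subset) simp

lemma rho_Cbd: "\<exists>W. Cbd k (ball 0 3) W rho"
proof -
  obtain j where j: "K = Suc j" using K_ge by (cases K) auto
  have c: "cgrow k UNIV (UNIV :: unit set) (\<lambda>_ :: complex ^ 3. -1/2)"
    unfolding cgrow_def by (rule conjI; rule pgrow_const[where B = 1]) auto
  have d: "pgrow k UNIV (UNIV :: unit set) (\<lambda>_ _ :: complex ^ 3. 1/4)"
    by (rule pgrow_const[where B = 1]) auto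
  have p: "pgrow k UNIV (UNIV :: unit set) (\<lambda>_ x :: complex ^ 3. (cmod ((x $ i) ^ Suc j))\<^sup>2)" for i
    by (rule cgrow_norm_square[OF cgrow_power[OF cgrow_coord[OF open_UNIV]]])
  have "pgrow k UNIV (UNIV :: unit set) (\<lambda>_ x :: complex ^ 3. (cmod (x $ 1 - (-1/2)))\<^sup>2 - 1/4
      + ((cmod ((x $ 2) ^ Suc j))\<^sup>2 + (cmod ((x $ 3) ^ Suc j))\<^sup>2))"
    by (rule pgrow_add[OF pgrow_diff[OF cgrow_norm_square[OF cgrow_diff[OF cgrow_coord[OF open_UNIV] c]] d] pgrow_add[OF p p]])
  then obtain W where "Cbd k UNIV W (\<lambda>x :: complex ^ 3. (cmod (x $ 1 - (-1/2)))\<^sup>2 - 1/4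
      + ((cmod ((x $ 2) ^ Suc j))\<^sup>2 + (cmod ((x $ 3) ^ Suc j))\<^sup>2))"
    unfolding pgrow_def by blast
  hence "Cbd k (ball 0 3) W (\<lambda>x :: complex ^ 3. (cmod (x $ 1 - (-1/2)))\<^sup>2 - 1/4
      + ((cmod ((x $ 2) ^ Suc j))\<^sup>2 + (cmod ((x $ 3) ^ Suc j))\<^sup>2))"
    by (rule Cbd_subset) simp
  from Cbd_add[OF open_ball this series_bound_3]
  have "Cbd k (ball 0 3) (\<lambda>x. W x + 1/16) rho"
    by (rule Cbd_cong) (auto simp: rho_def Q_def Nrm_eq j)
  thus ?thesis by blast
qed

lemma norm_less_3:
  fixes x :: "complex ^ 3"
  assumes "cmod (x $ 1) \<le> 3/2" "cmod (x $ 2) \<le> 1" "cmod (x $ 3) \<le> 1"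
  shows "norm x < 3"
proof -
  have "(cmod (x $ 1))\<^sup>2 \<le> (3/2)\<^sup>2" "(cmod (x $ 2))\<^sup>2 \<le> 1\<^sup>2" "(cmod (x $ 3))\<^sup>2 \<le> 1\<^sup>2"
    by (rule power_mono[OF _ norm_ge_zero], fact)+
  hence "(cmod (x $ 1))\<^sup>2 + (cmod (x $ 2))\<^sup>2 + (cmod (x $ 3))\<^sup>2 < 3\<^sup>2" by (simp add: power2_eq_square)
  hence "sqrt ((cmod (x $ 1))\<^sup>2 + (cmod (x $ 2))\<^sup>2 + (cmod (x $ 3))\<^sup>2) < 3" by (intro real_less_lsqrt) auto
  thus ?thesis by (simp add: norm_vec_def L2_set_def sum_3)
qed

lemma Q_small_norm:
  assumes "Q x \<le> 1/4"
  shows "cmod (x $ 2) < 1" "cmod (x $ 3) < 1"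
proof -
  have N: "Nrm x \<le> 5/16" using assms series_lower[of x] by (simp add: Q_def)
  have *: "t < 1" if "t ^ (2 * K) \<le> 5/16" "t \<ge> 0" for t :: real
  proof (rule ccontr)
    assume "\<not> t < 1"
    hence "1 \<le> t ^ (2 * K)" by (intro one_le_power) auto
    with that show False by simp
  qed
  show "cmod (x $ 2) < 1" "cmod (x $ 3) < 1"
    by (rule *, use N in \<open>auto simp: Nrm_def intro: order_trans[rotated]\<close>)+
qed

lemma rho_nonpos_norm:
  assumes "rho x \<le> 0"
  shows "norm x < 3"
proof (rule norm_less_3)
  have Q: "Q x \<le> 1/4" using assms zero_le_power2[of "cmod (x $ 1 + 1/2)"] unfolding rho_def by linarith
  show "cmod (x $ 2) \<le> 1" "cmod (x $ 3) \<le> 1" using Q_small_norm[OF Q] by auto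
  have "Q x \<ge> - (1/16)" using series_lower[of x] Nrm_nonneg[of x] by (simp add: Q_def)
  hence "(cmod (x $ 1 + 1/2))\<^sup>2 \<le> 1\<^sup>2" using assms unfolding rho_def by simp
  hence "cmod (x $ 1 + 1/2) \<le> 1" by (rule power2_le_imp_le) simp
  moreover have "cmod (x $ 1) \<le> cmod (x $ 1 + 1/2) + cmod (1/2)"
    using norm_triangle_ineq4[of "x $ 1 + 1/2" "1/2"] by simp
  ultimately show "cmod (x $ 1) \<le> 3/2" by (simp add: norm_divide)
qed

text \<open>Along rays the term \<open>Nrm\<close>, homogeneous of degree \<open>2 K\<close>, dominates the small Lipschitz perturbation \<open>series\<close>.\<close>
lemma Q_ray:
  assumes x: "norm (s *\<^sub>R x) < 3" "s \<ge> 1" "Nrm x \<ge> 1/8"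
  shows "Q x + (s - 1) / 4 \<le> Q (s *\<^sub>R x)"
proof -
  have nx: "norm x < 3"
  proof -
    have "1 * norm x \<le> s * norm x" using x(2) by (intro mult_right_mono) auto
    thus ?thesis using x(1,2) by simp
  qed
  have "s *\<^sub>R x - x = (s - 1) *\<^sub>R x" by (simp add: algebra_simps)
  hence "norm (s *\<^sub>R x - x) = (s - 1) * norm x" using x(2) by simp
  also have "\<dots> \<le> (s - 1) * 3" using nx x(2) by (intro mult_left_mono) auto
  finally have "\<bar>series (s *\<^sub>R x) - series x\<bar> \<le> 1/16 * ((s - 1) * 3)"
    using series_Lipschitz[OF x(1) nx] by simp
  moreover have "Nrm x + (s - 1) / 2 \<le> Nrm (s *\<^sub>R x)"
  proof -
    have "1 + real (2 * K) * (s - 1) \<le> (1 + (s - 1)) ^ (2 * K)"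
      using x(2) by (intro Bernoulli_inequality) auto
    moreover have "4 * (s - 1) \<le> real (2 * K) * (s - 1)" using x(2) K_ge by (intro mult_right_mono) auto
    ultimately have "1 + 4 * (s - 1) \<le> s ^ (2 * K)" by simp
    hence "(1 + 4 * (s - 1)) * Nrm x \<le> s ^ (2 * K) * Nrm x" using Nrm_nonneg by (rule mult_right_mono)
    moreover have "4 * (s - 1) * (1/8) \<le> 4 * (s - 1) * Nrm x" using x by (intro mult_left_mono) auto
    moreover have "(1 + 4 * (s - 1)) * Nrm x = Nrm x + 4 * (s - 1) * Nrm x" by (simp only: ring_distribs)
    moreover have "Nrm (s *\<^sub>R x) = s ^ (2 * K) * Nrm x" using x(2) by (simp add: Nrm_scaleR)
    ultimately show ?thesis by linarith
  qed
  moreover have "1/16 * ((s - 1) * 3) \<le> (s - 1) / 2 - (s - 1) / 4" using x(2) by (simp add: field_simps)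
  ultimately show ?thesis unfolding Q_def by linarith
qed

text \<open>If \<open>Q\<close> reached 1/4 at \<open>t *\<^sub>R x\<close>, then \<open>Nrm\<close>
  would be at least 1/8 there and \<open>Q_ray\<close> would keep \<open>Q\<close> at or above 1/4
  all the way out to \<open>x\<close>. Setting the first coordinate to 0 leaves \<open>Q\<close>
  unchanged and keeps the ray in the ball of radius 3.\<close>

lemma Q_star:
  assumes "Q x < 1/4" "0 \<le> t" "t \<le> 1"
  shows "Q (t *\<^sub>R x) < 1/4"
proof (cases "t = 0")
  case False
  define x' :: "complex ^ 3" where "x' = (\<chi> i. if i = 1 then 0 else x $ i)"
  have QQ: "Q x' = Q x" "Q (t *\<^sub>R x') = Q (t *\<^sub>R x)" by (auto simp: x'_def intro!: Q_cong)
  have n: "norm x' < 3"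
    by (rule norm_less_3) (use Q_small_norm[of x] assms in \<open>auto simp: x'_def intro: less_imp_le\<close>)
  have ntx: "norm (t *\<^sub>R x') < 3"
    using mult_right_mono[of t 1 "norm x'"] assms n by simp
  show ?thesis
  proof (rule ccontr)
    assume "\<not> Q (t *\<^sub>R x) < 1/4"
    hence Q: "1/4 \<le> Q (t *\<^sub>R x')" by (simp add: QQ)
    hence "Nrm (t *\<^sub>R x') \<ge> 1/8" using series_small[OF ntx] by (simp add: Q_def)
    define s where "s = 1 / t"
    have s: "1 \<le> s" "s *\<^sub>R (t *\<^sub>R x') = x'" using assms(2,3) False by (simp_all add: s_def)
    have "Q (t *\<^sub>R x') + (s - 1) / 4 \<le> Q x'"
      using Q_ray[of s "t *\<^sub>R x'", unfolded s(2), OF n s(1) \<open>Nrm (t *\<^sub>R x') \<ge> 1/8\<close>] .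
    moreover have "(s - 1) / 4 \<ge> 0" using s(1) by simp
    ultimately show False using Q assms(1) QQ by linarith
  qed
qed (simp add: Q_0)

lemma open_Dom: "open Dom"
  unfolding Dom_def by (intro open_Collect_less continuous_on_rho continuous_intros)

lemma bounded_Dom: "bounded Dom"
  unfolding bounded_iff Dom_def using rho_nonpos_norm by (intro exI[of _ 3]) (auto intro: less_imp_le)

lemma frontier_Dom:
  assumes p: "p \<in> frontier Dom"
  shows "rho p = 0"
proof -
  have "closed {x. rho x \<le> 0}" by (intro closed_Collect_le continuous_on_rho continuous_intros)
  hence "closure Dom \<subseteq> {x. rho x \<le> 0}" by (rule closure_minimal[rotated]) (auto simp: Dom_def)
  moreover have "p \<in> closure Dom" "p \<notin> Dom" using p open_Dom by (auto simp: frontier_def interior_open)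
  ultimately show ?thesis unfolding Dom_def by force
qed

text \<open>Moving the first coordinate straight to \<open>-1/2\<close> does not increase
  \<open>rho\<close>; over that centre the slice is star-shaped by \<open>Q_star\<close>.\<close>

lemma connected_Dom: "connected Dom"
proof -
  define o' :: "complex ^ 3" where "o' = (\<chi> i. if i = 1 then - 1/2 else 0)"
  have o2: "o' $ 1 = -1/2" "o' $ 2 = 0" "o' $ 3 = 0" by (auto simp: o'_def)
  have "connected_component Dom x o'" if x: "x \<in> Dom" for x
  proof -
    define x1 :: "complex ^ 3" where "x1 = (\<chi> i. if i = 1 then - 1/2 else x $ i)"
    have x1: "x1 $ 1 = -1/2" "x1 $ 2 = x $ 2" "x1 $ 3 = x $ 3" by (auto simp: x1_def)
    have r: "(cmod (x $ 1 + 1/2))\<^sup>2 - 1/4 + Q x < 0" using x by (simp add: Dom_def rho_def)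
    hence Qx: "Q x < 1/4" using zero_le_power2[of "cmod (x $ 1 + 1/2)"] by linarith
    have "closed_segment x x1 \<subseteq> Dom"
    proof
      fix z assume "z \<in> closed_segment x x1"
      then obtain u where u: "0 \<le> u" "u \<le> 1" "z = (1 - u) *\<^sub>R x + u *\<^sub>R x1" by (auto simp: in_segment)
      have "z $ 1 + 1/2 = (1 - u) *\<^sub>R (x $ 1 + 1/2)"
        using x1 by (simp add: complex_eq_iff u(3) algebra_simps)
      hence "(cmod (z $ 1 + 1/2))\<^sup>2 = (1 - u)\<^sup>2 * (cmod (x $ 1 + 1/2))\<^sup>2"
        using u by (simp add: power_mult_distrib)
      also have "\<dots> \<le> 1 * (cmod (x $ 1 + 1/2))\<^sup>2"
        using u by (intro mult_right_mono) (auto intro: power_le_one)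
      finally have "(cmod (z $ 1 + 1/2))\<^sup>2 \<le> (cmod (x $ 1 + 1/2))\<^sup>2" by simp
      moreover have "Q z = Q x"
        by (rule Q_cong) (simp_all add: u(3) x1 scaleR_left_distrib[symmetric])
      ultimately have "rho z < 0" using r unfolding rho_def by linarith
      thus "z \<in> Dom" by (simp add: Dom_def)
    qed
    hence "connected_component Dom x x1"
      by (intro connected_componentI[of "closed_segment x x1"]) auto
    moreover have "closed_segment x1 o' \<subseteq> Dom"
    proof
      fix z assume "z \<in> closed_segment x1 o'"
      then obtain u where u: "0 \<le> u" "u \<le> 1" "z = (1 - u) *\<^sub>R x1 + u *\<^sub>R o'" by (auto simp: in_segment)
      have "z $ 1 = -1/2" using x1 o2 by (simp add: complex_eq_iff u(3) algebra_simps)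
      moreover have "Q z = Q ((1 - u) *\<^sub>R x)"
        by (rule Q_cong) (simp_all add: u(3) x1 o2)
      moreover have "Q ((1 - u) *\<^sub>R x) < 1/4" using u by (intro Q_star Qx) auto
      ultimately show "z \<in> Dom" by (simp add: Dom_def rho_def)
    qed
    hence "connected_component Dom x1 o'"
      by (intro connected_componentI[of "closed_segment x1 o'"]) auto
    ultimately show ?thesis by (rule connected_component_trans)
  qed
  thus ?thesis
    unfolding connected_iff_connected_component
    by (meson connected_component_sym connected_component_trans)
qed

text \<open>Off the centre \<open>p $ 1 = -1/2\<close> the function grows radially in the first
  coordinate. Over the centre \<open>Q p = 1/4\<close> forces \<open>Nrm\<close> to be at least 1/8,
  and \<open>Q\<close> grows along the ray in the other coordinates.\<close>

lemma rho_gradient: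
  assumes p: "rho p = 0" and L: "(rho has_derivative L) (at p)"
  shows "L \<noteq> (\<lambda>_. 0)"
proof (cases "p $ 1 = -1/2")
  case False
  define h :: "complex ^ 3" where "h = (\<chi> i. if i = 1 then p $ 1 + 1/2 else 0)"
  let ?c = "(cmod (p $ 1 + 1/2))\<^sup>2"
  have nz: "p $ 1 + 1/2 \<noteq> 0"
  proof
    assume "p $ 1 + 1/2 = 0"
    hence "p $ 1 = - (1/2)" by (rule eq_neg_iff_add_eq_0[THEN iffD2])
    with False show False by simp
  qed
  show ?thesis
  proof (rule nonzero_derivative_of_growth[OF L, where c = ?c and d = 1 and h = h])
    fix t :: real assume t: "0 < t" "t < 1"
    have "(p + t *\<^sub>R h) $ 1 + 1/2 = (1 + t) *\<^sub>R (p $ 1 + 1/2)"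
      by (simp add: h_def algebra_simps)
    hence "(cmod ((p + t *\<^sub>R h) $ 1 + 1/2))\<^sup>2 = (1 + t)\<^sup>2 * ?c"
      using t by (simp add: power_mult_distrib)
    moreover have "(1 + t) * ?c \<le> (1 + t)\<^sup>2 * ?c"
      using t by (intro mult_right_mono) (auto simp: power2_eq_square)
    moreover have "Q (p + t *\<^sub>R h) = Q p" by (rule Q_cong) (simp_all add: h_def)
    ultimately show "rho p + ?c * t \<le> rho (p + t *\<^sub>R h)"
      unfolding rho_def by (simp add: algebra_simps)
  qed (use nz in auto)
next
  case True
  define h :: "complex ^ 3" where "h = (\<chi> i. if i = 1 then 0 else p $ i)"
  have Qp: "Q p = 1/4" using p True by (simp add: rho_def)
  have Qh: "Q h = 1/4" unfolding Qp[symmetric] by (rule Q_cong) (simp_all add: h_def)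
  have nh: "norm h < 3"
    by (rule norm_less_3) (use Q_small_norm[of p] Qp in \<open>auto simp: h_def intro: less_imp_le\<close>)
  have N: "Nrm h \<ge> 1/8" using Qh series_small[OF nh] by (simp add: Q_def)
  show ?thesis
  proof (rule nonzero_derivative_of_growth[OF L, where c = "1/4" and d = "(3 - norm h) / 3" and h = h])
    fix t :: real assume t: "0 < t" "t < (3 - norm h) / 3"
    have "t * norm h \<le> t * 3" using t(1) nh by (intro mult_left_mono) auto
    moreover have "norm ((1 + t) *\<^sub>R h) = norm h + t * norm h" using t by (simp add: ring_distribs)
    moreover have "t * 3 < 3 - norm h" using t(2) by simp
    ultimately have "norm ((1 + t) *\<^sub>R h) < 3" by linarith
    from Q_ray[OF this _ N] t have "Q h + t / 4 \<le> Q ((1 + t) *\<^sub>R h)" by simp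
    moreover have "Q ((1 + t) *\<^sub>R h) = Q (p + t *\<^sub>R h)"
      by (rule Q_cong) (simp_all add: h_def scaleR_left_distrib)
    moreover have "(p + t *\<^sub>R h) $ 1 + 1/2 = 0" using True by (simp add: h_def)
    ultimately show "rho p + 1/4 * t \<le> rho (p + t *\<^sub>R h)"
      using p Qh by (simp add: rho_def)
  qed (use nh in auto)
qed

lemma Ck_boundary_Dom: "Ck_boundary (k - 1) Dom"
  unfolding Ck_boundary_def
proof (intro exI[of _ "ball 0 3"] exI[of _ rho] conjI ballI allI impI)
  show "frontier Dom \<subseteq> ball 0 3" using frontier_Dom rho_nonpos_norm by fastforce
  obtain W where "Cbd (Suc (k - 1)) (ball 0 3) W rho" using rho_Cbd k1 by auto
  thus "Ck_on (k - 1) (ball 0 3) rho" by (rule Cbd_imp_Ck_on[OF open_ball])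
  show "Dom \<inter> ball 0 3 = {z \<in> ball 0 3. rho z < 0}" by (auto simp: Dom_def)
  show "L \<noteq> (\<lambda>_. 0)" if "p \<in> frontier Dom" "(rho has_derivative L) (at p)" for p L
    using rho_gradient[OF frontier_Dom] that by blast
qed auto

section \<open>The boundary point, its normal and the discs\<close>

abbreviation e1 :: "complex ^ 3" where "e1 \<equiv> axis 1 1"

lemma rho_derivative_0: "(rho has_derivative (\<lambda>h. inner e1 h)) (at 0)"
proof -
  have re: "((\<lambda>x :: complex ^ 3. Re (x $ i)) has_derivative (\<lambda>h. Re (h $ i))) (at 0)"
    and im: "((\<lambda>x :: complex ^ 3. Im (x $ i)) has_derivative (\<lambda>h. Im (h $ i))) (at 0)" for i
    by (intro bounded_linear_imp_has_derivative bounded_linear_compose[OF bounded_linear_Re]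
        bounded_linear_compose[OF bounded_linear_Im] bounded_linear_vec_nth)+
  have "((\<lambda>x. (f x + 1/2)\<^sup>2 + (g x)\<^sup>2 - 1/4) has_derivative f') (at 0)"
    if "(f has_derivative f') (at 0)" "(g has_derivative g') (at 0)" "f 0 = 0" "g 0 = 0"
    for f g f' g' :: "complex ^ 3 \<Rightarrow> real"
    using that by (auto intro!: derivative_eq_intros)
  from this[OF re im, of 1 1]
  have w: "((\<lambda>x :: complex ^ 3. (Re (x $ 1) + 1/2)\<^sup>2 + (Im (x $ 1))\<^sup>2 - 1/4) has_derivative (\<lambda>h. Re (h $ 1))) (at 0)"
    by simp
  have "((\<lambda>x. ((f x)\<^sup>2 + (g x)\<^sup>2) ^ K) has_derivative (\<lambda>h. 0)) (at 0)"
    if "(f has_derivative f') (at 0)" "(g has_derivative g') (at 0)" "f 0 = 0" "g 0 = 0"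
    for f g f' g' :: "complex ^ 3 \<Rightarrow> real"
    using that K_ge by (auto intro!: derivative_eq_intros simp: power_0_left fun_eq_iff)
  from this[OF re im]
  have n: "((\<lambda>x :: complex ^ 3. ((Re (x $ i))\<^sup>2 + (Im (x $ i))\<^sup>2) ^ K) has_derivative (\<lambda>h. 0)) (at 0)" for i
    by simp
  have "((\<lambda>x. ((Re (x $ 1) + 1/2)\<^sup>2 + (Im (x $ 1))\<^sup>2 - 1/4) + (series x
      + (((Re (x $ 2))\<^sup>2 + (Im (x $ 2))\<^sup>2) ^ K + ((Re (x $ 3))\<^sup>2 + (Im (x $ 3))\<^sup>2) ^ K)))
      has_derivative (\<lambda>h. Re (h $ 1) + (0 + (0 + 0)))) (at 0)"
    by (intro has_derivative_add w n series_derivative_0)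
  moreover have "(\<lambda>x. ((Re (x $ 1) + 1/2)\<^sup>2 + (Im (x $ 1))\<^sup>2 - 1/4) + (series x
      + (((Re (x $ 2))\<^sup>2 + (Im (x $ 2))\<^sup>2) ^ K + ((Re (x $ 3))\<^sup>2 + (Im (x $ 3))\<^sup>2) ^ K))) = rho"
    by (simp add: fun_eq_iff rho_def Q_def Nrm_def power_mult cmod_power2)
  moreover have "(\<lambda>h. Re (h $ 1) + (0 + (0 + 0))) = (\<lambda>h. inner e1 h)"
    by (simp add: fun_eq_iff inner_axis' inner_complex_def)
  ultimately show ?thesis by simp
qed

definition disc :: "nat \<Rightarrow> complex \<Rightarrow> complex ^ 3" where
  "disc \<nu> \<zeta> = (\<chi> i. if i = 1 then - of_real (rad \<nu> ^ (4 * K - 2)) + of_real (rad \<nu> ^ (4 * K - 3)) * \<zeta>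
      else if i = 2 then (of_real (rad \<nu>) * \<zeta>)\<^sup>2 else (of_real (rad \<nu>) * \<zeta>) ^ 3)"

text \<open>The terms \<open>A * Re \<zeta>\<close> of the first coordinate and of
  \<open>series\<close> cancel. What remains is \<open>- dl\<close> plus multiples of
  \<open>T = dl * R\<close>: \<open>73 + 2 * B\<close> from \<open>series\<close>, 2 from
  \<open>Nrm\<close>, 4 from the square of the first coordinate. The choice of \<open>q\<close>
  makes their total smaller than \<open>dl\<close>.\<close>

lemma disc_in_Dom:
  assumes z: "cmod \<zeta> < 1"
  shows "disc \<nu> \<zeta> \<in> Dom"
proof -
  define R where "R = rad \<nu>"
  define x where "x = disc \<nu> \<zeta>"
  define A where "A = R ^ (4 * K - 3)"
  define dl where "dl = R ^ (4 * K - 2)"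
  define T where "T = R ^ (4 * K - 1)"
  have R: "0 < R" "R \<le> 1/100" "R \<le> 1"
    using rad_pos[of \<nu>] rad_le_q[of \<nu>] q_small by (auto simp: R_def)
  have x: "x $ 1 = - of_real dl + of_real A * \<zeta>" "x $ 2 = (of_real R * \<zeta>)\<^sup>2" "x $ 3 = (of_real R * \<zeta>) ^ 3"
    by (simp_all add: x_def disc_def R_def A_def dl_def)
  have Rz: "cmod (of_real R * \<zeta>) \<le> R" using z R by (simp add: norm_mult mult_left_le)
  have pos: "0 < A" "0 < dl" "0 < T" using R by (auto simp: A_def dl_def T_def)
  have dA: "dl \<le> A" unfolding dl_def A_def using R by (intro power_decreasing) auto
  have "A \<le> R ^ 1" unfolding A_def using R K_ge by (intro power_decreasing) auto
  hence AR: "A \<le> R" by simp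
  have x1: "cmod (x $ 1) \<le> 2 * A"
  proof -
    have "cmod (x $ 1) \<le> cmod (- of_real dl) + cmod (of_real A * \<zeta>)" unfolding x by (rule norm_triangle_ineq)
    also have "\<dots> = dl + A * cmod \<zeta>" using pos by (simp add: norm_mult)
    also have "\<dots> \<le> A + A * 1" using pos dA z by (intro add_mono mult_left_mono) auto
    finally show ?thesis by simp
  qed
  have x2: "cmod (x $ 2) \<le> R ^ 2" "cmod (x $ 3) \<le> R ^ 3"
    unfolding x norm_power using Rz by (auto intro!: power_mono)
  have R23: "R ^ 2 \<le> 1" "R ^ 3 \<le> 1" using R by (auto intro: power_le_one)
  have n: "norm x < 3"
    by (rule norm_less_3) (use x1 AR R x2 R23 in linarith)+
  have s: "series x \<le> T * (73 + 2 * B) - A * Re \<zeta>"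
    using series_on_disc[of x \<nu> \<zeta>] x n z by (simp add: R_def A_def T_def)
  have N: "Nrm x \<le> 2 * T"
  proof -
    have "cmod (x $ 2) ^ (2 * K) \<le> (R ^ 2) ^ (2 * K)" "cmod (x $ 3) ^ (2 * K) \<le> (R ^ 3) ^ (2 * K)"
      using x2 by (auto intro!: power_mono)
    moreover have "(R ^ 2) ^ (2 * K) \<le> T" "(R ^ 3) ^ (2 * K) \<le> T"
      unfolding T_def power_mult[symmetric] using R by (auto intro!: power_decreasing)
    ultimately show ?thesis by (simp add: Nrm_def)
  qed
  have "(cmod (x $ 1))\<^sup>2 \<le> (2 * A)\<^sup>2" using x1 by (intro power_mono) auto
  also have "\<dots> = 4 * R ^ (2 * (4 * K - 3))" by (simp add: A_def power_mult_distrib power_mult[symmetric] mult.commute)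
  also have "\<dots> \<le> 4 * T" unfolding T_def using R K_ge by (intro mult_left_mono power_decreasing) auto
  finally have w: "(cmod (x $ 1))\<^sup>2 \<le> 4 * T" .
  have TR: "T = dl * R"
  proof -
    have "4 * K - 1 = Suc (4 * K - 2)" using K_ge by simp
    thus ?thesis by (simp add: T_def dl_def)
  qed
  have "R * (79 + 2 * B) \<le> q * (79 + 2 * B)" using rad_le_q[of \<nu>] B_ge by (intro mult_right_mono) (auto simp: R_def)
  also have "\<dots> < 1" using B_ge by (simp add: q_def)
  finally have "dl * (R * (79 + 2 * B)) < dl * 1" using pos by (intro mult_strict_left_mono)
  hence fin: "T * (79 + 2 * B) < dl" by (simp add: TR mult.assoc)
  have "(cmod (x $ 1 + 1/2))\<^sup>2 - 1/4 = (cmod (x $ 1))\<^sup>2 + Re (x $ 1)"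
    unfolding cmod_power2 by (simp add: power2_eq_square algebra_simps)
  moreover have "Re (x $ 1) = - dl + A * Re \<zeta>" by (simp add: x)
  ultimately have "rho x \<le> T * (79 + 2 * B) - dl"
    using s N w unfolding rho_def Q_def by (simp add: algebra_simps)
  with fin show ?thesis by (simp add: Dom_def x_def)
qed

lemma disc_0: "disc \<nu> 0 = 0 - of_real (rad \<nu> ^ (4 * K - 2)) *s e1"
  by (simp add: disc_def vec_eq_iff axis_def)

lemma holo_disc_disc: "holo_disc (disc \<nu>) Dom"
  unfolding holo_disc_def
proof (intro conjI allI)
  show "(\<lambda>\<zeta>. disc \<nu> \<zeta> $ i) holomorphic_on ball 0 1" for i
    unfolding disc_def by (cases "i = 1"; cases "i = 2") (auto intro!: holomorphic_intros)
  show "disc \<nu> ` ball 0 1 \<subseteq> Dom" using disc_in_Dom by auto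
qed

lemma vderiv0_disc: "vderiv0 (disc \<nu>) = of_real (rad \<nu> ^ (4 * K - 3)) *s e1"
proof -
  have "deriv (\<lambda>\<zeta>. disc \<nu> \<zeta> $ i) 0 = (if i = 1 then of_real (rad \<nu> ^ (4 * K - 3)) else 0)" for i
    by (cases "i = 1"; cases "i = 2"; rule DERIV_imp_deriv; auto simp: disc_def intro!: derivative_eq_intros)
  thus ?thesis by (simp add: vderiv0_def vec_eq_iff axis_def)
qed

lemma kobayashi_disc:
  "kobayashi Dom (0 - of_real (rad \<nu> ^ (4 * K - 2)) *s e1) e1 \<le> 1 / rad \<nu> ^ (4 * K - 3)"
  unfolding kobayashi_def
proof (rule cInf_lower)
  let ?A = "rad \<nu> ^ (4 * K - 3)"
  have "?A > 0" using rad_pos by simp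
  moreover from this have "of_real (1 / ?A) *s (of_real ?A *s e1) = e1"
    using rad_pos[of \<nu>] by (simp add: vec_eq_iff axis_def)
  ultimately show "1 / ?A \<in> {\<alpha>. 0 < \<alpha> \<and> (\<exists>f. holo_disc f Dom \<and> f 0 = 0 - of_real (rad \<nu> ^ (4 * K - 2)) *s e1
      \<and> of_real \<alpha> *s vderiv0 f = e1)}"
    using holo_disc_disc[of \<nu>] disc_0[of \<nu>] vderiv0_disc[of \<nu>] by auto
qed (rule bdd_belowI[of _ 0], auto)

text \<open>This determines \<open>\<epsilon>\<close>: it is the relative gap between the exponents
  of \<open>\<delta>\<close> and of the derivative of the disc.\<close>

lemma rad_powr:
  "(rad \<nu> ^ (4 * K - 2)) powr (1 - 1 / real (4 * K - 2)) = rad \<nu> ^ (4 * K - 3)"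
proof -
  have "real (4 * K - 2) * (1 - 1 / real (4 * K - 2)) = real (4 * K - 3)"
    using K_ge by (simp add: field_simps of_nat_diff)
  thus ?thesis using rad_pos[of \<nu>] by (simp add: powr_realpow[symmetric] powr_powr)
qed

lemma rad_tendsto_0: "rad \<longlonglongrightarrow> 0"
proof (rule tendsto_sandwich[where f = "\<lambda>_. 0" and h = "\<lambda>\<nu>. q ^ Suc \<nu>"])
  show "(\<lambda>\<nu>. q ^ Suc \<nu>) \<longlonglongrightarrow> 0"
    using q_pos q_small by (intro LIMSEQ_Suc LIMSEQ_realpow_zero) auto
  show "\<forall>\<^sub>F \<nu> in sequentially. 0 \<le> rad \<nu>"
    by (intro always_eventually allI) (rule less_imp_le[OF rad_pos])
  show "\<forall>\<^sub>F \<nu> in sequentially. rad \<nu> \<le> q ^ Suc \<nu>"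
    by (intro always_eventually allI) (rule rad_le)
qed auto

lemma zero_in_frontier: "0 \<in> frontier Dom"
proof -
  have "0 \<notin> Dom" by (simp add: Dom_def rho_0)
  moreover have "0 \<in> closure Dom"
  proof -
    have "(\<lambda>\<nu>. disc \<nu> 0) \<longlonglongrightarrow> 0"
    proof (rule vec_tendstoI)
      fix i :: 3
      have "(\<lambda>\<nu>. - of_real (rad \<nu> ^ (4 * K - 2)) :: complex) \<longlonglongrightarrow> - of_real (0 ^ (4 * K - 2))"
        by (intro tendsto_intros rad_tendsto_0)
      thus "(\<lambda>\<nu>. disc \<nu> 0 $ i) \<longlonglongrightarrow> 0 $ i"
        using K_ge by (cases "i = 1"; cases "i = 2") (simp_all add: disc_def power_0_left)
    qed
    moreover have "disc \<nu> 0 \<in> Dom" for \<nu> by (rule disc_in_Dom) simp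
    ultimately show ?thesis by (metis closure_sequential)
  qed
  ultimately show ?thesis using open_Dom by (simp add: frontier_def interior_open)
qed

lemma unit_outward_normal_Dom: "unit_outward_normal Dom 0 n \<longleftrightarrow> n = e1"
proof
  assume "unit_outward_normal Dom 0 n"
  thus "n = e1"
    by (rule unit_outward_normal_unique[OF Dom_def rho_derivative_0 rho_0, rotated]) (simp add: norm_eq_1 inner_axis_axis)
next
  assume "n = e1"
  moreover have "unit_outward_normal Dom 0 e1"
    unfolding unit_outward_normal_def
  proof (intro conjI zero_in_frontier)
    have "open UNIV \<and> 0 \<in> UNIV \<and> Dom \<inter> UNIV = {z \<in> UNIV. rho z < 0} \<and>
        (rho has_derivative (\<lambda>h. inner e1 h)) (at 0) \<and> (\<exists>c>0. \<forall>h. inner e1 h = c * inner e1 h)"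
      using rho_derivative_0 by (auto simp: Dom_def intro: exI[of _ 1])
    thus "\<exists>U \<rho> L. open U \<and> 0 \<in> U \<and> Dom \<inter> U = {z \<in> U. \<rho> z < 0} \<and> (\<rho> has_derivative L) (at 0) \<and>
        (\<exists>c>0. \<forall>h. L h = c * inner e1 h)"
      by (intro exI[of _ UNIV] exI[of _ rho] exI[of _ "\<lambda>h. inner e1 h"])
  qed (simp add: norm_eq_1 inner_axis_axis)
  ultimately show "unit_outward_normal Dom 0 n" by simp
qed

end

theorem theorem3:
  fixes k :: nat
  assumes "k \<ge> 1"
  shows "\<exists>(D :: (complex^3) set) P (\<epsilon>::real) (\<delta> :: nat \<Rightarrow> real).
           domain D \<and> bounded D \<and> pseudoconvex D \<and> Ck_boundary k D \<and>
           P \<in> frontier D \<and> \<epsilon> > 0 \<and>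
           (\<forall>\<nu>. \<delta> \<nu> > 0 \<and> \<delta> (Suc \<nu>) < \<delta> \<nu>) \<and> \<delta> \<longlonglongrightarrow> 0 \<and>
           (\<exists>n. unit_outward_normal D P n) \<and>
           (\<forall>n. unit_outward_normal D P n \<longrightarrow>
              (\<forall>\<nu>. P - of_real (\<delta> \<nu>) *s n \<in> D \<and>
                   kobayashi D (P - of_real (\<delta> \<nu>) *s n) n \<le> 1 / (\<delta> \<nu>) powr (1 - \<epsilon>)))"
proof -
  \<comment> \<open>One order more than requested, to make up for the loss in
    \<open>Cbd_imp_Ck_on\<close>.\<close>
  obtain ramp where ramp: "\<And>S. pgrow (Suc k) UNIV (S :: real set) (\<lambda>_. ramp)"
    "continuous_on UNIV ramp" "\<And>t. t \<le> -1 \<Longrightarrow> ramp t = 0" "\<And>t. t \<ge> 1 \<Longrightarrow> ramp t = t"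
    "\<And>x. \<exists>m. 0 \<le> m \<and> m \<le> 1 \<and> (\<forall>y. ramp x + m * (y - x) \<le> ramp y)"
    using smooth_convex_ramp[where ?'i = real and k = "Suc k"] by blast
  interpret R: smooth_ramp "Suc k" ramp by unfold_locales (use ramp in blast)+
  obtain C m where Cm: "C \<ge> 1" "\<And>s. s \<in> {0..1} \<Longrightarrow> Cbd (Suc k) UNIV (\<lambda>x. C * (1 + norm x) ^ m) (R.Phi s)"
    using R.pgrow_Phi unfolding pgrow_def by blast
  interpret S: cusp_series "Suc k" ramp C m by unfold_locales (use Cm in auto)
  define \<delta> where "\<delta> \<nu> = S.rad \<nu> ^ (4 * S.K - 2)" for \<nu>
  have K: "4 * S.K - 2 > 0" using S.K_ge by simp
  show ?thesis
  proof (rule exI[of _ S.Dom], rule exI[of _ 0], rule exI[of _ "1 / real (4 * S.K - 2)"], rule exI[of _ \<delta>],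
      unfold S.unit_outward_normal_Dom, intro conjI)
    have "S.Dom \<noteq> {}" using S.disc_in_Dom[of 0 0] by auto
    thus "domain S.Dom" by (simp add: domain_def S.open_Dom S.connected_Dom)
    show "pseudoconvex S.Dom"
      by (rule pseudoconvex_sublevel[OF S.psh_on_rho S.Dom_def S.bounded_Dom])
    show "Ck_boundary k S.Dom" using S.Ck_boundary_Dom by simp
    show "\<forall>\<nu>. \<delta> \<nu> > 0 \<and> \<delta> (Suc \<nu>) < \<delta> \<nu>"
      unfolding \<delta>_def using S.rad_pos S.rad_Suc_less K by (auto intro!: power_strict_mono less_imp_le)
    show "\<delta> \<longlonglongrightarrow> 0"
      using tendsto_power[OF S.rad_tendsto_0, of "4 * S.K - 2"] K by (simp add: \<delta>_def[abs_def] power_0_left)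
    show "1 / real (4 * S.K - 2) > 0" using K by simp
    have "0 - of_real (\<delta> \<nu>) *s axis 1 1 \<in> S.Dom" for \<nu>
      using S.disc_in_Dom[of 0 \<nu>] unfolding S.disc_0 \<delta>_def by simp
    moreover have "kobayashi S.Dom (0 - of_real (\<delta> \<nu>) *s axis 1 1) (axis 1 1)
        \<le> 1 / \<delta> \<nu> powr (1 - 1 / real (4 * S.K - 2))" for \<nu>
      unfolding \<delta>_def S.rad_powr by (rule S.kobayashi_disc)
    ultimately show "\<forall>n. n = axis 1 1 \<longrightarrow> (\<forall>\<nu>. 0 - of_real (\<delta> \<nu>) *s n \<in> S.Dom \<and>
        kobayashi S.Dom (0 - of_real (\<delta> \<nu>) *s n) n \<le> 1 / \<delta> \<nu> powr (1 - 1 / real (4 * S.K - 2)))"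
      by blast
  qed (use S.bounded_Dom S.zero_in_frontier in auto)
qed

end
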